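(* For every $n\ge 1$, $$Y^n_0(0,0)=\sup_{\delta\in\mathcal A_n}J(\delta).$$ In addition, there exists a strategy $\delta_n^*\in\mathcal A_n$ which is optimal over $\mathcal A_n$, i.e. $$J(\delta_n^* )=\sup_{\delta\in\mathcal A_n}J(\delta).$$
   Context: Setting. $T>0$; $(\Omega,\mathcal F,\mathbb P)$ is a probability space carrying a standard $d$-dimensional Brownian motion $B=(B_t)_{0\le t\le T}$; $(\mathcal F_t)_{0\le t\le T}$ is the natural filtration of $B$ completed with the $\mathbb P$-null sets of $\mathcal F$; $\mathscr P$ is the $\sigma$-algebra of $\mathcal F_t$-progressively measurable sets on $[0,T]\times\Omega$. $\mathcal H^{2,d}$: $\mathscr P$-measurable $\mathbb R^d$-valued $v$ with $\mathbb E\int_0^T|v_s|^2ds<\infty$. $\mathcal S_c^2$: continuous $\mathscr P$-measurable real processes $Y$ with $\mathbb E[\sup_{t\le T}|Y_t|^2]<\infty$. $\mathcal S_{c,i}^2$: non-decreasing $k\in\mathcal S_c^2$ with $k_0=0$. $L=(L_t)_{0\le t\le T}$ is a $\mathscr P$-measurable $\mathbb R^l$-valued process with $\mathbb E\int_0^T|L_s|^2ds<\infty$. $U\subset\mathbb R^l$ is a finite (nonempty) set. $h:[0,T]\times\Omega\times\mathbb R^l\to[0,\infty)$ is $\mathscr P\otimes\mathcal B(\mathbb R^l)$-measurable with $0\le h\le\gamma$ for a constant $\gamma$. $\psi:U\to[0,\infty)$ satisfies $\inf_{\beta\in U}\psi(\beta)\ge c$ for a constant $c>0$. Strategies. $\mathcal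 A$ is the set of sequences $\delta=(\tau_n,\xi_n)_{n\ge0}$ where $(\tau_n)$ are $\mathcal F_t$-stopping times with $0\le\tau_0\le\tau_1\le\dots\le T$ a.s. and each $\xi_n$ is a $U$-valued $\mathcal F_{\tau_n}$-measurable random variable. $\mathcal D$ is the set of finite strategies: $\delta\in\mathcal A$ with $\mathbb P(\tau_n<T \text{ for all } n\ge0)=0$. For $n\ge 1$, $\mathcal A_n=\{(\tau_m,\xi_m)_{m\ge0}\in\mathcal D:\ \tau_n=T\ \mathbb P\text{-a.s.}\}$. The controlled process is $L^\delta_t=L_t+\sum_{n\ge0}\xi_n\mathbf 1_{[\tau_n\le t]}$ and the reward is $J(\delta)=\mathbb E\big[\int_0^Th(s,L^\delta_s)ds-\sum_{n\ge0}\psi(\xi_n)\mathbf 1_{[\tau_n<T]}\big]$. Approximating processes. For a stopping time $\nu$ with values in $[0,T]$ and an $\mathcal F_\nu$-measurable $\mathbb R^l$-valued random variable $\xi$, $(Y^0(\nu,\xi),Z^0(\nu,\xi))\in\mathcal S_c^2\times\mathcal H^{2,d}$ is the unique solution of $$Y^0_t(\nu,\xi)=\int_t^Th(s,L_s+\xi)\mathbf 1_{[s\ge\nu]}ds-\int_t^TZ^0_s(\nu,\xi)dB_s,\quad 0\le t\le T,$$ and, recursively for $n\ge1$, $(Y^n(\nu,\xi),Z^n(\nu,\xi),K^n(\nu,\xi))\in\mathcal S_c^2\times\mathcal H^{2,d}\times\mathcal S_{c,i}^2$ is the unique solution of the reflected BSDE $$Y^n_t(\nu,\xi)=\int_t^Th(s,L_s+\xi)\mathbf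 1_{[s\ge\nu]}ds+K^n_T(\nu,\xi)-K^n_t(\nu,\xi)-\int_t^TZ^n_s(\nu,\xi)dB_s,$$ $$Y^n_t(\nu,\xi)\ge O^n_t(\nu,\xi):=\max_{\beta\in U}\{-\psi(\beta)+Y^{n-1}_t(\nu,\xi+\beta)\},\quad \int_0^T(Y^n_t(\nu,\xi)-O^n_t(\nu,\xi))dK^n_t(\nu,\xi)=0,\quad 0\le t\le T.$$ $Y^n_0(0,0)$ is the (deterministic) value at time $0$ for $\nu=0$, $\xi=0$. *)

theory Defs
  imports "HOL-Probability.Probability" "HOL-Probability.Stopping_Time"
begin

text \<open>Processes are curried functions \<open>real \<Rightarrow> 'w \<Rightarrow> 'b\<close> (time, scenario).  The time set is
  \<open>{0..T}\<close>; values at other times are never used.\<close>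

section \<open>Brownian motion and its filtration\<close>

definition standard_brownian_motion ::
    "'w measure \<Rightarrow> real \<Rightarrow> (real \<Rightarrow> 'w \<Rightarrow> real ^ 'd::finite) \<Rightarrow> bool" where
  "standard_brownian_motion M T B \<longleftrightarrow>
     (\<forall>t\<in>{0..T}. B t \<in> borel_measurable M) \<and>
     (AE \<omega> in M. B 0 \<omega> = 0) \<and>
     (AE \<omega> in M. continuous_on {0..T} (\<lambda>t. B t \<omega>)) \<and>
     (\<forall>s t. 0 \<le> s \<and> s < t \<and> t \<le> T \<longrightarrow>
        distributed M lborel (\<lambda>\<omega>. B t \<omega> - B s \<omega>)
          (\<lambda>x. ennreal (\<Prod>i\<in>UNIV. normal_density 0 (sqrt (t - s)) (x $ i)))) \<and>
     (\<forall>(m::nat) p. (\<forall>i<m. p i \<le> p (Suc i)) \<and> (\<forall>i\<le>m. p i \<in> {0..T}) \<longrightarrow>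
        prob_space.indep_vars M (\<lambda>_. borel) (\<lambda>i \<omega>. B (p (Suc i)) \<omega> - B (p i) \<omega>) {..<m})"

text \<open>The natural filtration on \<open>{0..T}\<close>, completed with the null sets of \<open>M\<close>.  So that the library
  notions of stopping time (indexed by all of \<open>real\<close>) apply, it is extended by the algebra of time
  \<open>T\<close> after \<open>T\<close> and by the algebra generated by the null sets before \<open>0\<close>.\<close>

definition brownian_filtration ::
    "'w measure \<Rightarrow> real \<Rightarrow> (real \<Rightarrow> 'w \<Rightarrow> real ^ 'd::finite) \<Rightarrow> real \<Rightarrow> 'w measure" where
  "brownian_filtration M T B t =
     sigma (space M)
       ((\<Union>s\<in>{0..min t T}. {B s -` A \<inter> space M | A. A \<in> sets borel}) \<union> null_sets M)"

lemma brownian_generator_Pow: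
  "(\<Union>s\<in>{0..min t T}. {B s -` A \<inter> space M | A. A \<in> sets borel}) \<union> null_sets M
     \<subseteq> Pow (space M)"
  using sets.sets_into_space by (auto simp: null_sets_def)

lemma space_brownian_filtration [simp]: "space (brownian_filtration M T B t) = space M"
  unfolding brownian_filtration_def using brownian_generator_Pow by (rule space_measure_of)

lemma filtration_brownian_filtration: "filtration (space M) (brownian_filtration M T B)"
proof
  fix i j :: real assume "i \<le> j"
  show "sets (brownian_filtration M T B i) \<subseteq> sets (brownian_filtration M T B j)"
    unfolding brownian_filtration_def sets_measure_of[OF brownian_generator_Pow]
    using \<open>i \<le> j\<close> by (intro sigma_sets_mono') force
qed simp

abbreviation stopped_sigma ::
    "'w measure \<Rightarrow> real \<Rightarrow> (real \<Rightarrow> 'w \<Rightarrow> real ^ 'd::finite) \<Rightarrow> ('w \<Rightarrow> real) \<Rightarrow> 'w measure" where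
  "stopped_sigma M T B \<equiv> filtration.pre_sigma (space M) (brownian_filtration M T B)"


section \<open>Spaces of processes\<close>

definition progressive_sigma ::
    "'w measure \<Rightarrow> real \<Rightarrow> (real \<Rightarrow> 'w \<Rightarrow> real ^ 'd::finite) \<Rightarrow> (real \<times> 'w) measure" where
  "progressive_sigma M T B =
     sigma ({0..T} \<times> space M)
       {A. A \<subseteq> {0..T} \<times> space M \<and>
           (\<forall>t\<in>{0..T}. A \<inter> ({0..t} \<times> space M)
              \<in> sets (restrict_space borel {0..t} \<Otimes>\<^sub>M brownian_filtration M T B t))}"

definition progressive ::
    "'w measure \<Rightarrow> real \<Rightarrow> (real \<Rightarrow> 'w \<Rightarrow> real ^ 'd::finite) \<Rightarrow>
     (real \<Rightarrow> 'w \<Rightarrow> 'b::topological_space) \<Rightarrow> bool" where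
  "progressive M T B v \<longleftrightarrow>
     (\<lambda>p. v (fst p) (snd p)) \<in> borel_measurable (progressive_sigma M T B)"

definition H2_sqnorm ::
    "'w measure \<Rightarrow> real \<Rightarrow> (real \<Rightarrow> 'w \<Rightarrow> 'b::real_normed_vector) \<Rightarrow> ennreal" where
  "H2_sqnorm M T v = (\<integral>\<^sup>+\<omega>. (\<integral>\<^sup>+s\<in>{0..T}. ennreal ((norm (v s \<omega>))\<^sup>2) \<partial>lborel) \<partial>M)"

definition H2 ::
    "'w measure \<Rightarrow> real \<Rightarrow> (real \<Rightarrow> 'w \<Rightarrow> real ^ 'd::finite) \<Rightarrow>
     (real \<Rightarrow> 'w \<Rightarrow> 'b::euclidean_space) set" where
  "H2 M T B = {v. progressive M T B v \<and> H2_sqnorm M T v < \<infinity>}"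

definition S2_c ::
    "'w measure \<Rightarrow> real \<Rightarrow> (real \<Rightarrow> 'w \<Rightarrow> real ^ 'd::finite) \<Rightarrow> (real \<Rightarrow> 'w \<Rightarrow> real) set" where
  "S2_c M T B = {y. progressive M T B y \<and>
     (\<forall>\<omega>\<in>space M. continuous_on {0..T} (\<lambda>t. y t \<omega>)) \<and>
     (\<integral>\<^sup>+\<omega>. (SUP t\<in>{0..T}. ennreal (\<bar>y t \<omega>\<bar>\<^sup>2)) \<partial>M) < \<infinity>}"

definition S2_ci ::
    "'w measure \<Rightarrow> real \<Rightarrow> (real \<Rightarrow> 'w \<Rightarrow> real ^ 'd::finite) \<Rightarrow> (real \<Rightarrow> 'w \<Rightarrow> real) set" where
  "S2_ci M T B = {k \<in> S2_c M T B. \<forall>\<omega>\<in>space M. mono_on {0..T} (\<lambda>t. k t \<omega>) \<and> k 0 \<omega> = 0}"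


section \<open>The Ito integral\<close>

text \<open>\<open>simple_integrand M T B m p \<eta>\<close> describes the elementary process
  \<open>\<Sum>j<m. \<eta> j * 1_(p j, p (j+1)]\<close>.\<close>

definition simple_integrand ::
    "'w measure \<Rightarrow> real \<Rightarrow> (real \<Rightarrow> 'w \<Rightarrow> real ^ 'd::finite) \<Rightarrow>
     nat \<Rightarrow> (nat \<Rightarrow> real) \<Rightarrow> (nat \<Rightarrow> 'w \<Rightarrow> real ^ 'd) \<Rightarrow> bool" where
  "simple_integrand M T B m p \<eta> \<longleftrightarrow>
     (\<forall>j<m. p j \<le> p (Suc j)) \<and> (\<forall>j\<le>m. p j \<in> {0..T}) \<and>
     (\<forall>j<m. \<eta> j \<in> borel_measurable (brownian_filtration M T B (p j)) \<and> bounded (\<eta> j ` space M))"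

definition simple_process ::
    "nat \<Rightarrow> (nat \<Rightarrow> real) \<Rightarrow> (nat \<Rightarrow> 'w \<Rightarrow> real ^ 'd::finite) \<Rightarrow> real \<Rightarrow> 'w \<Rightarrow> real ^ 'd" where
  "simple_process m p \<eta> s \<omega> = (\<Sum>j<m. indicator {p j<..p (Suc j)} s *\<^sub>R \<eta> j \<omega>)"

definition simple_integral ::
    "(real \<Rightarrow> 'w \<Rightarrow> real ^ 'd::finite) \<Rightarrow>
     nat \<Rightarrow> (nat \<Rightarrow> real) \<Rightarrow> (nat \<Rightarrow> 'w \<Rightarrow> real ^ 'd) \<Rightarrow> real \<Rightarrow> 'w \<Rightarrow> real" where
  "simple_integral B m p \<eta> t \<omega> =
     (\<Sum>j<m. \<eta> j \<omega> \<bullet> (B (min (p (Suc j)) t) \<omega> - B (min (p j) t) \<omega>))"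

text \<open>\<open>I\<close> is a continuous version of the process \<open>t \<mapsto> \<integral>\<^sub>0\<^sup>t V\<^sub>s dB\<^sub>s\<close>: the \<open>L\<^sup>2\<close>-limit of the integrals of
  elementary processes converging to \<open>V\<close>.  This determines \<open>I\<close> up to indistinguishability.\<close>

definition is_ito_integral ::
    "'w measure \<Rightarrow> real \<Rightarrow> (real \<Rightarrow> 'w \<Rightarrow> real ^ 'd::finite) \<Rightarrow>
     (real \<Rightarrow> 'w \<Rightarrow> real ^ 'd) \<Rightarrow> (real \<Rightarrow> 'w \<Rightarrow> real) \<Rightarrow> bool" where
  "is_ito_integral M T B V I \<longleftrightarrow>
     V \<in> H2 M T B \<and> progressive M T B I \<and>
     (\<forall>\<omega>\<in>space M. continuous_on {0..T} (\<lambda>t. I t \<omega>)) \<and>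
     (\<exists>m p \<eta>. (\<forall>k::nat. simple_integrand M T B (m k) (p k) (\<eta> k)) \<and>
        (\<lambda>k. H2_sqnorm M T (\<lambda>s \<omega>. simple_process (m k) (p k) (\<eta> k) s \<omega> - V s \<omega>))
          \<longlonglongrightarrow> 0 \<and>
        (\<forall>t\<in>{0..T}.
          (\<lambda>k. \<integral>\<^sup>+\<omega>. ennreal ((simple_integral B (m k) (p k) (\<eta> k) t \<omega> - I t \<omega>)\<^sup>2) \<partial>M)
            \<longlonglongrightarrow> 0))"


section \<open>Backward stochastic differential equations\<close>

text \<open>Both equations have terminal value \<open>0\<close> and a generator \<open>g\<close> not depending on the solution.\<close>

definition bsde_solution ::
    "'w measure \<Rightarrow> real \<Rightarrow> (real \<Rightarrow> 'w \<Rightarrow> real ^ 'd::finite) \<Rightarrow> (real \<Rightarrow> 'w \<Rightarrow> real) \<Rightarrow>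
     (real \<Rightarrow> 'w \<Rightarrow> real) \<Rightarrow> (real \<Rightarrow> 'w \<Rightarrow> real ^ 'd) \<Rightarrow> bool" where
  "bsde_solution M T B g y z \<longleftrightarrow>
     y \<in> S2_c M T B \<and> z \<in> H2 M T B \<and>
     (\<exists>I. is_ito_integral M T B z I \<and>
        (AE \<omega> in M. \<forall>t\<in>{0..T}.
           y t \<omega> = (LINT s:{t..T}|lborel. g s \<omega>) - (I T \<omega> - I t \<omega>)))"

text \<open>In the minimality condition the path of \<open>k\<close> is extended by constants outside \<open>{0..T}\<close> to
  form its Stieltjes measure.\<close>

definition rbsde_solution ::
    "'w measure \<Rightarrow> real \<Rightarrow> (real \<Rightarrow> 'w \<Rightarrow> real ^ 'd::finite) \<Rightarrow> (real \<Rightarrow> 'w \<Rightarrow> real) \<Rightarrow>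
     (real \<Rightarrow> 'w \<Rightarrow> real) \<Rightarrow>
     (real \<Rightarrow> 'w \<Rightarrow> real) \<Rightarrow> (real \<Rightarrow> 'w \<Rightarrow> real ^ 'd) \<Rightarrow> (real \<Rightarrow> 'w \<Rightarrow> real) \<Rightarrow> bool" where
  "rbsde_solution M T B g ob y z k \<longleftrightarrow>
     y \<in> S2_c M T B \<and> z \<in> H2 M T B \<and> k \<in> S2_ci M T B \<and>
     (\<exists>I. is_ito_integral M T B z I \<and>
        (AE \<omega> in M. \<forall>t\<in>{0..T}.
           y t \<omega> = (LINT s:{t..T}|lborel. g s \<omega>) + k T \<omega> - k t \<omega> - (I T \<omega> - I t \<omega>))) \<and>
     (AE \<omega> in M. \<forall>t\<in>{0..T}. y t \<omega> \<ge> ob t \<omega>) \<and>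
     (AE \<omega> in M.
        (LINT t:{0..T}|interval_measure (\<lambda>u. k (max 0 (min T u)) \<omega>). y t \<omega> - ob t \<omega>) = 0)"

text \<open>The parameters \<open>(\<nu>, \<xi>)\<close> of the approximating processes.\<close>

definition start_data ::
    "'w measure \<Rightarrow> real \<Rightarrow> (real \<Rightarrow> 'w \<Rightarrow> real ^ 'd::finite) \<Rightarrow>
     ('w \<Rightarrow> real) \<Rightarrow> ('w \<Rightarrow> real ^ 'l::finite) \<Rightarrow> bool" where
  "start_data M T B \<nu> \<xi> \<longleftrightarrow>
     stopping_time (brownian_filtration M T B) \<nu> \<and> (\<forall>\<omega>\<in>space M. \<nu> \<omega> \<in> {0..T}) \<and>
     \<xi> \<in> borel_measurable (stopped_sigma M T B \<nu>)"

definition shifted_running_reward ::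
    "(real \<Rightarrow> 'w \<Rightarrow> real ^ 'l::finite) \<Rightarrow> (real \<Rightarrow> 'w \<Rightarrow> real ^ 'l \<Rightarrow> real) \<Rightarrow>
     ('w \<Rightarrow> real) \<Rightarrow> ('w \<Rightarrow> real ^ 'l) \<Rightarrow> real \<Rightarrow> 'w \<Rightarrow> real" where
  "shifted_running_reward L h \<nu> \<xi> s \<omega> = h s \<omega> (L s \<omega> + \<xi> \<omega>) * indicator {\<nu> \<omega>..} s"

text \<open>The obstacle built from the family \<open>y\<close> of the previous level.\<close>

definition impulse_obstacle ::
    "(real ^ 'l::finite) set \<Rightarrow> (real ^ 'l \<Rightarrow> real) \<Rightarrow>
     (('w \<Rightarrow> real) \<Rightarrow> ('w \<Rightarrow> real ^ 'l) \<Rightarrow> real \<Rightarrow> 'w \<Rightarrow> real) \<Rightarrow>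
     ('w \<Rightarrow> real) \<Rightarrow> ('w \<Rightarrow> real ^ 'l) \<Rightarrow> real \<Rightarrow> 'w \<Rightarrow> real" where
  "impulse_obstacle U \<psi> y \<nu> \<xi> t \<omega> =
     Max ((\<lambda>\<beta>. - \<psi> \<beta> + y \<nu> (\<lambda>\<omega>'. \<xi> \<omega>' + \<beta>) t \<omega>) ` U)"


section \<open>Impulse strategies\<close>

type_synonym ('w, 'l) strategy = "nat \<Rightarrow> ('w \<Rightarrow> real) \<times> ('w \<Rightarrow> real ^ 'l)"

definition strategies ::
    "'w measure \<Rightarrow> real \<Rightarrow> (real \<Rightarrow> 'w \<Rightarrow> real ^ 'd::finite) \<Rightarrow> (real ^ 'l::finite) set \<Rightarrow>
     ('w, 'l) strategy set" where
  "strategies M T B U = {\<delta>.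
     (\<forall>n. stopping_time (brownian_filtration M T B) (fst (\<delta> n))) \<and>
     (AE \<omega> in M. 0 \<le> fst (\<delta> 0) \<omega> \<and>
        (\<forall>n. fst (\<delta> n) \<omega> \<le> fst (\<delta> (Suc n)) \<omega> \<and> fst (\<delta> n) \<omega> \<le> T)) \<and>
     (\<forall>n. snd (\<delta> n) \<in> borel_measurable (stopped_sigma M T B (fst (\<delta> n))) \<and>
        (\<forall>\<omega>\<in>space M. snd (\<delta> n) \<omega> \<in> U))}"

definition finite_strategies ::
    "'w measure \<Rightarrow> real \<Rightarrow> (real \<Rightarrow> 'w \<Rightarrow> real ^ 'd::finite) \<Rightarrow> (real ^ 'l::finite) set \<Rightarrow>
     ('w, 'l) strategy set" where
  "finite_strategies M T B U =
     {\<delta> \<in> strategies M T B U. measure M {\<omega>\<in>space M. \<forall>n. fst (\<delta> n) \<omega> < T} = 0}"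

definition strategies_upto ::
    "'w measure \<Rightarrow> real \<Rightarrow> (real \<Rightarrow> 'w \<Rightarrow> real ^ 'd::finite) \<Rightarrow> (real ^ 'l::finite) set \<Rightarrow> nat \<Rightarrow>
     ('w, 'l) strategy set" where
  "strategies_upto M T B U n =
     {\<delta> \<in> finite_strategies M T B U. AE \<omega> in M. fst (\<delta> n) \<omega> = T}"

text \<open>For finite strategies the two series below have, almost surely and for \<open>t < T\<close>, only finitely
  many nonzero terms.  At \<open>t = T\<close> the first one may diverge, which is irrelevant to the
  \<open>ds\<close>-integral in the reward.  For strategies with at most \<open>n\<close> impulses all quantities in
  the reward are bounded, so its expectation is a genuine one.\<close>

definition controlled ::
    "(real \<Rightarrow> 'w \<Rightarrow> real ^ 'l::finite) \<Rightarrow> ('w, 'l) strategy \<Rightarrow> real \<Rightarrow> 'w \<Rightarrow> real ^ 'l" where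
  "controlled L \<delta> t \<omega> = L t \<omega> + (\<Sum>n. indicator {fst (\<delta> n) \<omega>..} t *\<^sub>R snd (\<delta> n) \<omega>)"

definition reward ::
    "'w measure \<Rightarrow> real \<Rightarrow> (real \<Rightarrow> 'w \<Rightarrow> real ^ 'l::finite) \<Rightarrow>
     (real \<Rightarrow> 'w \<Rightarrow> real ^ 'l \<Rightarrow> real) \<Rightarrow> (real ^ 'l \<Rightarrow> real) \<Rightarrow> ('w, 'l) strategy \<Rightarrow> real" where
  "reward M T L h \<psi> \<delta> =
     (LINT \<omega>|M. (LINT s:{0..T}|lborel. h s \<omega> (controlled L \<delta> s \<omega>))
        - (\<Sum>n. \<psi> (snd (\<delta> n) \<omega>) * indicator {..<T} (fst (\<delta> n) \<omega>)))"

end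

theory Submission
  imports Defs
begin

text \<open>The whole argument rests on one identity.  Let a solution \<open>y\<close> have increasing part \<open>k\<close> and generator
  \<open>g\<close>.  As Ito integrals are martingales, optional stopping gives, for stopping times
  \<open>\<rho> \<le> \<sigma>\<close> and \<open>A \<in> \<F>\<^sub>\<rho>\<close>,
  \<open>E[1\<^sub>A y\<^sub>\<rho>] = E[1\<^sub>A (\<integral>\<^sub>\<rho>\<^sup>\<sigma> g ds + y\<^sub>\<sigma> + k\<^sub>\<sigma> - k\<^sub>\<rho>)]\<close>, and \<open>k\<close> does not grow between \<open>\<rho>\<close> and the first time
  after \<open>\<rho>\<close> at which \<open>y\<close> meets its obstacle.  Applied up to this contact time, the identity yields a
  comparison principle without Ito's formula.  By induction on the level it implies that \<open>Y\<^sup>m(\<nu>, \<xi>)\<close> and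
  \<open>Y\<^sup>m(\<nu>', \<xi>')\<close> agree from any time \<open>\<rho> \<ge> \<nu>, \<nu>'\<close> on, on every \<open>\<F>\<^sub>\<rho>\<close>-event on which \<open>\<xi> = \<xi>'\<close>; since \<open>U\<close> is
  finite, a constant impulse \<open>\<beta>\<close> may thus be replaced by a random one.  With \<open>\<sigma>\<close> the time of the next impulse \<open>\<eta>\<close>,
  the identity becomes \<open>E Y\<^sup>m\<^sup>+\<^sup>1\<^sub>\<nu>(\<nu>, \<xi>) \<ge> E[\<integral>\<^sub>\<nu>\<^sup>\<sigma> h(s, L\<^sub>s + \<xi>) ds - \<psi>(\<eta>) 1[\<sigma> < T] + Y\<^sup>m\<^sub>\<sigma>(\<sigma>, \<xi> + \<eta>)]\<close>, with
  equality when \<open>\<sigma>\<close> is the contact time and \<open>\<eta>\<close> attains the maximum in the obstacle.  Iterating \<open>n\<close> times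
  gives both claims.\<close>

section \<open>Adaptedness and stopping times\<close>

text \<open>For each pair of data, \<open>Y m \<nu> \<xi>\<close> is an arbitrary solution, related
  to the others only through the obstacle, and the null sets involved depend on the pair. Inserting
  a random impulse into a family indexed by constants is therefore not a substitution; this gap is
  what locality closes. It also explains the events of the stopped sigma-algebra: an inequality
  between expectations that holds on all of them is an almost sure inequality at the stopping time,
  and only in that form does it pass through the obstacle to the next level. Optional stopping asks
  for an integrable bound on the whole path of the Ito integral. The equation supplies it, because
  its other terms are bounded or dominated. The horizon is special: a contact time equals
  \<open>T\<close> by default when there is no contact. The identities persist there because all
  values vanish at \<open>T\<close> and an impulse at \<open>T\<close> costs nothing. The dynamic
  programming steps compare expectations; triviality of \<open>F 0\<close> turns the last one into
  the value of \<open>Y n\<close> at time \<open>0\<close>.\<close>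

locale brownian = prob_space M for M :: "'w measure" +
  fixes T :: real and B :: "real \<Rightarrow> 'w \<Rightarrow> real ^ 'd::finite"
  assumes T_pos: "0 < T" and bm: "standard_brownian_motion M T B"
begin

abbreviation F where "F \<equiv> brownian_filtration M T B"

sublocale filt: filtration "space M" F
  by (rule filtration_brownian_filtration)

lemma B_measurable [measurable]: "t \<in> {0..T} \<Longrightarrow> B t \<in> borel_measurable M"
  using bm by (auto simp: standard_brownian_motion_def)

lemma sets_F_subset: "sets (F t) \<subseteq> sets M"
  unfolding brownian_filtration_def sets_measure_of[OF brownian_generator_Pow]
  by (rule sets.sigma_sets_subset) (auto simp: null_sets_def intro!: measurable_sets[OF B_measurable])

lemma null_sets_F: "N \<in> null_sets M \<Longrightarrow> N \<in> sets (F t)"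
  unfolding brownian_filtration_def sets_measure_of[OF brownian_generator_Pow] by blast

lemma F_after_T: "T \<le> t \<Longrightarrow> F t = F T"
  by (simp add: brownian_filtration_def min_def)

lemma subalgebra_F: "subalgebra M (F t)"
  by (simp add: subalgebra_def sets_F_subset)

lemma F_mono: "s \<le> t \<Longrightarrow> sets (F s) \<subseteq> sets (F t)"
  by (rule filt.sets_F_mono)

lemma measurable_F_mono: "f \<in> measurable (F s) N \<Longrightarrow> s \<le> t \<Longrightarrow> f \<in> measurable (F t) N"
  by (rule measurable_from_subalg[where F = "F s"]) (auto simp: subalgebra_def F_mono)

text \<open>The range is imposed in every scenario, because progressive measurability controls a
  process on \<open>[0, T]\<close> only and a process sampled at a stopping time must never leave
  that interval.\<close>

definition stime :: "('w \<Rightarrow> real) \<Rightarrow> bool" where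
  "stime \<tau> \<longleftrightarrow> stopping_time F \<tau> \<and> (\<forall>\<omega>\<in>space M. 0 \<le> \<tau> \<omega> \<and> \<tau> \<omega> \<le> T)"

abbreviation Fs where "Fs \<equiv> stopped_sigma M T B"

lemma stime_stopping: "stime \<tau> \<Longrightarrow> stopping_time F \<tau>"
  by (simp add: stime_def)

lemma stime_range: "stime \<tau> \<Longrightarrow> \<omega> \<in> space M \<Longrightarrow> 0 \<le> \<tau> \<omega>" "stime \<tau> \<Longrightarrow> \<omega> \<in> space M \<Longrightarrow> \<tau> \<omega> \<le> T"
  by (auto simp: stime_def)

lemma stime_const: "c \<in> {0..T} \<Longrightarrow> stime (\<lambda>_. c)"
  by (simp add: stime_def stopping_time_const)

lemma space_Fs [simp]: "space (Fs \<tau>) = space M"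
  by (simp add: filt.space_pre_sigma)

lemma stopping_measurable: "stopping_time F \<tau> \<Longrightarrow> \<tau> \<in> borel_measurable M"
  by (rule measurable_stopping_time[where F = F]) (auto simp: sets_F_subset)

text \<open>Membership in the stopped sigma-algebra constrains only the parts of an event on which
  \<open>\<tau> \<le> t\<close>. As \<open>\<tau>\<close> is real-valued, countably many of these
  parts exhaust the event.\<close>

lemma sets_Fs_subset:
  assumes "stopping_time F \<tau>" shows "sets (Fs \<tau>) \<subseteq> sets M"
proof
  fix A assume A: "A \<in> sets (Fs \<tau>)"
  have "A = (\<Union>n::nat. {\<omega>\<in>A. \<tau> \<omega> \<le> real n})"
    using real_arch_simple[of "\<tau> _"] by blast
  also have "\<dots> \<in> sets M"
    using filt.sets_pre_sigmaD[OF assms A] sets_F_subset by blast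
  finally show "A \<in> sets M" .
qed

lemma subalgebra_Fs: "stopping_time F \<tau> \<Longrightarrow> subalgebra M (Fs \<tau>)"
  by (simp add: subalgebra_def sets_Fs_subset)

lemma Fs_measurable: "stopping_time F \<tau> \<Longrightarrow> f \<in> measurable (Fs \<tau>) N \<Longrightarrow> f \<in> measurable M N"
  using measurable_from_subalg subalgebra_Fs by blast

lemma Fs_mono_measurable:
  assumes "stopping_time F \<tau>" "stopping_time F \<sigma>" "\<And>\<omega>. \<omega> \<in> space M \<Longrightarrow> \<tau> \<omega> \<le> \<sigma> \<omega>"
    and f: "f \<in> measurable (Fs \<tau>) N"
  shows "f \<in> measurable (Fs \<sigma>) N"
proof (rule measurable_from_subalg[OF _ f])
  show "subalgebra (Fs \<sigma>) (Fs \<tau>)"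
    unfolding subalgebra_def space_Fs by (intro conjI refl filt.mono_pre_sigma assms)
qed

text \<open>For \<open>s < t\<close> the event that the capped time is at most \<open>s\<close> lies
  already in \<open>F s\<close>, and for \<open>s \<ge> t\<close> it is everything. Capping is what
  makes a stopping time usable as a time argument inside \<open>F t\<close>.\<close>

lemma min_stopping_measurable:
  assumes "stopping_time F \<tau>" shows "(\<lambda>\<omega>. min (\<tau> \<omega>) t) \<in> borel_measurable (F t)"
proof (rule borel_measurableI_le)
  fix s
  have "{\<omega> \<in> space M. \<tau> \<omega> \<le> s} \<in> sets (F s)"
    using stopping_timeD[OF assms, of s] by (simp add: pred_def)
  then have "s < t \<Longrightarrow> {\<omega> \<in> space M. \<tau> \<omega> \<le> s} \<in> sets (F t)"
    using F_mono[of s t] by auto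
  moreover have "{\<omega> \<in> space (F t). min (\<tau> \<omega>) t \<le> s} = (if t \<le> s then space (F t) else {\<omega> \<in> space M. \<tau> \<omega> \<le> s})"
    by (auto simp: min_le_iff_disj)
  ultimately show "{\<omega> \<in> space (F t). min (\<tau> \<omega>) t \<le> s} \<in> sets (F t)"
    by (cases "t \<le> s") (simp_all only: if_True if_False sets.top not_le)
qed

section \<open>Sampling progressive processes at stopping times\<close>

lemma progressive_generator_Pow:
  "{A. A \<subseteq> {0..T} \<times> space M \<and>
           (\<forall>t\<in>{0..T}. A \<inter> ({0..t} \<times> space M)
              \<in> sets (restrict_space borel {0..t} \<Otimes>\<^sub>M F t))} \<subseteq> Pow ({0..T} \<times> space M)"
  by auto

text \<open>The defining condition of the progressive sigma-algebra, read as measurability of an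
  inclusion map; every sampled process gets its measurability by composing with it.\<close>

lemma measurable_progressive_upto:
  assumes "t \<in> {0..T}"
  shows "(\<lambda>p. p) \<in> measurable (restrict_space borel {0..t} \<Otimes>\<^sub>M F t) (progressive_sigma M T B)"
  unfolding progressive_sigma_def
proof (rule measurable_measure_of[OF progressive_generator_Pow])
  show "(\<lambda>p. p) \<in> space (restrict_space borel {0..t} \<Otimes>\<^sub>M F t) \<rightarrow> {0..T} \<times> space M"
    using assms by (auto simp: space_pair_measure space_restrict_space)
next
  fix A assume "A \<in> {A. A \<subseteq> {0..T} \<times> space M \<and>
           (\<forall>t\<in>{0..T}. A \<inter> ({0..t} \<times> space M)
              \<in> sets (restrict_space borel {0..t} \<Otimes>\<^sub>M F t))}"
  then show "(\<lambda>p. p) -` A \<inter> space (restrict_space borel {0..t} \<Otimes>\<^sub>M F t)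
    \<in> sets (restrict_space borel {0..t} \<Otimes>\<^sub>M F t)"
    using assms by (auto simp: space_pair_measure space_restrict_space)
qed

lemma progressive_stopped_upto:
  assumes "t \<in> {0..T}" and \<sigma>: "\<sigma> \<in> borel_measurable (F t)" "\<And>\<omega>. \<omega> \<in> space M \<Longrightarrow> \<sigma> \<omega> \<in> {0..t}"
  shows "(\<lambda>\<omega>. (\<sigma> \<omega>, \<omega>)) \<in> measurable (F t) (progressive_sigma M T B)"
proof -
  have "(\<lambda>\<omega>. (\<sigma> \<omega>, \<omega>)) \<in> measurable (F t) (restrict_space borel {0..t} \<Otimes>\<^sub>M F t)"
    using \<sigma> by (intro measurable_Pair measurable_restrict_space2) auto
  from measurable_compose[OF this measurable_progressive_upto[OF assms(1)]] show ?thesis by simp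
qed

lemma progressive_F:
  assumes "progressive M T B v" "t \<in> {0..T}" "\<sigma> \<in> borel_measurable (F t)" "\<And>\<omega>. \<omega> \<in> space M \<Longrightarrow> \<sigma> \<omega> \<in> {0..t}"
  shows "(\<lambda>\<omega>. v (\<sigma> \<omega>) \<omega>) \<in> borel_measurable (F t)"
  using measurable_compose[OF progressive_stopped_upto[OF assms(2-4)] assms(1)[unfolded progressive_def]]
  by simp

text \<open>On the event \<open>\<tau> \<le> t\<close> the sampled value is the one at the capped
  time \<open>min \<tau> t\<close>, which is \<open>F t\<close>-measurable. Levels \<open>t\<close>
  outside \<open>[0, T]\<close> give the empty event or the same event as level
  \<open>T\<close>.\<close>

lemma progressive_stopped:
  fixes v :: "real \<Rightarrow> 'w \<Rightarrow> 'b::topological_space"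
  assumes v: "progressive M T B v" and \<tau>: "stime \<tau>"
  shows "(\<lambda>\<omega>. v (\<tau> \<omega>) \<omega>) \<in> borel_measurable (Fs \<tau>)"
proof (rule measurableI)
  fix A :: "'b set" assume A: "A \<in> sets borel"
  let ?X = "(\<lambda>\<omega>. v (\<tau> \<omega>) \<omega>) -` A \<inter> space (Fs \<tau>)"
  note st = stime_stopping[OF \<tau>]
  have main: "{\<omega> \<in> ?X. \<tau> \<omega> \<le> t} \<in> sets (F t)" if t: "t \<in> {0..T}" for t
  proof -
    have "(\<lambda>\<omega>. v (min (\<tau> \<omega>) t) \<omega>) \<in> borel_measurable (F t)"
      using t stime_range[OF \<tau>] by (intro progressive_F[OF v] min_stopping_measurable st) auto
    from measurable_sets[OF this A] have "(\<lambda>\<omega>. v (min (\<tau> \<omega>) t) \<omega>) -` A \<inter> space M \<in> sets (F t)" by simp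
    moreover have "{\<omega>\<in>space M. \<tau> \<omega> \<le> t} \<in> sets (F t)"
      using stopping_timeD[OF st, of t] by (simp add: pred_def)
    moreover have "{\<omega> \<in> ?X. \<tau> \<omega> \<le> t} = ((\<lambda>\<omega>. v (min (\<tau> \<omega>) t) \<omega>) -` A \<inter> space M) \<inter> {\<omega>\<in>space M. \<tau> \<omega> \<le> t}"
      by (auto simp: min_def)
    ultimately show ?thesis by auto
  qed
  show "?X \<in> sets (Fs \<tau>)"
  proof (rule filt.sets_pre_sigmaI[OF st])
    fix t
    consider "t < 0" | "t \<in> {0..T}" | "T < t" by force
    then show "{\<omega> \<in> ?X. \<tau> \<omega> \<le> t} \<in> sets (F t)"
    proof cases
      case 1
      then have "{\<omega> \<in> ?X. \<tau> \<omega> \<le> t} = {}"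
        using stime_range[OF \<tau>] by fastforce
      then show ?thesis by (simp only: sets.empty_sets)
    next
      case 3
      then have "{\<omega> \<in> ?X. \<tau> \<omega> \<le> t} = {\<omega> \<in> ?X. \<tau> \<omega> \<le> T}"
        using stime_range(2)[OF \<tau>] by fastforce
      then show ?thesis using main[of T] T_pos 3 F_after_T[of t] by simp
    qed (rule main)
  qed
qed auto

lemma progressive_stopped_M:
  assumes "progressive M T B v" "stime \<tau>"
  shows "(\<lambda>\<omega>. v (\<tau> \<omega>) \<omega>) \<in> borel_measurable M"
  using Fs_measurable progressive_stopped assms stime_stopping by blast

lemma progressive_adapted:
  "progressive M T B v \<Longrightarrow> t \<in> {0..T} \<Longrightarrow> v t \<in> borel_measurable (F t)"
  using progressive_F[of v t "\<lambda>_. t"] by simp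

lemma measurable_progressive_joint:
  "(\<lambda>p. p) \<in> measurable (restrict_space borel {0..T} \<Otimes>\<^sub>M M) (progressive_sigma M T B)"
proof -
  have "(\<lambda>\<omega>. \<omega>) \<in> measurable M (F T)"
    using sets_F_subset[of T] by (intro measurableI) auto
  then have "(\<lambda>p. (fst p, snd p)) \<in> measurable (restrict_space borel {0..T} \<Otimes>\<^sub>M M) (restrict_space borel {0..T} \<Otimes>\<^sub>M F T)"
    by (intro measurable_Pair measurable_fst measurable_compose[OF measurable_snd])
  from measurable_compose[OF this measurable_progressive_upto[of T]] T_pos show ?thesis by simp
qed

end

section \<open>Brownian increments are independent of the past\<close>

text \<open>The density of an increment is a product over coordinates, whereas integration of
  products over a euclidean space is indexed by its basis.\<close>

lemma prod_Basis_vec: "(\<Prod>b\<in>(Basis :: (real^'d::finite) set). g b) = (\<Prod>j\<in>UNIV. g (axis j 1))"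
proof -
  have "Basis = range (\<lambda>j::'d. axis j (1::real))"
    by (auto simp: Basis_vec_def)
  moreover have "inj (\<lambda>j::'d. axis j (1::real))"
    by (auto simp: inj_on_def axis_eq_axis)
  ultimately show ?thesis using prod.reindex[of "\<lambda>j::'d. axis j (1::real)" UNIV g] by simp
qed

lemma sets_Collect_finite_Ball:
  fixes f :: "'i \<Rightarrow> 'a \<Rightarrow> 'b::topological_space"
  assumes "finite J" "\<And>j. j \<in> J \<Longrightarrow> f j \<in> borel_measurable N" "\<And>j. j \<in> J \<Longrightarrow> Q j \<in> sets borel"
  shows "{x\<in>space N. \<forall>j\<in>J. f j x \<in> Q j} \<in> sets N"
proof (rule sets.sets_Collect_finite_All[OF _ assms(1)])
  fix j assume "j \<in> J"
  from measurable_sets[OF assms(2)[OF this] assms(3)[OF this]]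
  show "{x\<in>space N. f j x \<in> Q j} \<in> sets N" by (simp add: vimage_def Int_def conj_commute)
qed

lemma integrable_normal_product_moment:
  fixes i :: "'d::finite"
  assumes "0 < \<sigma>"
  shows "integrable lborel (\<lambda>x::real^'d. (\<Prod>j\<in>UNIV. normal_density 0 \<sigma> (x $ j)) * x $ i)"
proof (rule integrableI_bounded)
  show "(\<lambda>x::real^'d. (\<Prod>j\<in>UNIV. normal_density 0 \<sigma> (x $ j)) * x $ i) \<in> borel_measurable lborel"
    by measurable
  \<comment> \<open>The extra factor \<open>x $ i\<close> is merged with the density of the
    \<open>i\<close>-th coordinate, so the integrand stays a product and the integral factorises
    into one-dimensional ones.\<close>
  define g where "g b y = ennreal (normal_density 0 \<sigma> y * (if b = axis i 1 then \<bar>y\<bar> else 1))" for b :: "real^'d" and y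
  have "(\<integral>\<^sup>+x. ennreal (norm ((\<Prod>j\<in>UNIV. normal_density 0 \<sigma> (x $ j)) * x $ i)) \<partial>lborel)
     = (\<integral>\<^sup>+x. (\<Prod>b\<in>Basis. g b (x \<bullet> b)) \<partial>lborel)"
  proof (intro nn_integral_cong)
    fix x :: "real^'d"
    have "norm ((\<Prod>j\<in>UNIV. normal_density 0 \<sigma> (x $ j)) * x $ i) = (\<Prod>j\<in>UNIV. normal_density 0 \<sigma> (x $ j) * (if j = i then \<bar>x $ j\<bar> else 1))"
      by (simp add: prod.distrib abs_mult abs_prod)
    then show "ennreal (norm ((\<Prod>j\<in>UNIV. normal_density 0 \<sigma> (x $ j)) * x $ i)) = (\<Prod>b\<in>Basis. g b (x \<bullet> b))"
      by (simp add: g_def prod_Basis_vec inner_axis axis_eq_axis prod_ennreal normal_density_nonneg cong: if_cong)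
  qed
  also have "\<dots> = (\<Prod>b\<in>Basis. \<integral>\<^sup>+y. g b y \<partial>lborel)"
    by (rule nn_integral_lborel_prod) (auto simp: g_def)
  also have "\<dots> < \<infinity>"
  proof -
    have "(\<integral>\<^sup>+y. g b y \<partial>lborel) < \<infinity>" for b
    proof -
      have "integrable lborel (\<lambda>y. normal_density 0 \<sigma> y * (if b = axis i 1 then \<bar>y\<bar> else 1))"
        using integrable_normal_moment_abs[OF assms, of 0 1] integrable_normal_density[OF assms, of 0] by (cases "b = axis i 1") auto
      then show ?thesis
        unfolding g_def by (subst nn_integral_eq_integral) (auto simp: normal_density_nonneg)
    qed
    then show ?thesis by (auto simp: ennreal_prod_eq_top less_top[symmetric] less_le)
  qed
  finally show "(\<integral>\<^sup>+x. ennreal (norm ((\<Prod>j\<in>UNIV. normal_density 0 \<sigma> (x $ j)) * x $ (i::'d))) \<partial>lborel) < \<infinity>" .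
qed

text \<open>The density is even and the coordinate is odd, while Lebesgue measure is invariant under
  reflection at the origin.\<close>

lemma integral_normal_product_moment:
  fixes i :: "'d::finite"
  shows "integral\<^sup>L lborel (\<lambda>x::real^'d. (\<Prod>j\<in>UNIV. normal_density 0 \<sigma> (x $ j)) * x $ i) = 0"
proof -
  let ?f = "\<lambda>x::real^'d. (\<Prod>j\<in>UNIV. normal_density 0 \<sigma> (x $ j)) * x $ i"
  have "(\<integral>x. ?f x \<partial>lborel) = (\<integral>x. ?f x \<partial>(distr lborel borel uminus))"
    using lborel_affine[of "-1" "0 :: real^'d"] by (simp add: density_1)
  also have "\<dots> = (\<integral>x. ?f (- x) \<partial>lborel)"
    by (rule integral_distr) auto
  also have "\<dots> = - (\<integral>x. ?f x \<partial>lborel)"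
    by (simp add: normal_density_def)
  finally show ?thesis by simp
qed

context brownian begin

lemma increment_integrable:
  assumes "0 \<le> s" "s \<le> t" "t \<le> T"
  shows "integrable M (\<lambda>\<omega>. (B t \<omega> - B s \<omega>) $ i)" "(\<integral>\<omega>. (B t \<omega> - B s \<omega>) $ i \<partial>M) = 0"
proof -
  have "integrable M (\<lambda>\<omega>. (B t \<omega> - B s \<omega>) $ i) \<and> (\<integral>\<omega>. (B t \<omega> - B s \<omega>) $ i \<partial>M) = 0"
  proof (cases "s = t")
    case False
    then have D: "distributed M lborel (\<lambda>\<omega>. B t \<omega> - B s \<omega>)
          (\<lambda>x. ennreal (\<Prod>i\<in>UNIV. normal_density 0 (sqrt (t - s)) (x $ i)))" and st: "0 < sqrt (t - s)"
      using assms bm by (auto simp: standard_brownian_motion_def)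
    have 1: "integrable lborel (\<lambda>x. (\<Prod>i\<in>UNIV. normal_density 0 (sqrt (t - s)) (x $ i)) * x $ i) \<longleftrightarrow>
        integrable M (\<lambda>\<omega>. (B t \<omega> - B s \<omega>) $ i)"
      by (rule distributed_integrable[OF D]) (auto intro!: prod_nonneg simp: normal_density_nonneg)
    have 2: "(\<integral>x. (\<Prod>i\<in>UNIV. normal_density 0 (sqrt (t - s)) (x $ i)) * x $ i \<partial>lborel) =
        (\<integral>\<omega>. (B t \<omega> - B s \<omega>) $ i \<partial>M)"
      by (rule distributed_integral[OF D]) (auto intro!: prod_nonneg simp: normal_density_nonneg)
    show ?thesis using 1 2 integrable_normal_product_moment[OF st, of i] integral_normal_product_moment[of "sqrt (t - s)" i] by simp
  qed simp
  then show "integrable M (\<lambda>\<omega>. (B t \<omega> - B s \<omega>) $ i)" "(\<integral>\<omega>. (B t \<omega> - B s \<omega>) $ i \<partial>M) = 0" by auto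
qed

text \<open>The definition of Brownian motion offers independence of consecutive increments along
  one finite grid. Along a grid through all times of \<open>J\<close>, each \<open>B j - B 0\<close>
  is a sum of the earlier increments and \<open>B t - B s\<close> is the last one. Since
  \<open>B 0 = 0\<close> almost surely, \<open>B j - B 0\<close> may be replaced by
  \<open>B j\<close> without changing probabilities.\<close>

lemma cylinder_increment_indep:
  assumes st: "0 \<le> s" "s \<le> t" "t \<le> T" and J: "finite J" "J \<subseteq> {0..s}"
    and Q: "\<And>j. j \<in> J \<Longrightarrow> Q j \<in> sets borel" and R: "R \<in> sets borel"
  shows "prob ({\<omega>\<in>space M. \<forall>j\<in>J. B j \<omega> \<in> Q j} \<inter> ((\<lambda>\<omega>. B t \<omega> - B s \<omega>) -` R \<inter> space M)) =
    prob {\<omega>\<in>space M. \<forall>j\<in>J. B j \<omega> \<in> Q j} * prob ((\<lambda>\<omega>. B t \<omega> - B s \<omega>) -` R \<inter> space M)"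
proof -
  \<comment> \<open>With \<open>0\<close> in the grid the partial sums telescope down to
    \<open>B 0\<close>; with \<open>s\<close>, its largest point, the final increment up to
    \<open>t\<close> starts exactly at \<open>s\<close>.\<close>
  define S where "S = insert 0 (insert s J)"
  define l where "l = sorted_list_of_set S"
  define k where "k = length l"
  define p where "p i = (if i < k then l ! i else t)" for i
  have fS: "finite S" "S \<subseteq> {0..s}" using J st by (auto simp: S_def)
  have l: "sorted l" "set l = S" using fS by (auto simp: l_def)
  have k: "0 < k" using l by (auto simp: k_def S_def)
  have pS: "i < k \<Longrightarrow> p i \<in> S" for i using l by (auto simp: p_def k_def)
  have ex: "\<exists>i<k. p i = j" if "j \<in> S" for j
  proof -
    obtain i where "i < length l" "l ! i = j" using \<open>j \<in> S\<close> unfolding l(2)[symmetric] in_set_conv_nth by blast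
    then show ?thesis by (intro exI[of _ i]) (simp add: p_def k_def)
  qed
  have mono: "i \<le> i' \<Longrightarrow> i' < k \<Longrightarrow> p i \<le> p i'" for i i'
    using l(1) by (auto simp: p_def k_def sorted_nth_mono)
  have p0: "p 0 = 0"
  proof -
    obtain i where "i < k" "p i = 0" using ex[of 0] by (auto simp: S_def)
    then show ?thesis using mono[of 0 i] pS[of 0] k fS(2) by (auto simp: subset_eq)
  qed
  obtain i0 where i0: "i0 < k" "p i0 = s" using ex[of s] by (auto simp: S_def)
  have pk1: "p (k - 1) = s"
  proof -
    have "p (k - 1) \<in> {0..s}" using pS[of "k - 1"] k fS(2) by auto
    moreover have "s \<le> p (k - 1)" using mono[of i0 "k - 1"] i0 by auto
    ultimately show ?thesis by auto
  qed
  have pk: "p k = t" by (simp add: p_def)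
  have "p i \<le> p (Suc i)" if "i < k" for i
  proof (cases "Suc i < k")
    case True then show ?thesis using mono[of i "Suc i"] by auto
  next
    case False then have "Suc i = k" using that by auto
    then show ?thesis using pk pS[OF that] fS st by auto
  qed
  moreover have "p i \<in> {0..T}" if "i \<le> k" for i
    using pS[of i] pk fS st that by (cases "i = k") (auto simp: subset_eq)
  ultimately have ind: "indep_vars (\<lambda>_. borel) (\<lambda>i \<omega>. B (p (Suc i)) \<omega> - B (p i) \<omega>) {..<k}"
    using bm unfolding standard_brownian_motion_def by blast
  define D where "D i \<omega> = B (p (Suc i)) \<omega> - B (p i) \<omega>" for i \<omega>
  have ind: "indep_vars (\<lambda>_. borel) D {..<k}" using ind by (simp add: D_def[abs_def])
  have indr: "indep_var (PiM {..<k-1} (\<lambda>_. borel)) (\<lambda>\<omega>. restrict (\<lambda>i. D i \<omega>) {..<k-1})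
       (PiM {k-1} (\<lambda>_. borel)) (\<lambda>\<omega>. restrict (\<lambda>i. D i \<omega>) {k-1})"
    by (rule indep_var_restrict[OF ind]) (use k in auto)
  have "\<forall>j\<in>J. \<exists>i<k. p i = j" using ex by (auto simp: S_def)
  then obtain idx where idx: "\<And>j. j \<in> J \<Longrightarrow> idx j < k \<and> p (idx j) = j" by metis
  define E1 where "E1 = {x \<in> space (PiM {..<k-1} (\<lambda>_. borel)). \<forall>j\<in>J. (\<Sum>i<idx j. x i) \<in> (Q j :: (real^'d) set)}"
  define E2 where "E2 = {x \<in> space (PiM {k-1} (\<lambda>_. borel)). x (k-1) \<in> (R :: (real^'d) set)}"
  have "(\<lambda>x. \<Sum>i<idx j. x i) \<in> borel_measurable (PiM {..<k-1} (\<lambda>_. borel :: (real^'d) measure))" if "j \<in> J" for j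
    using idx[OF that] by (intro borel_measurable_sum measurable_component_singleton) auto
  then have "E1 \<in> sets (PiM {..<k-1} (\<lambda>_. borel))"
    unfolding E1_def using J Q by (intro sets_Collect_finite_Ball) auto
  moreover have "E2 \<in> sets (PiM {k-1} (\<lambda>_. borel))"
    using R measurable_sets[OF measurable_component_singleton[of "k-1" "{k-1}" "\<lambda>_. borel :: (real^'d) measure"], of R]
    by (simp add: E2_def vimage_def Int_def conj_commute)
  ultimately have eq: "prob ((\<lambda>\<omega>. (\<lambda>i\<in>{..<k-1}. D i \<omega>, \<lambda>i\<in>{k-1}. D i \<omega>)) -` (E1 \<times> E2) \<inter> space M) =
    prob ((\<lambda>\<omega>. \<lambda>i\<in>{..<k-1}. D i \<omega>) -` E1 \<inter> space M) * prob ((\<lambda>\<omega>. \<lambda>i\<in>{k-1}. D i \<omega>) -` E2 \<inter> space M)"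
    by (rule indep_varD[OF indr])
  have X: "D (k - 1) \<omega> = B t \<omega> - B s \<omega>" for \<omega>
    using k pk pk1 by (simp add: D_def)
  have e2: "(\<lambda>\<omega>. \<lambda>i\<in>{k-1}. D i \<omega>) -` E2 \<inter> space M = (\<lambda>\<omega>. B t \<omega> - B s \<omega>) -` R \<inter> space M"
    using X by (auto simp: E2_def space_PiM simp del: One_nat_def)
  have AE0: "AE \<omega> in M. B 0 \<omega> = 0" using bm by (simp add: standard_brownian_motion_def)
  have sum: "(\<Sum>i<idx j. (\<lambda>i\<in>{..<k-1}. D i \<omega>) i) = B j \<omega> - B 0 \<omega>" if "j \<in> J" for j \<omega>
  proof -
    have "(\<Sum>i<idx j. (\<lambda>i\<in>{..<k-1}. D i \<omega>) i) = (\<Sum>i<idx j. D i \<omega>)"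
      using idx[OF that] by (intro sum.cong) auto
    also have "\<dots> = B (p (idx j)) \<omega> - B (p 0) \<omega>"
      unfolding D_def by (rule sum_lessThan_telescope)
    finally show ?thesis using idx[OF that] p0 by simp
  qed
  have e1: "\<omega> \<in> (\<lambda>\<omega>. \<lambda>i\<in>{..<k-1}. D i \<omega>) -` E1 \<inter> space M \<longleftrightarrow> \<omega> \<in> {\<omega>\<in>space M. \<forall>j\<in>J. B j \<omega> - B 0 \<omega> \<in> Q j}" for \<omega>
  proof -
    have "(\<lambda>i\<in>{..<k-1}. D i \<omega>) \<in> space (PiM {..<k-1} (\<lambda>_. borel))" by (simp add: space_PiM)
    then show ?thesis
      unfolding E1_def by (simp only: vimage_eq Int_iff mem_Collect_eq sum cong: ball_cong) auto
  qed
  have m1: "{\<omega>\<in>space M. \<forall>j\<in>J. B j \<omega> - B 0 \<omega> \<in> Q j} \<in> events"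
    using J Q st by (intro sets_Collect_finite_Ball borel_measurable_diff B_measurable) (auto simp: subset_eq)
  have m2: "{\<omega>\<in>space M. \<forall>j\<in>J. B j \<omega> \<in> Q j} \<in> events"
    using J Q st by (intro sets_Collect_finite_Ball B_measurable) (auto simp: subset_eq)
  have m3: "(\<lambda>\<omega>. B t \<omega> - B s \<omega>) -` R \<inter> space M \<in> events"
    using st R by (intro measurable_sets[where A=borel] borel_measurable_diff B_measurable) auto
  have a: "prob {\<omega>\<in>space M. \<forall>j\<in>J. B j \<omega> \<in> Q j} = prob {\<omega>\<in>space M. \<forall>j\<in>J. B j \<omega> - B 0 \<omega> \<in> Q j}"
    using AE0 m1 m2 by (intro finite_measure_eq_AE) auto
  have b: "prob ({\<omega>\<in>space M. \<forall>j\<in>J. B j \<omega> \<in> Q j} \<inter> ((\<lambda>\<omega>. B t \<omega> - B s \<omega>) -` R \<inter> space M)) =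
     prob ({\<omega>\<in>space M. \<forall>j\<in>J. B j \<omega> - B 0 \<omega> \<in> Q j} \<inter> ((\<lambda>\<omega>. B t \<omega> - B s \<omega>) -` R \<inter> space M))"
    using AE0 m1 m2 m3 by (intro finite_measure_eq_AE) auto
  have c: "(\<lambda>\<omega>. (\<lambda>i\<in>{..<k-1}. D i \<omega>, \<lambda>i\<in>{k-1}. D i \<omega>)) -` (E1 \<times> E2) \<inter> space M
     = {\<omega>\<in>space M. \<forall>j\<in>J. B j \<omega> - B 0 \<omega> \<in> Q j} \<inter> ((\<lambda>\<omega>. B t \<omega> - B s \<omega>) -` R \<inter> space M)"
    using e1 e2 by blast
  have e1': "(\<lambda>\<omega>. \<lambda>i\<in>{..<k-1}. D i \<omega>) -` E1 \<inter> space M = {\<omega>\<in>space M. \<forall>j\<in>J. B j \<omega> - B 0 \<omega> \<in> Q j}"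
    using e1 by blast
  show ?thesis using eq unfolding a b c e1' e2 .
qed

text \<open>Cylinder events up to time \<open>s\<close> together with the null sets form an
  intersection-stable generator of \<open>F s\<close>. Null sets are independent of every event,
  cylinders are handled by \<open>cylinder_increment_indep\<close>, and independence extends from
  intersection-stable families to the sigma-algebras that they generate.\<close>

lemma increment_indep:
  assumes st: "0 \<le> s" "s \<le> t" "t \<le> T" and Y: "Y \<in> measurable (F s) N"
    and g: "g \<in> measurable borel N'"
  shows "indep_var N Y N' (\<lambda>\<omega>. g (B t \<omega> - B s \<omega>))"
proof -
  let ?X = "\<lambda>\<omega>. B t \<omega> - B s \<omega>"
  define cyl where "cyl J Q = {\<omega>\<in>space M. \<forall>j\<in>J. B j \<omega> \<in> (Q j :: (real^'d) set)}" for J Q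
  define GC where "GC = {cyl J Q | J Q. finite J \<and> J \<subseteq> {0..s} \<and> (\<forall>j. Q j \<in> sets borel)}"
  define GA where "GA = GC \<union> null_sets M"
  define GB where "GB = {?X -` R \<inter> space M | R. R \<in> sets borel}"
  have Xm: "random_variable borel ?X"
    using st by (intro borel_measurable_diff B_measurable) auto
  have cm: "C \<in> events" if "C \<in> GC" for C
    using that st unfolding GC_def cyl_def
    by (auto intro!: sets_Collect_finite_Ball B_measurable simp: subset_eq)
  have "indep_set GA GB"
  proof (rule indep_setI)
    show "GA \<subseteq> events" using cm by (auto simp: GA_def null_sets_def)
    show "GB \<subseteq> events" using measurable_sets[OF Xm] by (auto simp: GB_def)
    fix C D assume C: "C \<in> GA" and D: "D \<in> GB"
    from D obtain R where R: "R \<in> sets borel" "D = ?X -` R \<inter> space M" by (auto simp: GB_def)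
    show "prob (C \<inter> D) = prob C * prob D"
    proof (cases "C \<in> null_sets M")
      case True
      then have "C \<inter> D \<in> null_sets M"
        using R measurable_sets[OF Xm, of R] by (intro null_set_Int2) auto
      then show ?thesis using True by (simp add: measure_def null_sets_def)
    next
      case False
      then obtain J Q where "C = cyl J Q" "finite J" "J \<subseteq> {0..s}" "\<forall>j. Q j \<in> sets borel"
        using C by (auto simp: GA_def GC_def)
      then show ?thesis using cylinder_increment_indep[OF st, of J Q R] R by (simp add: cyl_def)
    qed
  qed
  moreover have "Int_stable GA"
  proof (rule Int_stableI)
    fix C D assume CD: "C \<in> GA" "D \<in> GA"
    have ev: "C \<in> events" "D \<in> events" using CD cm by (auto simp: GA_def null_sets_def)
    show "C \<inter> D \<in> GA"
    proof (cases "C \<in> null_sets M \<or> D \<in> null_sets M")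
      case True
      then show ?thesis using ev by (auto simp: GA_def intro: null_set_Int1 null_set_Int2)
    next
      case False
      then obtain J Q J' Q' where *: "C = cyl J Q" "finite J" "J \<subseteq> {0..s}" "\<forall>j. Q j \<in> sets borel"
        "D = cyl J' Q'" "finite J'" "J' \<subseteq> {0..s}" "\<forall>j. Q' j \<in> sets borel"
        using CD unfolding GA_def GC_def by auto
      \<comment> \<open>At a time used by only one of the two cylinders, \<open>UNIV\<close> stands
        in for the missing constraint of the other.\<close>
      define R where "R j = (if j \<in> J then Q j else UNIV) \<inter> (if j \<in> J' then Q' j else UNIV)" for j
      have "C \<inter> D = cyl (J \<union> J') R"
        unfolding *(1,5) cyl_def by (auto simp: R_def split: if_splits)
      moreover have "\<forall>j. R j \<in> sets borel" using * by (auto simp: R_def)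
      ultimately have "C \<inter> D \<in> GC"
        unfolding GC_def using * by (intro CollectI exI[of _ "J \<union> J'"] exI[of _ R]) auto
      then show ?thesis by (simp add: GA_def)
    qed
  qed
  moreover have "Int_stable GB"
  proof (rule Int_stableI)
    fix C D assume "C \<in> GB" "D \<in> GB"
    then obtain R R' where "R \<in> sets borel" "C = ?X -` R \<inter> space M" "R' \<in> sets borel" "D = ?X -` R' \<inter> space M"
      by (auto simp: GB_def)
    then show "C \<inter> D \<in> GB" unfolding GB_def by (intro CollectI exI[of _ "R \<inter> R'"]) auto
  qed
  ultimately have ind: "indep_set (sigma_sets (space M) GA) (sigma_sets (space M) GB)"
    by (rule indep_set_sigma_sets)
  have FG: "sets (F s) \<subseteq> sigma_sets (space M) GA"
    unfolding brownian_filtration_def sets_measure_of[OF brownian_generator_Pow]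
  proof (rule sigma_sets_mono, safe)
    fix r and A :: "(real^'d) set" assume r: "r \<in> {0..min s T}" and A: "A \<in> sets borel"
    have "B r -` A \<inter> space M = cyl {r} (\<lambda>_. A)" by (auto simp: cyl_def)
    also have "\<dots> \<in> GC" unfolding GC_def using r A by (intro CollectI exI[of _ "{r}"] exI[of _ "\<lambda>_. A"]) auto
    finally show "B r -` A \<inter> space M \<in> sigma_sets (space M) GA" by (auto simp: GA_def)
  next
    fix A assume "A \<in> null_sets M"
    then show "A \<in> sigma_sets (space M) GA" by (auto simp: GA_def)
  qed
  have YF: "{Y -` A \<inter> space M | A. A \<in> sets N} \<subseteq> sets (F s)"
    using measurable_sets[OF Y] by auto
  have "sigma_sets (space M) {Y -` A \<inter> space M | A. A \<in> sets N} \<subseteq> sets (F s)"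
    using sets.sigma_sets_subset[OF YF] by simp
  moreover have "{(\<lambda>\<omega>. g (?X \<omega>)) -` A \<inter> space M | A. A \<in> sets N'} \<subseteq> GB"
  proof safe
    fix A assume "A \<in> sets N'"
    then have "g -` A \<in> sets borel" using measurable_sets[OF g] by simp
    then show "(\<lambda>\<omega>. g (?X \<omega>)) -` A \<inter> space M \<in> GB"
      unfolding GB_def by (intro CollectI exI[of _ "g -` A"]) auto
  qed
  then have "sigma_sets (space M) {(\<lambda>\<omega>. g (?X \<omega>)) -` A \<inter> space M | A. A \<in> sets N'} \<subseteq> sigma_sets (space M) GB"
    by (rule sigma_sets_mono')
  ultimately have "indep_set (sigma_sets (space M) {Y -` A \<inter> space M | A. A \<in> sets N})
      (sigma_sets (space M) {(\<lambda>\<omega>. g (?X \<omega>)) -` A \<inter> space M | A. A \<in> sets N'})"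
    using ind FG unfolding indep_set_def by (elim indep_sets_mono_sets) (auto split: bool.split)
  then show ?thesis
    unfolding indep_var_eq using measurable_compose[OF Xm g] measurable_from_subalg[OF subalgebra_F Y] by simp
qed

text \<open>By independence the expectation factorises, and the increment is centred.\<close>

lemma increment_integral:
  fixes f :: "'w \<Rightarrow> real"
  assumes st: "0 \<le> s" "s \<le> t" "t \<le> T" and f: "f \<in> borel_measurable (F s)"
    and bd: "\<And>\<omega>. \<omega> \<in> space M \<Longrightarrow> \<bar>f \<omega>\<bar> \<le> C"
  shows "integrable M (\<lambda>\<omega>. f \<omega> * (B t \<omega> - B s \<omega>) $ i)" "(\<integral>\<omega>. f \<omega> * (B t \<omega> - B s \<omega>) $ i \<partial>M) = 0"
proof -
  have ind: "indep_var borel f borel (\<lambda>\<omega>. (B t \<omega> - B s \<omega>) $ i)"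
    by (rule increment_indep[OF st f]) measurable
  have f_int: "integrable M f"
    using measurable_from_subalg[OF subalgebra_F f] bd by (intro integrable_const_bound[of _ C]) auto
  show "integrable M (\<lambda>\<omega>. f \<omega> * (B t \<omega> - B s \<omega>) $ i)"
    by (rule indep_var_integrable[OF ind f_int increment_integrable(1)[OF st]])
  show "(\<integral>\<omega>. f \<omega> * (B t \<omega> - B s \<omega>) $ i \<partial>M) = 0"
    unfolding indep_var_lebesgue_integral[OF ind f_int increment_integrable(1)[OF st]] increment_integrable(2)[OF st] by simp
qed

lemma increment_inner_integral:
  assumes st: "0 \<le> s" "s \<le> t" "t \<le> T" and f: "f \<in> borel_measurable (F s)"
    and bd: "bounded (f ` space M)"
  shows "integrable M (\<lambda>\<omega>. f \<omega> \<bullet> (B t \<omega> - B s \<omega>))" "(\<integral>\<omega>. f \<omega> \<bullet> (B t \<omega> - B s \<omega>) \<partial>M) = 0"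
proof -
  obtain C where C: "\<And>\<omega>. \<omega> \<in> space M \<Longrightarrow> norm (f \<omega>) \<le> C"
    using bd by (auto simp: bounded_iff)
  have i: "(\<lambda>\<omega>. f \<omega> $ i) \<in> borel_measurable (F s)" "\<omega> \<in> space M \<Longrightarrow> \<bar>f \<omega> $ i\<bar> \<le> C" for i \<omega>
    using measurable_compose[OF f, of "\<lambda>x. x $ i" borel] C[of \<omega>] component_le_norm_cart[of "f \<omega>" i] by auto
  note * = increment_integral[OF st i(1) i(2)]
  show "integrable M (\<lambda>\<omega>. f \<omega> \<bullet> (B t \<omega> - B s \<omega>))"
    unfolding inner_vec_def by (intro Bochner_Integration.integrable_sum) (use *(1) in \<open>simp add: inner_real_def\<close>)
  show "(\<integral>\<omega>. f \<omega> \<bullet> (B t \<omega> - B s \<omega>) \<partial>M) = 0"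
    unfolding inner_vec_def inner_real_def
    by (subst Bochner_Integration.integral_sum) (use * in auto)
qed

end

section \<open>Ito integrals are martingales\<close>

text \<open>Passage from the quadratic convergence in the definition of the Ito integral to
  convergence in mean. It integrates the pointwise bound of \<open>\<bar>z\<bar>\<close> by
  \<open>e + z\<^sup>2 / e\<close> over a space of mass one.\<close>

lemma nn_integral_abs_le_of_square:
  fixes Z :: "'a \<Rightarrow> real"
  assumes "prob_space M" and Z: "Z \<in> borel_measurable M" and e: "0 < e"
    and le: "(\<integral>\<^sup>+\<omega>. ennreal ((Z \<omega>)\<^sup>2) \<partial>M) \<le> ennreal (e\<^sup>2)"
  shows "(\<integral>\<^sup>+\<omega>. ennreal \<bar>Z \<omega>\<bar> \<partial>M) \<le> ennreal (2 * e)"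
proof -
  interpret prob_space M by fact
  have "\<bar>z\<bar> \<le> e + (1/e) * z\<^sup>2" for z :: real
  proof -
    have "0 \<le> (\<bar>z\<bar> - e)\<^sup>2" by simp
    then have "2 * \<bar>z\<bar> * e \<le> e * e + z\<^sup>2" by (simp add: power2_diff) (simp add: power2_eq_square)
    moreover have "\<bar>z\<bar> * e \<le> 2 * \<bar>z\<bar> * e" using e by simp
    moreover have "(e + (1/e) * z\<^sup>2) * e = e * e + z\<^sup>2" using e by (simp add: distrib_right)
    ultimately have "\<bar>z\<bar> * e \<le> (e + (1/e) * z\<^sup>2) * e" by linarith
    then show ?thesis using e by simp
  qed
  then have "(\<integral>\<^sup>+\<omega>. ennreal \<bar>Z \<omega>\<bar> \<partial>M) \<le> (\<integral>\<^sup>+\<omega>. ennreal e + ennreal (1/e) * ennreal ((Z \<omega>)\<^sup>2) \<partial>M)"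
    using e by (intro nn_integral_mono) (simp flip: ennreal_mult'' ennreal_plus)
  also have "\<dots> = ennreal e + ennreal (1/e) * (\<integral>\<^sup>+\<omega>. ennreal ((Z \<omega>)\<^sup>2) \<partial>M)"
    using Z by (subst nn_integral_add) (auto simp: nn_integral_cmult emeasure_space_1)
  also have "\<dots> \<le> ennreal e + ennreal (1/e) * ennreal (e\<^sup>2)"
    using le by (intro add_left_mono mult_left_mono) auto
  also have "\<dots> = ennreal (2 * e)"
    using e by (simp add: power2_eq_square flip: ennreal_mult'' ennreal_plus)
  finally show ?thesis .
qed

context brownian begin

text \<open>Cutting the interval from \<open>a\<close> to \<open>b\<close> at \<open>t\<close> and
  at \<open>s\<close> and subtracting leaves its part between \<open>s\<close> and \<open>t\<close>.
  That part starts at \<open>max a s\<close>, when both \<open>\<eta>\<close> and \<open>A\<close>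
  are known, so it is a single increment weighted by the past. If \<open>a\<close> lies beyond
  \<open>t\<close>, nothing remains.\<close>

lemma simple_term_integral:
  assumes "0 \<le> a" "a \<le> b" "b \<le> T" "0 \<le> s" "s \<le> t" "t \<le> T" and A: "A \<in> sets (F s)"
    and \<eta>: "\<eta> \<in> borel_measurable (F a)" "bounded (\<eta> ` space M)"
  shows "integrable M (\<lambda>\<omega>. indicator A \<omega> * (\<eta> \<omega> \<bullet> (B (min b t) \<omega> - B (min a t) \<omega>) - \<eta> \<omega> \<bullet> (B (min b s) \<omega> - B (min a s) \<omega>)))"
    (is "integrable M ?f")
    "(\<integral>\<omega>. indicator A \<omega> * (\<eta> \<omega> \<bullet> (B (min b t) \<omega> - B (min a t) \<omega>) - \<eta> \<omega> \<bullet> (B (min b s) \<omega> - B (min a s) \<omega>)) \<partial>M) = 0"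
proof -
  have "integrable M ?f \<and> integral\<^sup>L M ?f = 0"
  proof (cases "max a s \<le> t")
    case True
    let ?u = "max a s" and ?v = "min t (max b s)"
    let ?g = "\<lambda>\<omega>. indicator A \<omega> *\<^sub>R \<eta> \<omega>"
    have f: "?f \<omega> = ?g \<omega> \<bullet> (B ?v \<omega> - B ?u \<omega>)" for \<omega>
      using True assms(1-6) by (auto simp: min_def max_def inner_diff_right right_diff_distrib)
    have "A \<in> sets (F ?u)" using A F_mono[of s ?u] by auto
    then have g: "?g \<in> borel_measurable (F ?u)"
      using measurable_F_mono[OF \<eta>(1), of ?u] by (intro borel_measurable_scaleR borel_measurable_indicator) auto
    obtain C where C: "\<And>\<omega>. \<omega> \<in> space M \<Longrightarrow> norm (\<eta> \<omega>) \<le> C"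
      using \<eta>(2) by (auto simp: bounded_iff)
    then have "\<And>\<omega>. \<omega> \<in> space M \<Longrightarrow> norm (?g \<omega>) \<le> \<bar>C\<bar>"
      using order_trans[OF norm_ge_zero C] by (auto simp: indicator_def)
    then have bd: "bounded (?g ` space M)" by (auto simp: bounded_iff)
    show ?thesis
      unfolding f using True assms(1-6) by (intro conjI increment_inner_integral g bd) auto
  next
    case False
    then have "min b t = t" "min a t = t" "min b s = s" "min a s = s" using assms(1-6) by auto
    then show ?thesis by simp
  qed
  then show "integrable M ?f" "integral\<^sup>L M ?f = 0" by auto
qed

lemma simple_integral_martingale:
  assumes si: "simple_integrand M T B m p \<eta>" and st: "0 \<le> s" "s \<le> t" "t \<le> T" and A: "A \<in> sets (F s)"
  shows "integrable M (\<lambda>\<omega>. indicator A \<omega> * (simple_integral B m p \<eta> t \<omega> - simple_integral B m p \<eta> s \<omega>))"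
    "(\<integral>\<omega>. indicator A \<omega> * (simple_integral B m p \<eta> t \<omega> - simple_integral B m p \<eta> s \<omega>) \<partial>M) = 0"
proof -
  have eq: "indicator A \<omega> * (simple_integral B m p \<eta> t \<omega> - simple_integral B m p \<eta> s \<omega>) =
    (\<Sum>j<m. indicator A \<omega> * (\<eta> j \<omega> \<bullet> (B (min (p (Suc j)) t) \<omega> - B (min (p j) t) \<omega>) - \<eta> j \<omega> \<bullet> (B (min (p (Suc j)) s) \<omega> - B (min (p j) s) \<omega>)))" for \<omega>
    by (simp only: simple_integral_def sum_subtractf[symmetric] sum_distrib_left)
  have *: "0 \<le> p j" "p j \<le> p (Suc j)" "p (Suc j) \<le> T" "\<eta> j \<in> borel_measurable (F (p j))" "bounded (\<eta> j ` space M)" if "j < m" for j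
    using si that by (auto simp: simple_integrand_def)
  note st' = simple_term_integral[OF *(1-3) st A *(4,5)]
  show "integrable M (\<lambda>\<omega>. indicator A \<omega> * (simple_integral B m p \<eta> t \<omega> - simple_integral B m p \<eta> s \<omega>))"
    unfolding eq by (intro Bochner_Integration.integrable_sum st') auto
  show "(\<integral>\<omega>. indicator A \<omega> * (simple_integral B m p \<eta> t \<omega> - simple_integral B m p \<eta> s \<omega>) \<partial>M) = 0"
    unfolding eq by (subst Bochner_Integration.integral_sum) (use st' in auto)
qed

lemma simple_integral_0:
  assumes "simple_integrand M T B m p \<eta>" shows "simple_integral B m p \<eta> 0 \<omega> = 0"
proof -
  have "min (p j) 0 = 0" if "j \<le> m" for j
    using assms that by (auto simp: simple_integrand_def)
  then show ?thesis by (simp add: simple_integral_def)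
qed

lemma simple_integral_integrable:
  assumes "simple_integrand M T B m p \<eta>" "0 \<le> t" "t \<le> T"
  shows "integrable M (simple_integral B m p \<eta> t)"
proof -
  have "integrable M (\<lambda>\<omega>. indicator (space M) \<omega> * (simple_integral B m p \<eta> t \<omega> - simple_integral B m p \<eta> 0 \<omega>))"
    using simple_integral_martingale(1)[OF assms(1), of 0 t "space M"] assms sets.top[of "F 0"] by simp
  then show ?thesis
    by (rule Bochner_Integration.integrable_cong[THEN iffD1, rotated -1]) (auto simp: simple_integral_0[OF assms(1)])
qed

lemma ito_measurable:
  assumes "is_ito_integral M T B V I" "t \<in> {0..T}" shows "I t \<in> borel_measurable M"
  using assms progressive_adapted[of I t] measurable_from_subalg[OF subalgebra_F] by (auto simp: is_ito_integral_def)

text \<open>Convergence is available at each fixed time. Martingale increments involve two times, so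
  one index is chosen late enough for both.\<close>

lemma ito_approx:
  assumes I: "is_ito_integral M T B V I" and e: "0 < e" and st: "s \<in> {0..T}" "t \<in> {0..T}"
  obtains m p \<eta> where "simple_integrand M T B m p \<eta>"
    "(\<integral>\<^sup>+\<omega>. ennreal \<bar>simple_integral B m p \<eta> s \<omega> - I s \<omega>\<bar> \<partial>M) \<le> ennreal (2 * e)"
    "(\<integral>\<^sup>+\<omega>. ennreal \<bar>simple_integral B m p \<eta> t \<omega> - I t \<omega>\<bar> \<partial>M) \<le> ennreal (2 * e)"
proof -
  obtain m p \<eta> where si: "\<And>k::nat. simple_integrand M T B (m k) (p k) (\<eta> k)"
    and lim: "\<And>t. t \<in> {0..T} \<Longrightarrow> (\<lambda>k. \<integral>\<^sup>+\<omega>. ennreal ((simple_integral B (m k) (p k) (\<eta> k) t \<omega> - I t \<omega>)\<^sup>2) \<partial>M) \<longlonglongrightarrow> 0"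
    using I unfolding is_ito_integral_def by blast
  have "0 < ennreal (e\<^sup>2)" using e by simp
  then have "\<forall>\<^sub>F k in sequentially. (\<integral>\<^sup>+\<omega>. ennreal ((simple_integral B (m k) (p k) (\<eta> k) s \<omega> - I s \<omega>)\<^sup>2) \<partial>M) < ennreal (e\<^sup>2) \<and>
     (\<integral>\<^sup>+\<omega>. ennreal ((simple_integral B (m k) (p k) (\<eta> k) t \<omega> - I t \<omega>)\<^sup>2) \<partial>M) < ennreal (e\<^sup>2)"
    using order_tendstoD(2)[OF lim] st by (intro eventually_conj) auto
  then obtain k where k: "(\<integral>\<^sup>+\<omega>. ennreal ((simple_integral B (m k) (p k) (\<eta> k) s \<omega> - I s \<omega>)\<^sup>2) \<partial>M) \<le> ennreal (e\<^sup>2)"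
     "(\<integral>\<^sup>+\<omega>. ennreal ((simple_integral B (m k) (p k) (\<eta> k) t \<omega> - I t \<omega>)\<^sup>2) \<partial>M) \<le> ennreal (e\<^sup>2)"
    unfolding eventually_sequentially by (meson order.refl less_imp_le)
  have me: "(\<lambda>\<omega>. simple_integral B (m k) (p k) (\<eta> k) r \<omega> - I r \<omega>) \<in> borel_measurable M" if "r \<in> {0..T}" for r
    using simple_integral_integrable[OF si, of r] ito_measurable[OF I that] that by auto
  show ?thesis
    by (rule that[OF si[of k]]; intro nn_integral_abs_le_of_square[OF prob_space_axioms me e] k st)
qed

text \<open>The backward equations see only differences of \<open>I\<close>. This normalisation lets
  the size of \<open>I t\<close> itself be read off from them.\<close>

lemma ito_zero:
  assumes I: "is_ito_integral M T B V I" shows "AE \<omega> in M. I 0 \<omega> = 0"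
proof -
  have "(\<integral>\<^sup>+\<omega>. ennreal \<bar>I 0 \<omega>\<bar> \<partial>M) \<le> ennreal e" if "0 < e" for e
  proof -
    obtain m p \<eta> where "simple_integrand M T B m p \<eta>"
      "(\<integral>\<^sup>+\<omega>. ennreal \<bar>simple_integral B m p \<eta> 0 \<omega> - I 0 \<omega>\<bar> \<partial>M) \<le> ennreal (2 * (e / 2))"
      by (rule ito_approx[OF I, of "e/2" 0 0]) (use \<open>0 < e\<close> T_pos in auto)
    then show ?thesis by (simp add: simple_integral_0)
  qed
  then have "(\<integral>\<^sup>+\<omega>. ennreal \<bar>I 0 \<omega>\<bar> \<partial>M) \<le> 0"
    by - (rule ennreal_le_epsilon, simp only: add_0)
  then have eq: "(\<integral>\<^sup>+\<omega>. ennreal \<bar>I 0 \<omega>\<bar> \<partial>M) = 0" by (simp only: le_zero_eq)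
  have I0: "I 0 \<in> borel_measurable M" using ito_measurable[OF I, of 0] T_pos by simp
  have "(\<lambda>\<omega>. ennreal \<bar>I 0 \<omega>\<bar>) \<in> borel_measurable M" using I0 by measurable
  from nn_integral_0_iff_AE[OF this] eq have "AE \<omega> in M. ennreal \<bar>I 0 \<omega>\<bar> = 0" by blast
  then show ?thesis by eventually_elim simp
qed

text \<open>The property holds for the approximating simple integrals and passes to the limit in
  mean. Integrability of \<open>I s\<close> and \<open>I t\<close> is taken as a premise here; for
  the integral in a backward equation it is derived later from the equation.\<close>

lemma ito_martingale:
  assumes I: "is_ito_integral M T B V I" and st: "0 \<le> s" "s \<le> t" "t \<le> T" and A: "A \<in> sets (F s)"
    and int: "integrable M (I s)" "integrable M (I t)"
  shows "(\<integral>\<omega>. indicator A \<omega> * (I t \<omega> - I s \<omega>) \<partial>M) = 0"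
proof -
  have A': "A \<in> sets M" using A sets_F_subset by auto
  have "\<bar>\<integral>\<omega>. indicator A \<omega> * (I t \<omega> - I s \<omega>) \<partial>M\<bar> \<le> e" if "0 < e" for e
  proof -
    \<comment> \<open>The approximation is within \<open>2 * (e / 4)\<close> in mean at each of the
      two times, hence within \<open>e\<close> in total.\<close>
    obtain m p \<eta> where si: "simple_integrand M T B m p \<eta>"
      and s: "(\<integral>\<^sup>+\<omega>. ennreal \<bar>simple_integral B m p \<eta> s \<omega> - I s \<omega>\<bar> \<partial>M) \<le> ennreal (2 * (e / 4))"
      and t: "(\<integral>\<^sup>+\<omega>. ennreal \<bar>simple_integral B m p \<eta> t \<omega> - I t \<omega>\<bar> \<partial>M) \<le> ennreal (2 * (e / 4))"
      by (rule ito_approx[OF I, of "e/4" s t]) (use \<open>0 < e\<close> st in auto)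
    let ?S = "simple_integral B m p \<eta>"
    have S: "integrable M (?S s)" "integrable M (?S t)" using simple_integral_integrable[OF si] st by auto
    note [measurable] = A' and [simp] = S int
    have "(\<integral>\<omega>. indicator A \<omega> * (I t \<omega> - I s \<omega>) \<partial>M)
       = (\<integral>\<omega>. indicator A \<omega> * ((I t \<omega> - ?S t \<omega>) - (I s \<omega> - ?S s \<omega>)) + indicator A \<omega> * (?S t \<omega> - ?S s \<omega>) \<partial>M)"
      by (intro Bochner_Integration.integral_cong) (auto simp: algebra_simps)
    also have "\<dots> = (\<integral>\<omega>. indicator A \<omega> * ((I t \<omega> - ?S t \<omega>) - (I s \<omega> - ?S s \<omega>)) \<partial>M)"
      using simple_integral_martingale[OF si st A] A' integrable_real_mult_indicator
      by (subst Bochner_Integration.integral_add) (auto intro!: integrable_real_mult_indicator simp: mult.commute[of "indicator _ _"])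
    finally have eq: "(\<integral>\<omega>. indicator A \<omega> * (I t \<omega> - I s \<omega>) \<partial>M) = (\<integral>\<omega>. indicator A \<omega> * ((I t \<omega> - ?S t \<omega>) - (I s \<omega> - ?S s \<omega>)) \<partial>M)" .
    have "integrable M (\<lambda>\<omega>. indicator A \<omega> * ((I t \<omega> - ?S t \<omega>) - (I s \<omega> - ?S s \<omega>)))"
      using A' by (auto intro!: integrable_real_mult_indicator simp: mult.commute[of "indicator _ _"])
    from integral_norm_bound_ennreal[OF this]
    have "ennreal \<bar>\<integral>\<omega>. indicator A \<omega> * ((I t \<omega> - ?S t \<omega>) - (I s \<omega> - ?S s \<omega>)) \<partial>M\<bar>
       \<le> (\<integral>\<^sup>+\<omega>. ennreal \<bar>indicator A \<omega> * ((I t \<omega> - ?S t \<omega>) - (I s \<omega> - ?S s \<omega>))\<bar> \<partial>M)"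
      by simp
    also have "\<dots> \<le> (\<integral>\<^sup>+\<omega>. ennreal \<bar>?S t \<omega> - I t \<omega>\<bar> + ennreal \<bar>?S s \<omega> - I s \<omega>\<bar> \<partial>M)"
      by (intro nn_integral_mono) (auto simp: indicator_def simp flip: ennreal_plus)
    also have "\<dots> = (\<integral>\<^sup>+\<omega>. ennreal \<bar>?S t \<omega> - I t \<omega>\<bar> \<partial>M) + (\<integral>\<^sup>+\<omega>. ennreal \<bar>?S s \<omega> - I s \<omega>\<bar> \<partial>M)"
      using S int by (intro nn_integral_add measurable_compose[OF _ measurable_ennreal] borel_measurable_abs borel_measurable_diff borel_measurable_integrable)
    also have "\<dots> \<le> ennreal (2 * (e/4)) + ennreal (2 * (e/4))" using s t by (intro add_mono)
    also have "\<dots> = ennreal e" using that by (simp flip: ennreal_plus)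
    finally show ?thesis unfolding eq using that by simp
  qed
  then have "\<bar>\<integral>\<omega>. indicator A \<omega> * (I t \<omega> - I s \<omega>) \<partial>M\<bar> \<le> 0"
    by - (rule field_le_epsilon, simp only: add_0)
  then show ?thesis by (simp only: abs_le_zero_iff)
qed

text \<open>The generators of \<open>F 0\<close> are the null sets and the events of
  \<open>B 0\<close>, which is almost surely the constant \<open>0\<close>. Each of them is almost
  surely true or almost surely false, and this dichotomy survives complements and countable
  unions.\<close>

lemma F0_trivial: "A \<in> sets (F 0) \<Longrightarrow> (AE \<omega> in M. \<omega> \<in> A) \<or> (AE \<omega> in M. \<omega> \<notin> A)"
  unfolding brownian_filtration_def sets_measure_of[OF brownian_generator_Pow]
proof (induction rule: sigma_sets.induct)
  case (Basic A)
  have AE0: "AE \<omega> in M. B 0 \<omega> = 0" using bm by (simp add: standard_brownian_motion_def)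
  from Basic consider "A \<in> null_sets M" | Q where "A = B 0 -` Q \<inter> space M" using T_pos by auto
  then show ?case
  proof cases
    case 1 then show ?thesis by (auto dest: AE_not_in)
  next
    case 2
    show ?thesis
    proof (cases "0 \<in> Q")
      case True
      have "AE \<omega> in M. \<omega> \<in> A" using AE0 AE_space by eventually_elim (use 2 True in auto)
      then show ?thesis ..
    next
      case False
      have "AE \<omega> in M. \<omega> \<notin> A" using AE0 by eventually_elim (use 2 False in auto)
      then show ?thesis ..
    qed
  qed
next
  case (Compl A)
  from Compl.IH show ?case
  proof
    assume "AE \<omega> in M. \<omega> \<in> A" then show ?thesis by (intro disjI2) auto
  next
    assume "AE \<omega> in M. \<omega> \<notin> A"
    then have "AE \<omega> in M. \<omega> \<in> space M - A" using AE_space by eventually_elim auto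
    then show ?thesis ..
  qed
next
  case (Union A)
  show ?case
  proof (cases "\<forall>i. AE \<omega> in M. \<omega> \<notin> A i")
    case True
    then have "AE \<omega> in M. \<forall>i. \<omega> \<notin> A i" by (simp add: AE_all_countable)
    then show ?thesis by auto
  next
    case False
    then obtain i where "AE \<omega> in M. \<omega> \<in> A i" using Union.IH by blast
    then have "AE \<omega> in M. \<omega> \<in> (\<Union>i. A i)" by eventually_elim auto
    then show ?thesis ..
  qed
qed simp

text \<open>A variable cannot lie almost surely strictly below or strictly above its own mean. By
  the zero-one law both events then fail almost surely.\<close>

lemma F0_const:
  fixes f :: "'w \<Rightarrow> real"
  assumes f: "f \<in> borel_measurable (F 0)" and int: "integrable M f"
  shows "AE \<omega> in M. f \<omega> = (\<integral>\<omega>. f \<omega> \<partial>M)"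
proof -
  let ?e = "\<integral>\<omega>. f \<omega> \<partial>M"
  have "{\<omega>\<in>space (F 0). f \<omega> < ?e} \<in> sets (F 0)" "{\<omega>\<in>space (F 0). ?e < f \<omega>} \<in> sets (F 0)"
    using f by measurable
  note tr = this[THEN F0_trivial]
  have "\<not> (AE \<omega> in M. f \<omega> < ?e)"
  proof
    assume "AE \<omega> in M. f \<omega> < ?e"
    then have "(\<integral>\<omega>. f \<omega> \<partial>M) < (\<integral>\<omega>. ?e \<partial>M)"
      using int by (intro integral_less_AE_space) (auto simp: emeasure_space_1)
    then show False by (simp add: prob_space)
  qed
  moreover have "\<not> (AE \<omega> in M. ?e < f \<omega>)"
  proof
    assume "AE \<omega> in M. ?e < f \<omega>"
    then have "(\<integral>\<omega>. ?e \<partial>M) < (\<integral>\<omega>. f \<omega> \<partial>M)"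
      using int by (intro integral_less_AE_space) (auto simp: emeasure_space_1)
    then show False by (simp add: prob_space)
  qed
  ultimately have "AE \<omega> in M. \<not> f \<omega> < ?e" "AE \<omega> in M. \<not> ?e < f \<omega>" using tr by auto
  then show ?thesis by eventually_elim auto
qed

text \<open>A supremum over a countable dense set of times is measurable, and by continuity it
  bounds the whole path. Integrability of its square suffices, since a number is at most one plus
  its square.\<close>

lemma S2_c_dominated:
  assumes y: "y \<in> S2_c M T B"
  obtains G where "integrable M G" "AE \<omega> in M. \<forall>t\<in>{0..T}. \<bar>y t \<omega>\<bar> \<le> G \<omega>"
proof -
  obtain D where D: "countable D" "D \<subseteq> {0..T}" "{0..T} \<subseteq> closure D"
    using separable[of "{0..T}"] by blast
  then have cl: "closure D = {0..T}" by (simp add: antisym closure_minimal)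
  have prog: "progressive M T B y" and cont: "\<And>\<omega>. \<omega> \<in> space M \<Longrightarrow> continuous_on {0..T} (\<lambda>t. y t \<omega>)"
    and fin: "(\<integral>\<^sup>+\<omega>. (SUP t\<in>{0..T}. ennreal (\<bar>y t \<omega>\<bar>\<^sup>2)) \<partial>M) < \<infinity>"
    using y by (auto simp: S2_c_def)
  define G2 where "G2 \<omega> = (SUP t\<in>D. ennreal (\<bar>y t \<omega>\<bar>\<^sup>2))" for \<omega>
  have "y t \<in> borel_measurable M" if "t \<in> D" for t
    using progressive_adapted[OF prog, of t] measurable_from_subalg[OF subalgebra_F] that D by blast
  then have G2[measurable]: "G2 \<in> borel_measurable M"
    unfolding G2_def using D(1) by (intro borel_measurable_SUP) auto
  have "(\<integral>\<^sup>+\<omega>. G2 \<omega> \<partial>M) \<le> (\<integral>\<^sup>+\<omega>. (SUP t\<in>{0..T}. ennreal (\<bar>y t \<omega>\<bar>\<^sup>2)) \<partial>M)"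
    unfolding G2_def by (intro nn_integral_mono SUP_subset_mono D) auto
  then have fin: "(\<integral>\<^sup>+\<omega>. G2 \<omega> \<partial>M) < \<infinity>" using fin by (rule le_less_trans)
  then have AE: "AE \<omega> in M. G2 \<omega> \<noteq> \<infinity>" using nn_integral_PInf_AE[OF G2] by auto
  show ?thesis
  proof
    have "(\<integral>\<^sup>+\<omega>. ennreal (enn2real (G2 \<omega>)) \<partial>M) \<le> (\<integral>\<^sup>+\<omega>. G2 \<omega> \<partial>M)"
      by (intro nn_integral_mono) (simp add: ennreal_enn2real_if)
    then show "integrable M (\<lambda>\<omega>. 1 + enn2real (G2 \<omega>))"
      using fin by (intro Bochner_Integration.integrable_add integrableI_bounded) (auto simp: le_less_trans emeasure_space_1)
    show "AE \<omega> in M. \<forall>t\<in>{0..T}. \<bar>y t \<omega>\<bar> \<le> 1 + enn2real (G2 \<omega>)"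
      using AE AE_space
    proof eventually_elim
      case (elim \<omega>)
      have b: "\<bar>y t \<omega>\<bar> \<le> 1 + enn2real (G2 \<omega>)" if "t \<in> D" for t
      proof -
        have "ennreal (\<bar>y t \<omega>\<bar>\<^sup>2) \<le> G2 \<omega>" unfolding G2_def using that by (rule SUP_upper)
        also have "G2 \<omega> = ennreal (enn2real (G2 \<omega>))" using elim(1) by (simp add: less_top)
        finally have "\<bar>y t \<omega>\<bar>\<^sup>2 \<le> enn2real (G2 \<omega>)" by simp
        moreover have "\<bar>y t \<omega>\<bar> \<le> 1 + \<bar>y t \<omega>\<bar>\<^sup>2"
          using zero_le_power2[of "\<bar>y t \<omega>\<bar> - 1"] zero_le_power2[of "\<bar>y t \<omega>\<bar>"] by (simp only: power2_diff) auto
        ultimately show ?thesis by simp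
      qed
      have "continuous_on (closure D) (\<lambda>t. \<bar>y t \<omega>\<bar>)" using cont[OF elim(2)] by (auto simp: cl intro!: continuous_intros)
      then show ?case using continuous_le_on_closure[of D "\<lambda>t. \<bar>y t \<omega>\<bar>" _ "1 + enn2real (G2 \<omega>)"] b cl by blast
    qed
  qed
qed

section \<open>Optional stopping, hitting times and flat Stieltjes measures\<close>

text \<open>Rounding \<open>\<rho>\<close> up to the grid of mesh \<open>T / k\<close> gives a stopping time with finitely many values.\<close>

lemma optional_stopping_grid:
  fixes N :: "real \<Rightarrow> 'w \<Rightarrow> real" and k :: nat
  assumes mart: "\<And>t A. t \<in> {0..T} \<Longrightarrow> A \<in> sets (F t) \<Longrightarrow> (\<integral>\<omega>. indicator A \<omega> * (N T \<omega> - N t \<omega>) \<partial>M) = 0"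
    and int: "\<And>t. t \<in> {0..T} \<Longrightarrow> integrable M (N t)"
    and \<rho>: "stime \<rho>" and A: "A \<in> sets (Fs \<rho>)" and k: "0 < k"
  shows "(\<integral>\<omega>. indicator A \<omega> * (N T \<omega> - N (T * real_of_int \<lceil>\<rho> \<omega> * k / T\<rceil> / k) \<omega>) \<partial>M) = 0"
    "integrable M (\<lambda>\<omega>. indicator A \<omega> * (N T \<omega> - N (T * real_of_int \<lceil>\<rho> \<omega> * k / T\<rceil> / k) \<omega>))"
proof -
  let ?t = "\<lambda>j. T * real j / real k"
  \<comment> \<open>The part of \<open>A\<close> on which \<open>\<rho>\<close> is rounded up to
    \<open>?t j\<close>, known at that time. For \<open>j = 0\<close> the lower limit is negative,
    so the value \<open>\<rho> = 0\<close> is included.\<close>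
  define Aj where "Aj j = {\<omega>\<in>A. \<rho> \<omega> \<le> ?t j} - {\<omega>\<in>A. \<rho> \<omega> \<le> T * (real j - 1) / real k}" for j
  note st = stime_stopping[OF \<rho>]
  have tj: "?t j \<in> {0..T}" if "j \<le> k" for j
    using that T_pos k by (auto simp: field_simps)
  have AjF: "Aj j \<in> sets (F (?t j))" for j
  proof -
    have "T * (real j - 1) / real k \<le> ?t j" using T_pos k by (intro divide_right_mono mult_left_mono) auto
    then show ?thesis
      unfolding Aj_def using filt.sets_pre_sigmaD[OF st A] F_mono by blast
  qed
  have AjM: "Aj j \<in> sets M" for j using AjF sets_F_subset by blast
  have AM: "A \<subseteq> space M" using A sets.sets_into_space by fastforce
  have mem: "\<omega> \<in> Aj j \<longleftrightarrow> \<omega> \<in> A \<and> \<lceil>\<rho> \<omega> * k / T\<rceil> = int j" for \<omega> j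
  proof -
    have "\<lceil>\<rho> \<omega> * k / T\<rceil> = int j \<longleftrightarrow> real j - 1 < \<rho> \<omega> * k / T \<and> \<rho> \<omega> * k / T \<le> real j"
      by (simp add: ceiling_eq_iff)
    also have "\<dots> \<longleftrightarrow> T * (real j - 1) / k < \<rho> \<omega> \<and> \<rho> \<omega> \<le> ?t j"
      using T_pos k by (simp add: field_simps)
    finally show ?thesis by (auto simp: Aj_def)
  qed
  have eq: "indicator A \<omega> * (N T \<omega> - N (T * real_of_int \<lceil>\<rho> \<omega> * k / T\<rceil> / k) \<omega>) =
      (\<Sum>j\<le>k. indicator (Aj j) \<omega> * (N T \<omega> - N (?t j) \<omega>))" if "\<omega> \<in> space M" for \<omega>
  proof (cases "\<omega> \<in> A")
    case True
    define j where "j = nat \<lceil>\<rho> \<omega> * k / T\<rceil>"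
    have r: "0 \<le> \<rho> \<omega>" "\<rho> \<omega> \<le> T" using stime_range[OF \<rho> that] by auto
    have "-1 < \<rho> \<omega> * k / T" using r T_pos k by (auto intro: less_le_trans[of _ 0])
    then have "0 \<le> \<lceil>\<rho> \<omega> * k / T\<rceil>" by simp
    then have j: "\<lceil>\<rho> \<omega> * k / T\<rceil> = int j" by (simp add: j_def)
    have "\<rho> \<omega> * k / T \<le> real k" using r T_pos k by (simp add: field_simps)
    then have "\<lceil>\<rho> \<omega> * k / T\<rceil> \<le> int k" by (simp add: ceiling_le_iff)
    then have jk: "j \<le> k" using j by simp
    have "(\<Sum>i\<le>k. indicator (Aj i) \<omega> * (N T \<omega> - N (?t i) \<omega>)) = (\<Sum>i\<le>k. if i = j then N T \<omega> - N (?t i) \<omega> else 0)"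
      by (intro sum.cong) (auto simp: indicator_def mem True j)
    also have "\<dots> = N T \<omega> - N (?t j) \<omega>" using jk by simp
    finally show ?thesis using True by (simp add: j)
  next
    case False
    then have "indicator (Aj j) \<omega> = (0::real)" for j using mem by (auto simp: indicator_def)
    then show ?thesis using False by simp
  qed
  have intj: "integrable M (\<lambda>\<omega>. indicator (Aj j) \<omega> * (N T \<omega> - N (?t j) \<omega>))" if "j \<le> k" for j
    using int[OF tj[OF that]] int[of T] T_pos AjM[of j]
    by (subst mult.commute) (intro integrable_real_mult_indicator, auto)
  show "integrable M (\<lambda>\<omega>. indicator A \<omega> * (N T \<omega> - N (T * real_of_int \<lceil>\<rho> \<omega> * k / T\<rceil> / k) \<omega>))"
    by (subst Bochner_Integration.integrable_cong[OF refl eq], assumption,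
        intro Bochner_Integration.integrable_sum intj, simp)
  have "(\<integral>\<omega>. indicator A \<omega> * (N T \<omega> - N (T * real_of_int \<lceil>\<rho> \<omega> * k / T\<rceil> / k) \<omega>) \<partial>M)
    = (\<integral>\<omega>. (\<Sum>j\<le>k. indicator (Aj j) \<omega> * (N T \<omega> - N (?t j) \<omega>)) \<partial>M)"
    by (intro Bochner_Integration.integral_cong refl eq)
  also have "\<dots> = (\<Sum>j\<le>k. \<integral>\<omega>. indicator (Aj j) \<omega> * (N T \<omega> - N (?t j) \<omega>) \<partial>M)"
    by (intro Bochner_Integration.integral_sum intj) auto
  also have "\<dots> = 0"
    by (intro sum.neutral ballI mart tj AjF) auto
  finally show "(\<integral>\<omega>. indicator A \<omega> * (N T \<omega> - N (T * real_of_int \<lceil>\<rho> \<omega> * k / T\<rceil> / k) \<omega>) \<partial>M) = 0" .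
qed

text \<open>The rounded times differ from \<open>\<rho>\<close> by at most the mesh, so the sampled
  values converge by path continuity; the bound \<open>2 * G\<close> allows dominated convergence.
  Meshes \<open>T / Suc n\<close> avoid an empty grid.\<close>

lemma optional_stopping:
  fixes N :: "real \<Rightarrow> 'w \<Rightarrow> real"
  assumes prog: "progressive M T B N" and cont: "\<And>\<omega>. \<omega> \<in> space M \<Longrightarrow> continuous_on {0..T} (\<lambda>t. N t \<omega>)"
    and G: "integrable M G" "AE \<omega> in M. \<forall>t\<in>{0..T}. \<bar>N t \<omega>\<bar> \<le> G \<omega>"
    and mart: "\<And>t A. t \<in> {0..T} \<Longrightarrow> A \<in> sets (F t) \<Longrightarrow> (\<integral>\<omega>. indicator A \<omega> * (N T \<omega> - N t \<omega>) \<partial>M) = 0"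
    and \<rho>: "stime \<rho>" and A: "A \<in> sets (Fs \<rho>)"
  shows "integrable M (\<lambda>\<omega>. N (\<rho> \<omega>) \<omega>)" "(\<integral>\<omega>. indicator A \<omega> * (N T \<omega> - N (\<rho> \<omega>) \<omega>) \<partial>M) = 0"
proof -
  have AM: "A \<in> sets M" using A sets_Fs_subset[OF stime_stopping[OF \<rho>]] by auto
  have i: "integrable M (\<lambda>\<omega>. N (\<rho> \<omega>) \<omega>)" if "stime \<rho>" for \<rho>
  proof (rule Bochner_Integration.integrable_bound[OF G(1)])
    show "(\<lambda>\<omega>. N (\<rho> \<omega>) \<omega>) \<in> borel_measurable M" using progressive_stopped_M[OF prog that] .
    show "AE \<omega> in M. norm (N (\<rho> \<omega>) \<omega>) \<le> norm (G \<omega>)"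
      using G(2) AE_space
    proof eventually_elim
      case (elim \<omega>)
      then have "\<bar>N (\<rho> \<omega>) \<omega>\<bar> \<le> G \<omega>" using stime_range[OF that elim(2)] by auto
      then show ?case by simp
    qed
  qed
  show "integrable M (\<lambda>\<omega>. N (\<rho> \<omega>) \<omega>)" by (rule i[OF \<rho>])
  have int: "integrable M (N t)" if "t \<in> {0..T}" for t
    using i[OF stime_const[OF that]] by simp
  let ?r = "\<lambda>n \<omega>. T * real_of_int \<lceil>\<rho> \<omega> * Suc n / T\<rceil> / Suc n"
  let ?f = "\<lambda>n \<omega>. indicator A \<omega> * (N T \<omega> - N (?r n \<omega>) \<omega>)"
  note grid = optional_stopping_grid[where N=N, OF mart int \<rho> A zero_less_Suc]
  have rr: "?r n \<omega> \<in> {0..T}" "\<bar>?r n \<omega> - \<rho> \<omega>\<bar> \<le> T / Suc n" if "\<omega> \<in> space M" for n \<omega>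
  proof -
    have r: "0 \<le> \<rho> \<omega>" "\<rho> \<omega> \<le> T" using stime_range[OF \<rho> that] by auto
    let ?c = "real_of_int \<lceil>\<rho> \<omega> * Suc n / T\<rceil>"
    have "-1 < \<rho> \<omega> * Suc n / T" using r T_pos by (auto intro: less_le_trans[of _ 0])
    then have c0: "0 \<le> ?c" by simp
    have "\<rho> \<omega> * Suc n \<le> T * Suc n" using r by (intro mult_right_mono) auto
    then have "\<rho> \<omega> * Suc n / T \<le> real (Suc n)" using T_pos by (simp add: divide_le_eq mult.commute)
    then have "\<lceil>\<rho> \<omega> * Suc n / T\<rceil> \<le> int (Suc n)" by (simp only: ceiling_le_iff of_int_of_nat_eq)
    then have c1: "?c \<le> Suc n" by linarith
    show "?r n \<omega> \<in> {0..T}" using c0 c1 T_pos by (auto simp: divide_simps)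
    have c: "\<rho> \<omega> * Suc n / T \<le> ?c" "?c < \<rho> \<omega> * Suc n / T + 1" by linarith+
    have "\<rho> \<omega> = T * (\<rho> \<omega> * Suc n / T) / Suc n" using T_pos by simp
    moreover have "T * (\<rho> \<omega> * Suc n / T) / Suc n \<le> ?r n \<omega>"
      using c T_pos by (intro divide_right_mono mult_left_mono) auto
    moreover have "?r n \<omega> \<le> T * (\<rho> \<omega> * Suc n / T + 1) / Suc n"
      using c T_pos by (intro divide_right_mono mult_left_mono) auto
    moreover have "T * (\<rho> \<omega> * Suc n / T + 1) / Suc n = T * (\<rho> \<omega> * Suc n / T) / Suc n + T / Suc n"
      by (simp only: distrib_left add_divide_distrib mult_1_right)
    ultimately show "\<bar>?r n \<omega> - \<rho> \<omega>\<bar> \<le> T / Suc n" by linarith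
  qed
  have "(\<lambda>n. \<integral>\<omega>. ?f n \<omega> \<partial>M) \<longlonglongrightarrow> (\<integral>\<omega>. indicator A \<omega> * (N T \<omega> - N (\<rho> \<omega>) \<omega>) \<partial>M)"
  proof (rule integral_dominated_convergence[where w = "\<lambda>\<omega>. 2 * G \<omega>"])
    show "(\<lambda>\<omega>. indicator A \<omega> * (N T \<omega> - N (\<rho> \<omega>) \<omega>)) \<in> borel_measurable M"
      using i[OF \<rho>] int[of T] T_pos AM by (intro borel_measurable_times borel_measurable_diff) auto
    show "?f n \<in> borel_measurable M" for n
      using grid(2)[of n] by (rule borel_measurable_integrable)
    show "integrable M (\<lambda>\<omega>. 2 * G \<omega>)" using G by simp
    show "AE \<omega> in M. (\<lambda>n. ?f n \<omega>) \<longlonglongrightarrow> indicator A \<omega> * (N T \<omega> - N (\<rho> \<omega>) \<omega>)"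
    proof (rule AE_I2)
      fix \<omega> assume \<omega>: "\<omega> \<in> space M"
      have "(\<lambda>n. T / Suc n) \<longlonglongrightarrow> 0" using LIMSEQ_Suc[OF tendsto_divide_0[OF tendsto_const filterlim_real_at_infinity_sequentially, of T]] by simp
      then have "(\<lambda>n. ?r n \<omega> - \<rho> \<omega>) \<longlonglongrightarrow> 0"
        by (rule Lim_null_comparison[rotated]) (use rr[OF \<omega>] in \<open>auto simp del: of_nat_Suc\<close>)
      then have lim: "(\<lambda>n. ?r n \<omega>) \<longlonglongrightarrow> \<rho> \<omega>" by (simp only: LIM_zero_iff)
      have "(\<lambda>n. N (?r n \<omega>) \<omega>) \<longlonglongrightarrow> N (\<rho> \<omega>) \<omega>"
        using continuous_on_tendsto_compose[OF cont[OF \<omega>] lim] rr[OF \<omega>] stime_range[OF \<rho> \<omega>] by (auto simp del: of_nat_Suc)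
      then show "(\<lambda>n. ?f n \<omega>) \<longlonglongrightarrow> indicator A \<omega> * (N T \<omega> - N (\<rho> \<omega>) \<omega>)"
        by (intro tendsto_intros)
    qed
    show "AE \<omega> in M. norm (?f n \<omega>) \<le> 2 * G \<omega>" for n
      using G(2) AE_space
    proof eventually_elim
      case (elim \<omega>)
      have "\<bar>N T \<omega>\<bar> \<le> G \<omega>" "\<bar>N (?r n \<omega>) \<omega>\<bar> \<le> G \<omega>" using elim(1) rr(1)[OF elim(2), of n] T_pos by auto
      then show ?case by (auto simp: indicator_def simp del: of_nat_Suc)
    qed
  qed
  then have "(\<lambda>n. 0) \<longlonglongrightarrow> (\<integral>\<omega>. indicator A \<omega> * (N T \<omega> - N (\<rho> \<omega>) \<omega>) \<partial>M)"
    by (simp only: grid(1))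
  then show "(\<integral>\<omega>. indicator A \<omega> * (N T \<omega> - N (\<rho> \<omega>) \<omega>) \<partial>M) = 0"
    using LIMSEQ_unique tendsto_const by blast
qed

end

text \<open>Reaching \<open>0\<close> from above is turned into countably many conditions: a
  continuous function on a compact interval attains its infimum, and near-minimal values are already
  taken on a dense set. The interval is parametrised by rationals in \<open>[0, 1]\<close>, so that
  this countable set stays the same when \<open>a\<close> becomes random.\<close>

lemma closed_hit_exists:
  fixes X :: "real \<Rightarrow> real"
  assumes c: "continuous_on {a..b} X" and ab: "a \<le> b"
  shows "(\<exists>s\<in>{a..b}. X s \<le> 0) \<longleftrightarrow> (\<forall>n::nat. \<exists>q\<in>\<rat>\<inter>{0..1}. X (a + q * (b - a)) < 1 / Suc n)" (is "?l \<longleftrightarrow> ?r")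
proof -
  let ?g = "\<lambda>q. a + q * (b - a)"
  have gr: "?g q \<in> {a..b}" if "q \<in> {0..1}" for q
  proof -
    have "0 \<le> q * (b - a)" "q * (b - a) \<le> 1 * (b - a)"
      using that ab mult_right_mono[of q 1 "b - a"] by auto
    then show ?thesis by auto
  qed
  show ?thesis
  proof
    have cg: "continuous_on {0..1} (\<lambda>q. X (?g q))"
      by (rule continuous_on_compose2[OF c]) (auto intro!: continuous_intros gr)
    assume ?l
    then obtain s where s: "a \<le> s" "s \<le> b" "X s \<le> 0" by auto
    show ?r
    proof
      fix n :: nat
      obtain u where u: "u \<in> {0..1}" "?g u = s"
      proof (cases "a = b")
        case True then show ?thesis using that[of 0] s by auto
      next
        case False then show ?thesis using that[of "(s - a) / (b - a)"] s ab by (auto simp: field_simps)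
      qed
      show "\<exists>q\<in>\<rat>\<inter>{0..1}. X (?g q) < 1 / Suc n"
      proof (rule ccontr)
        assume "\<not> ?thesis"
        then have *: "1 / Suc n \<le> X (?g q)" if "q \<in> \<rat> \<inter> {0..1}" for q using that by force
        have cl: "closure (\<rat> \<inter> {0..1}) = {0..1::real}"
          using closure_convex_Int_superset[of "{0..1::real}" \<rat>] by (simp add: Rats_closure_real Int_commute)
        have "1 / Suc n \<le> X (?g u)"
          using continuous_ge_on_closure[of "\<rat> \<inter> {0..1}" "\<lambda>q. X (?g q)" u "1 / Suc n"] cg * u cl by auto
        moreover have "0 < 1 / real (Suc n)" by simp
        ultimately show False using s(3) unfolding u(2) by linarith
      qed
    qed
  next
    assume r: ?r
    obtain s where s: "s \<in> {a..b}" "\<And>t. t \<in> {a..b} \<Longrightarrow> X s \<le> X t"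
      using continuous_attains_inf[OF compact_Icc _ c] ab by auto
    have "X s \<le> 0"
    proof (rule ccontr)
      assume "\<not> ?thesis"
      then obtain n where "1 / Suc n < X s" using nat_approx_posE[of "X s"] by auto
      moreover obtain q where "q \<in> \<rat> \<inter> {0..1}" "X (?g q) < 1 / Suc n" using r by blast
      ultimately show False using s(2)[OF gr[of q]] by auto
    qed
    then show ?l using s by auto
  qed
qed

context brownian begin

text \<open>Inserting \<open>T\<close> gives the infimum a default value. Hence
  \<open>hit \<rho> X \<omega> = T\<close> alone does not mean that \<open>X\<close> has reached
  \<open>0\<close>.\<close>

definition hit :: "('w \<Rightarrow> real) \<Rightarrow> (real \<Rightarrow> 'w \<Rightarrow> real) \<Rightarrow> 'w \<Rightarrow> real" where
  "hit \<rho> X \<omega> = Inf (insert T {t\<in>{\<rho> \<omega>..T}. X t \<omega> \<le> 0})"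

text \<open>The hitting set is closed by continuity, so the infimum belongs to it. The last claim
  stops short of \<open>t = T\<close>, where its left side always holds because of the default
  value.\<close>

lemma hit_props:
  assumes c: "continuous_on {0..T} (\<lambda>t. X t \<omega>)" and r: "0 \<le> \<rho> \<omega>" "\<rho> \<omega> \<le> T"
  shows "\<rho> \<omega> \<le> hit \<rho> X \<omega>" "hit \<rho> X \<omega> \<le> T"
    "hit \<rho> X \<omega> < T \<Longrightarrow> X (hit \<rho> X \<omega>) \<omega> \<le> 0"
    "\<And>t. \<rho> \<omega> \<le> t \<Longrightarrow> t < hit \<rho> X \<omega> \<Longrightarrow> 0 < X t \<omega>"
    "\<And>t. t < T \<Longrightarrow> hit \<rho> X \<omega> \<le> t \<longleftrightarrow> (\<exists>s\<in>{\<rho> \<omega>..t}. X s \<omega> \<le> 0)"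
proof -
  let ?S = "insert T {t\<in>{\<rho> \<omega>..T}. X t \<omega> \<le> 0}"
  have "closed {t\<in>{\<rho> \<omega>..T}. X t \<omega> \<le> 0}"
    using continuous_closed_preimage[of "{\<rho> \<omega>..T}" "\<lambda>t. X t \<omega>" "{..0}"] continuous_on_subset[OF c, of "{\<rho> \<omega>..T}"] r
    by (auto simp: vimage_def Int_def)
  then have cl: "closed ?S" by simp
  have bb: "bdd_below ?S" by (rule bdd_belowI[of _ "\<rho> \<omega>"]) (use r in auto)
  have inS: "hit \<rho> X \<omega> \<in> ?S" unfolding hit_def by (intro closed_contains_Inf bb cl) auto
  have low: "hit \<rho> X \<omega> \<le> t" if "t \<in> ?S" for t unfolding hit_def using that bb by (rule cInf_lower)
  show 1: "\<rho> \<omega> \<le> hit \<rho> X \<omega>" "hit \<rho> X \<omega> \<le> T"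
    and 2: "hit \<rho> X \<omega> < T \<Longrightarrow> X (hit \<rho> X \<omega>) \<omega> \<le> 0"
    using inS r by auto
  show "0 < X t \<omega>" if "\<rho> \<omega> \<le> t" "t < hit \<rho> X \<omega>" for t
    using low[of t] 1 that by (cases "0 < X t \<omega>") auto
  show "\<And>t. t < T \<Longrightarrow> hit \<rho> X \<omega> \<le> t \<longleftrightarrow> (\<exists>s\<in>{\<rho> \<omega>..t}. X s \<omega> \<le> 0)"
  proof
    fix t assume t: "t < T" "hit \<rho> X \<omega> \<le> t" then show "\<exists>s\<in>{\<rho> \<omega>..t}. X s \<omega> \<le> 0"
      using 1 2 by (intro bexI[of _ "hit \<rho> X \<omega>"]) auto
  next
    fix t assume t: "t < T" "\<exists>s\<in>{\<rho> \<omega>..t}. X s \<omega> \<le> 0" then show "hit \<rho> X \<omega> \<le> t"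
    proof -
      from t obtain s where "\<rho> \<omega> \<le> s" "s \<le> t" "X s \<omega> \<le> 0" by auto
      then show ?thesis using low[of s] t by auto
    qed
  qed
qed

lemma hit_stime:
  assumes prog: "progressive M T B X" and cont: "\<And>\<omega>. \<omega> \<in> space M \<Longrightarrow> continuous_on {0..T} (\<lambda>t. X t \<omega>)"
    and \<rho>: "stime \<rho>"
  shows "stime (hit \<rho> X)"
  unfolding stime_def
proof (intro conjI ballI stopping_timeI)
  fix \<omega> assume \<omega>: "\<omega> \<in> space M"
  note h = hit_props[where X=X and \<rho>=\<rho>, OF cont[OF \<omega>] stime_range[OF \<rho> \<omega>]]
  show "0 \<le> hit \<rho> X \<omega>" "hit \<rho> X \<omega> \<le> T" using h(1,2) stime_range[OF \<rho> \<omega>] by auto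
next
  fix t
  note st = stime_stopping[OF \<rho>]
  show "Measurable.pred (F t) (\<lambda>\<omega>. hit \<rho> X \<omega> \<le> t)"
  proof (cases "0 \<le> t \<and> t < T")
    case True
    then have t: "t \<in> {0..T}" by auto
    \<comment> \<open>With \<open>\<rho>\<close> capped at \<open>t\<close>, the sampling times
      \<open>?m + q * (t - ?m)\<close> are \<open>F t\<close>-measurable and lie in
      \<open>[0, t]\<close> in every scenario. Where \<open>\<rho> \<le> t\<close>, they are dense
      in the interval from \<open>\<rho>\<close> to \<open>t\<close>.\<close>
    let ?m = "\<lambda>\<omega>. min (\<rho> \<omega>) t"
    have m: "(\<lambda>\<omega>. ?m \<omega> + q * (t - ?m \<omega>)) \<in> borel_measurable (F t)" for q
      using min_stopping_measurable[OF st] by measurable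
    have eq: "hit \<rho> X \<omega> \<le> t \<longleftrightarrow> \<rho> \<omega> \<le> t \<and> (\<forall>n::nat. \<exists>q\<in>\<rat>\<inter>{0..1}. X (?m \<omega> + q * (t - ?m \<omega>)) \<omega> < 1 / Suc n)"
      if \<omega>: "\<omega> \<in> space (F t)" for \<omega>
    proof (cases "\<rho> \<omega> \<le> t")
      case le: True
      have "hit \<rho> X \<omega> \<le> t \<longleftrightarrow> (\<exists>s\<in>{\<rho> \<omega>..t}. X s \<omega> \<le> 0)"
        using hit_props(5)[where X=X and \<rho>=\<rho>, OF cont stime_range[OF \<rho>]] \<omega> True by simp
      also have "\<dots> \<longleftrightarrow> (\<forall>n::nat. \<exists>q\<in>\<rat>\<inter>{0..1}. X (\<rho> \<omega> + q * (t - \<rho> \<omega>)) \<omega> < 1 / Suc n)"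
        using \<omega> True stime_range[OF \<rho>, of \<omega>]
        by (intro closed_hit_exists[OF _ le] continuous_on_subset[OF cont]) auto
      finally show ?thesis using le by simp
    next
      case False
      then show ?thesis
        using hit_props(1)[where X=X and \<rho>=\<rho>, OF cont stime_range[OF \<rho>], of \<omega>] \<omega> by auto
    qed
    have "Measurable.pred (F t) (\<lambda>\<omega>. X (?m \<omega> + q * (t - ?m \<omega>)) \<omega> < 1 / Suc n)" if "q \<in> \<rat> \<inter> {0..1}" for q n
    proof -
      have "?m \<omega> + q * (t - ?m \<omega>) \<in> {0..t}" if "\<omega> \<in> space M" for \<omega>
      proof -
        have "0 \<le> ?m \<omega>" "?m \<omega> \<le> t" using stime_range[OF \<rho> that] t by auto
        moreover have "0 \<le> q * (t - ?m \<omega>)" "q * (t - ?m \<omega>) \<le> 1 * (t - ?m \<omega>)"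
          using \<open>q \<in> \<rat> \<inter> {0..1}\<close> \<open>?m \<omega> \<le> t\<close> mult_right_mono[of q 1 "t - ?m \<omega>"] by auto
        ultimately show ?thesis by auto
      qed
      from progressive_F[OF prog t m this] show ?thesis by measurable
    qed
    then have "Measurable.pred (F t) (\<lambda>\<omega>. \<rho> \<omega> \<le> t \<and> (\<forall>n::nat. \<exists>q\<in>\<rat>\<inter>{0..1}. X (?m \<omega> + q * (t - ?m \<omega>)) \<omega> < 1 / Suc n))"
      using stopping_timeD[OF st, of t]
      by (intro pred_intros_logic pred_intros_countable measurable_pred_countable countable_Int1 countable_rat)
    then show ?thesis
      by (subst measurable_cong[OF eq])
  next
    case False
    then consider "t < 0" | "T \<le> t" by linarith
    then show ?thesis
    proof cases
      case 1
      have eq: "hit \<rho> X \<omega> \<le> t \<longleftrightarrow> False" if \<omega>: "\<omega> \<in> space (F t)" for \<omega>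
        using hit_props(1)[where X=X and \<rho>=\<rho>, OF cont stime_range[OF \<rho>], of \<omega>] stime_range[OF \<rho>, of \<omega>] \<omega> 1 by auto
      then show ?thesis by (subst measurable_cong[OF eq]) auto
    next
      case 2
      have eq: "hit \<rho> X \<omega> \<le> t \<longleftrightarrow> True" if \<omega>: "\<omega> \<in> space (F t)" for \<omega>
        using hit_props(2)[where X=X and \<rho>=\<rho>, OF cont stime_range[OF \<rho>], of \<omega>] \<omega> 2 by auto
      then show ?thesis by (subst measurable_cong[OF eq]) auto
    qed
  qed
qed

end

text \<open>A nonnegative integrand with zero integral vanishes almost everywhere for the measure
  \<open>dk\<close>. As \<open>X\<close> is positive on \<open>[r, d)\<close>, the measure puts no
  mass between \<open>r\<close> and any earlier point than \<open>d\<close>, so \<open>k\<close> is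
  constant on \<open>[r, d)\<close>; continuity of \<open>k\<close> adds the endpoint
  \<open>d\<close>, where \<open>X\<close> may have any nonnegative value.\<close>

lemma stieltjes_flat:
  fixes k X :: "real \<Rightarrow> real"
  assumes T: "0 < T" and kc: "continuous_on {0..T} k" and km: "mono_on {0..T} k"
    and Xc: "continuous_on {0..T} X" and X0: "\<And>t. t \<in> {0..T} \<Longrightarrow> 0 \<le> X t"
    and int: "(LINT t:{0..T}|interval_measure (\<lambda>u. k (max 0 (min T u))). X t) = 0"
    and r: "0 \<le> r" "r \<le> d" "d \<le> T" and pos: "\<And>t. r \<le> t \<Longrightarrow> t < d \<Longrightarrow> 0 < X t"
  shows "k d = k r"
proof -
  let ?k = "\<lambda>u. k (max 0 (min T u))"
  let ?\<mu> = "interval_measure ?k"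
  have mono: "?k x \<le> ?k y" if "x \<le> y" for x y
    using km that T by (auto simp: mono_on_def)
  have cont: "continuous_on UNIV ?k"
    by (rule continuous_on_compose2[OF kc]) (use T in \<open>auto intro!: continuous_intros\<close>)
  then have rc: "continuous (at_right a) ?k" for a
    by (simp add: continuous_on_eq_continuous_at continuous_at_imp_continuous_within)
  have em: "emeasure ?\<mu> {a<..b} = ?k b - ?k a" if "a \<le> b" for a b
    by (rule emeasure_interval_measure_Ioc[OF that mono rc])
  have fin: "emeasure ?\<mu> {0..T} < \<infinity>"
    using emeasure_interval_measure_Icc[of 0 T ?k, OF _ mono cont] T by simp
  obtain C where "\<forall>t\<in>{0..T}. \<bar>X t\<bar> \<le> C"
    using compact_imp_bounded[OF compact_continuous_image[OF Xc compact_Icc]] by (auto simp: bounded_iff)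
  then have C: "\<And>t. t \<in> {0..T} \<Longrightarrow> \<bar>X t\<bar> \<le> C" by blast
  have Xm: "(\<lambda>t. indicator {0..T} t *\<^sub>R X t) \<in> borel_measurable borel"
    using Xc by (intro borel_measurable_continuous_on_indicator) auto
  have "integrable ?\<mu> (\<lambda>t. indicator {0..T} t *\<^sub>R X t)"
    using fin C Xm
    by (intro integrableI_bounded_set[where A="{0..T}" and B=C]) (auto simp: indicator_def)
  then have "AE t in ?\<mu>. indicator {0..T} t *\<^sub>R X t = 0"
    using int X0 by (subst (asm) set_lebesgue_integral_def, subst (asm) integral_nonneg_eq_0_iff_AE) (auto simp: indicator_def)
  then have AE: "AE t in ?\<mu>. t \<notin> {r<..<d}"
  proof eventually_elim
    case (elim t)
    then show ?case using pos[of t] r by (auto simp: indicator_def split: if_splits)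
  qed
  have eq: "k s = k r" if s: "r \<le> s" "s < d" for s
  proof -
    have "AE t in ?\<mu>. t \<notin> {r<..s}" using AE by eventually_elim (use s in auto)
    then have "emeasure ?\<mu> {r<..s} = 0" by (subst (asm) AE_iff_measurable[of "{r<..s}"]) auto
    then have "?k s - ?k r = 0" using em[of r s] mono[of r s] s by simp
    then show ?thesis using s r by (simp add: min_def max_def split: if_splits)
  qed
  show ?thesis
  proof (cases "r = d")
    case False
    then have rd: "r < d" using r by simp
    have "(k \<longlongrightarrow> k d) (at d within {0..T})"
      using kc r by (simp add: continuous_on_def)
    then have "(k \<longlongrightarrow> k d) (at d within {r..<d})"
      by (rule tendsto_within_subset) (use r in auto)
    moreover have "\<forall>\<^sub>F s in at d within {r..<d}. k s = k r"
      unfolding eventually_at_filter by (rule always_eventually) (intro allI impI eq, simp_all)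
    ultimately have "((\<lambda>_. k r) \<longlongrightarrow> k d) (at d within {r..<d})"
      by (rule Lim_transform_eventually)
    moreover have "at d within {r..<d} \<noteq> bot"
      using rd by (simp add: at_within_eq_bot_iff)
    ultimately show ?thesis using tendsto_unique tendsto_const by blast
  qed simp
qed

section \<open>Comparison of solutions\<close>

context brownian begin

section \<open>Time integrals of bounded generators\<close>

definition running :: "(real \<Rightarrow> 'w \<Rightarrow> real) \<Rightarrow> real \<Rightarrow> bool" where
  "running g C \<longleftrightarrow> (\<lambda>(s, \<omega>). g s \<omega>) \<in> borel_measurable (restrict_space borel {0..T} \<Otimes>\<^sub>M M) \<and>
     (\<forall>s\<in>{0..T}. \<forall>\<omega>\<in>space M. \<bar>g s \<omega>\<bar> \<le> C)"

text \<open>Clamping the time extends the generator from \<open>[0, T]\<close> to the whole line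
  without changing it there, so that parametrised Lebesgue integrals over the line become measurable
  in the scenario.\<close>

lemma running_clamped:
  assumes "running g C"
  shows "(\<lambda>(\<omega>, s). g (max 0 (min T s)) \<omega>) \<in> borel_measurable (M \<Otimes>\<^sub>M lborel)"
proof -
  have "(\<lambda>(\<omega>, s). (max 0 (min T s), \<omega>)) \<in> measurable (M \<Otimes>\<^sub>M lborel) (restrict_space borel {0..T} \<Otimes>\<^sub>M M)"
    unfolding case_prod_beta using T_pos by (intro measurable_Pair measurable_restrict_space2) auto
  from measurable_compose[OF this, of "\<lambda>(s, \<omega>). g s \<omega>" borel] assms show ?thesis
    by (simp add: running_def case_prod_beta)
qed

lemma running_set_integrable:
  assumes g: "running g C" and \<omega>: "\<omega> \<in> space M" and A: "A \<in> sets borel" "A \<subseteq> {0..T}"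
  shows "set_integrable lborel A (\<lambda>s. g s \<omega>)"
proof -
  have "(\<lambda>s. (\<omega>, s)) \<in> measurable lborel (M \<Otimes>\<^sub>M lborel)" using \<omega> by measurable
  from measurable_compose[OF this running_clamped[OF g]]
  have m: "(\<lambda>s. g (max 0 (min T s)) \<omega>) \<in> borel_measurable lborel" by simp
  have "integrable lborel (\<lambda>s. indicator {0..T} s *\<^sub>R g (max 0 (min T s)) \<omega>)"
    using m g \<omega> T_pos by (intro integrableI_bounded_set[where A="{0..T}" and B=C]) (auto simp: running_def)
  moreover have "(\<lambda>s. indicator {0..T} s *\<^sub>R g (max 0 (min T s)) \<omega>) = (\<lambda>s. indicator {0..T} s *\<^sub>R g s \<omega>)"
    by (auto simp: indicator_def fun_eq_iff)
  ultimately have "set_integrable lborel {0..T} (\<lambda>s. g s \<omega>)" by (simp add: set_integrable_def)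
  then show ?thesis by (rule set_integrable_subset) (use A in auto)
qed

lemma running_integral_split:
  assumes g: "running g C" and \<omega>: "\<omega> \<in> space M" and abc: "0 \<le> a" "a \<le> b" "b \<le> c" "c \<le> T"
  shows "(LINT s:{a..c}|lborel. g s \<omega>) = (LINT s:{a..b}|lborel. g s \<omega>) + (LINT s:{b..c}|lborel. g s \<omega>)"
proof -
  have "(LINT s:{a..b} \<union> {b..c}|lborel. g s \<omega>) = (LINT s:{a..b}|lborel. g s \<omega>) + (LINT s:{b..c}|lborel. g s \<omega>)"
  proof (rule set_integral_Un_AE)
    show "AE s in lborel. \<not> (s \<in> {a..b} \<and> s \<in> {b..c})"
      using AE_lborel_singleton[of b] by eventually_elim auto
  qed (use abc in \<open>auto intro!: running_set_integrable[OF g \<omega>]\<close>)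
  moreover have "{a..b} \<union> {b..c} = {a..c}" using abc by auto
  ultimately show ?thesis by simp
qed

lemma running_integral_bound:
  assumes g: "running g C" and \<omega>: "\<omega> \<in> space M" and ab: "0 \<le> a" "a \<le> b" "b \<le> T"
  shows "\<bar>LINT s:{a..b}|lborel. g s \<omega>\<bar> \<le> C * T"
proof -
  have C: "0 \<le> C" using g \<omega> T_pos unfolding running_def by (meson abs_ge_zero atLeastAtMost_iff less_eq_real_def order_trans)
  have "\<bar>LINT s:{a..b}|lborel. g s \<omega>\<bar> \<le> (LINT s:{a..b}|lborel. C)"
    unfolding set_lebesgue_integral_def
  proof (rule order_trans[OF integral_abs_bound integral_mono])
    show "integrable lborel (\<lambda>s. \<bar>indicator {a..b} s *\<^sub>R g s \<omega>\<bar>)"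
      using running_set_integrable[OF g \<omega>, of "{a..b}"] ab unfolding set_integrable_def by auto
    show "integrable lborel (\<lambda>s. indicator {a..b} s *\<^sub>R C)" using ab by (auto simp: emeasure_lborel_Icc_eq)
    show "\<bar>indicator {a..b} s *\<^sub>R g s \<omega>\<bar> \<le> indicator {a..b} s *\<^sub>R C" for s
      using g \<omega> ab by (auto simp: running_def indicator_def)
  qed
  also have "\<dots> = (b - a) * C" using ab by (simp add: set_lebesgue_integral_def)
  also have "\<dots> \<le> C * T" using ab C by (simp add: mult.commute mult_left_mono)
  finally show ?thesis .
qed

lemma running_integral_integrable:
  assumes g: "running g C" and m: "a \<in> borel_measurable M" "b \<in> borel_measurable M"
    and ab: "\<And>\<omega>. \<omega> \<in> space M \<Longrightarrow> 0 \<le> a \<omega> \<and> a \<omega> \<le> b \<omega> \<and> b \<omega> \<le> T"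
  shows "integrable M (\<lambda>\<omega>. LINT s:{a \<omega>..b \<omega>}|lborel. g s \<omega>)"
proof (rule integrable_const_bound[where B="C * T"])
  show "AE \<omega> in M. norm (LINT s:{a \<omega>..b \<omega>}|lborel. g s \<omega>) \<le> C * T"
    using running_integral_bound[OF g] ab by (intro AE_I2) auto
  note [measurable] = running_clamped[OF g] m
  \<comment> \<open>The random limits are moved into the integrand as a measurable condition, so
    that the domain of integration no longer depends on the scenario.\<close>
  have "(\<lambda>\<omega>. \<integral>s. (if a \<omega> \<le> s \<and> s \<le> b \<omega> then g (max 0 (min T s)) \<omega> else 0) \<partial>lborel) \<in> borel_measurable M"
    by measurable
  also have "?this \<longleftrightarrow> (\<lambda>\<omega>. LINT s:{a \<omega>..b \<omega>}|lborel. g s \<omega>) \<in> borel_measurable M"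
  proof (rule measurable_cong)
    fix \<omega> assume "\<omega> \<in> space M"
    then show "(\<integral>s. (if a \<omega> \<le> s \<and> s \<le> b \<omega> then g (max 0 (min T s)) \<omega> else 0) \<partial>lborel) = (LINT s:{a \<omega>..b \<omega>}|lborel. g s \<omega>)"
      unfolding set_lebesgue_integral_def using ab[of \<omega>] by (intro Bochner_Integration.integral_cong) (auto simp: indicator_def)
  qed
  finally show "(\<lambda>\<omega>. LINT s:{a \<omega>..b \<omega>}|lborel. g s \<omega>) \<in> borel_measurable M" .
qed

text \<open>The common shape of both equations. Obstacle and minimality are forgotten, the integrand
  of the Ito integral is hidden, and the unreflected equation is the case of a vanishing
  \<open>k\<close>.\<close>

definition decomposed :: "(real \<Rightarrow> 'w \<Rightarrow> real) \<Rightarrow> (real \<Rightarrow> 'w \<Rightarrow> real) \<Rightarrow> (real \<Rightarrow> 'w \<Rightarrow> real) \<Rightarrow> bool" where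
  "decomposed g y k \<longleftrightarrow> y \<in> S2_c M T B \<and> k \<in> S2_ci M T B \<and>
     (\<exists>V I. is_ito_integral M T B V I \<and>
        (AE \<omega> in M. \<forall>t\<in>{0..T}.
           y t \<omega> = (LINT s:{t..T}|lborel. g s \<omega>) + k T \<omega> - k t \<omega> - (I T \<omega> - I t \<omega>)))"

lemma bsde_decomposed:
  assumes "bsde_solution M T B g y z" shows "decomposed g y (\<lambda>_ _. 0)"
proof -
  have "(\<lambda>_ _. 0::real) \<in> S2_ci M T B"
    using T_pos by (auto simp: S2_ci_def S2_c_def progressive_def mono_on_def emeasure_space_1)
  then show ?thesis using assms by (auto simp: bsde_solution_def decomposed_def)
qed

lemma rbsde_decomposed: "rbsde_solution M T B g ob y z k \<Longrightarrow> decomposed g y k"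
  by (auto simp: rbsde_solution_def decomposed_def)

lemma decomposed_path:
  assumes "decomposed g y k"
  shows "progressive M T B y" "progressive M T B k"
    "\<And>\<omega>. \<omega> \<in> space M \<Longrightarrow> continuous_on {0..T} (\<lambda>t. y t \<omega>)"
    "\<And>\<omega>. \<omega> \<in> space M \<Longrightarrow> continuous_on {0..T} (\<lambda>t. k t \<omega>)"
    "\<And>\<omega>. \<omega> \<in> space M \<Longrightarrow> mono_on {0..T} (\<lambda>t. k t \<omega>)"
  using assms by (auto simp: decomposed_def S2_ci_def S2_c_def)

lemma S2_c_stopped_integrable:
  assumes "y \<in> S2_c M T B" "stime \<rho>" shows "integrable M (\<lambda>\<omega>. y (\<rho> \<omega>) \<omega>)"
proof -
  obtain G where G: "integrable M G" "AE \<omega> in M. \<forall>t\<in>{0..T}. \<bar>y t \<omega>\<bar> \<le> G \<omega>"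
    using S2_c_dominated[OF assms(1)] .
  show ?thesis
  proof (rule Bochner_Integration.integrable_bound[OF G(1)])
    show "(\<lambda>\<omega>. y (\<rho> \<omega>) \<omega>) \<in> borel_measurable M"
      using progressive_stopped_M[OF _ assms(2)] assms(1) by (auto simp: S2_c_def)
    show "AE \<omega> in M. norm (y (\<rho> \<omega>) \<omega>) \<le> norm (G \<omega>)"
      using G(2) AE_space
    proof eventually_elim
      case (elim \<omega>)
      then have "\<bar>y (\<rho> \<omega>) \<omega>\<bar> \<le> G \<omega>" using stime_range[OF assms(2) elim(2)] by auto
      then show ?case by simp
    qed
  qed
qed

lemma decomposed_integrable:
  assumes "decomposed g y k" "stime \<rho>"
  shows "integrable M (\<lambda>\<omega>. y (\<rho> \<omega>) \<omega>)" "integrable M (\<lambda>\<omega>. k (\<rho> \<omega>) \<omega>)"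
  using assms S2_c_stopped_integrable by (auto simp: decomposed_def S2_ci_def)

lemma decomposed_terminal:
  assumes "decomposed g y k" shows "AE \<omega> in M. y T \<omega> = 0"
proof -
  obtain V I where "AE \<omega> in M. \<forall>t\<in>{0..T}.
           y t \<omega> = (LINT s:{t..T}|lborel. g s \<omega>) + k T \<omega> - k t \<omega> - (I T \<omega> - I t \<omega>)"
    using assms by (auto simp: decomposed_def)
  then show ?thesis
  proof eventually_elim
    case (elim \<omega>)
    have "(LINT s:{T..T}|lborel. g s \<omega>) = (\<integral>s. 0 \<partial>lborel)"
      unfolding set_lebesgue_integral_def
    proof (rule integral_eq_zero_AE[THEN trans])
      show "AE s in lborel. indicator {T..T} s *\<^sub>R g s \<omega> = 0"
        using AE_lborel_singleton[of T] by eventually_elim (auto simp: indicator_def)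
    qed simp
    moreover have "T \<in> {0..T}" using T_pos by simp
    ultimately show ?case using elim by simp
  qed
qed

text \<open>Subtracting the equation at \<open>D\<close> from the one at \<open>\<rho>\<close>
  leaves the increment of \<open>I\<close> between the two times, which has zero mean on every event
  known at \<open>\<rho>\<close>. Optional stopping applies because the equation expresses
  \<open>I\<close> through dominated processes.\<close>

lemma decomposed_stopped:
  assumes g: "running g C" and d: "decomposed g y k" and \<rho>: "stime \<rho>" and D: "stime D"
    and le: "\<And>\<omega>. \<omega> \<in> space M \<Longrightarrow> \<rho> \<omega> \<le> D \<omega>" and A: "A \<in> sets (Fs \<rho>)"
  shows "(\<integral>\<omega>. indicator A \<omega> * y (\<rho> \<omega>) \<omega> \<partial>M) =
    (\<integral>\<omega>. indicator A \<omega> * ((LINT s:{\<rho> \<omega>..D \<omega>}|lborel. g s \<omega>) + y (D \<omega>) \<omega> + (k (D \<omega>) \<omega> - k (\<rho> \<omega>) \<omega>)) \<partial>M)"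
proof -
  obtain V I where I: "is_ito_integral M T B V I" and eq: "AE \<omega> in M. \<forall>t\<in>{0..T}.
           y t \<omega> = (LINT s:{t..T}|lborel. g s \<omega>) + k T \<omega> - k t \<omega> - (I T \<omega> - I t \<omega>)"
    using d by (auto simp: decomposed_def)
  have Ip: "progressive M T B I" "\<And>\<omega>. \<omega> \<in> space M \<Longrightarrow> continuous_on {0..T} (\<lambda>t. I t \<omega>)"
    using I by (auto simp: is_ito_integral_def)
  obtain Gy where Gy: "integrable M Gy" "AE \<omega> in M. \<forall>t\<in>{0..T}. \<bar>y t \<omega>\<bar> \<le> Gy \<omega>"
    using S2_c_dominated d unfolding decomposed_def by blast
  obtain Gk where Gk: "integrable M Gk" "AE \<omega> in M. \<forall>t\<in>{0..T}. \<bar>k t \<omega>\<bar> \<le> Gk \<omega>"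
    using S2_c_dominated d unfolding decomposed_def S2_ci_def by blast
  \<comment> \<open>Solving the equation for \<open>I t\<close>, with the time-\<open>0\<close>
    equation to eliminate \<open>I T\<close>, produces two values each of the time integral, of
    \<open>y\<close> and of \<open>k\<close>.\<close>
  let ?G = "\<lambda>\<omega>. 2 * (C * T) + 2 * Gy \<omega> + 2 * Gk \<omega>"
  have G: "integrable M ?G" using Gy Gk by simp
  have Gb: "AE \<omega> in M. \<forall>t\<in>{0..T}. \<bar>I t \<omega>\<bar> \<le> ?G \<omega>"
    using eq Gy(2) Gk(2) ito_zero[OF I] AE_space
  proof eventually_elim
    case (elim \<omega>)
    show ?case
    proof
      fix t assume t: "t \<in> {0..T}"
      have 0: "0 \<in> {0..T}" using T_pos by simp
      have "I t \<omega> = (y t \<omega> - y 0 \<omega>) + ((LINT s:{0..T}|lborel. g s \<omega>) - (LINT s:{t..T}|lborel. g s \<omega>)) + (k t \<omega> - k 0 \<omega>)"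
        using elim(1) t 0 elim(4) by (auto dest!: bspec[of _ _ t] bspec[of _ _ 0])
      moreover have "\<bar>LINT s:{0..T}|lborel. g s \<omega>\<bar> \<le> C * T" "\<bar>LINT s:{t..T}|lborel. g s \<omega>\<bar> \<le> C * T"
        using running_integral_bound[OF g elim(5)] t T_pos by auto
      moreover have "\<bar>y t \<omega>\<bar> \<le> Gy \<omega>" "\<bar>y 0 \<omega>\<bar> \<le> Gy \<omega>" "\<bar>k t \<omega>\<bar> \<le> Gk \<omega>" "\<bar>k 0 \<omega>\<bar> \<le> Gk \<omega>"
        using elim(2,3) t 0 by auto
      ultimately show "\<bar>I t \<omega>\<bar> \<le> ?G \<omega>" by linarith
    qed
  qed
  have Iint: "integrable M (I t)" if t: "t \<in> {0..T}" for t
  proof (rule Bochner_Integration.integrable_bound[OF G ito_measurable[OF I t]])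
    show "AE \<omega> in M. norm (I t \<omega>) \<le> norm (?G \<omega>)"
      using Gb
    proof eventually_elim
      case (elim \<omega>)
      then have "\<bar>I t \<omega>\<bar> \<le> ?G \<omega>" using t by blast
      then show ?case by simp
    qed
  qed
  have mart: "(\<integral>\<omega>. indicator A \<omega> * (I T \<omega> - I t \<omega>) \<partial>M) = 0" if "t \<in> {0..T}" "A \<in> sets (F t)" for t A
    using ito_martingale[OF I _ _ _ that(2) Iint Iint, of T] that T_pos by auto
  have os: "integrable M (\<lambda>\<omega>. I (\<sigma> \<omega>) \<omega>)" "(\<integral>\<omega>. indicator A \<omega> * (I T \<omega> - I (\<sigma> \<omega>) \<omega>) \<partial>M) = 0"
    if "stime \<sigma>" "A \<in> sets (Fs \<sigma>)" for \<sigma> A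
    using optional_stopping[OF Ip(1) _ G Gb _ that] Ip(2) mart by blast+
  have AD: "A \<in> sets (Fs D)" using A filt.mono_pre_sigma[OF stime_stopping[OF \<rho>] stime_stopping[OF D] le] by auto
  have AM: "A \<in> sets M" using A sets_Fs_subset[OF stime_stopping[OF \<rho>]] by auto
  have i: "integrable M (\<lambda>\<omega>. I (\<rho> \<omega>) \<omega>)" "integrable M (\<lambda>\<omega>. I (D \<omega>) \<omega>)" "integrable M (I T)"
    using os(1)[OF \<rho> A] os(1)[OF D AD] Iint[of T] T_pos by auto
  have iA: "integrable M (\<lambda>\<omega>. indicator A \<omega> * f \<omega>)" if "integrable M f" for f :: "'w \<Rightarrow> real"
    using integrable_real_mult_indicator[OF AM that] by (simp add: mult.commute)
  have z: "(\<integral>\<omega>. indicator A \<omega> * (I (D \<omega>) \<omega> - I (\<rho> \<omega>) \<omega>) \<partial>M) = 0"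
  proof -
    have "(\<integral>\<omega>. indicator A \<omega> * (I (D \<omega>) \<omega> - I (\<rho> \<omega>) \<omega>) \<partial>M) =
       (\<integral>\<omega>. indicator A \<omega> * (I T \<omega> - I (\<rho> \<omega>) \<omega>) - indicator A \<omega> * (I T \<omega> - I (D \<omega>) \<omega>) \<partial>M)"
      by (intro Bochner_Integration.integral_cong) (auto simp: algebra_simps)
    also have "\<dots> = (\<integral>\<omega>. indicator A \<omega> * (I T \<omega> - I (\<rho> \<omega>) \<omega>) \<partial>M) - (\<integral>\<omega>. indicator A \<omega> * (I T \<omega> - I (D \<omega>) \<omega>) \<partial>M)"
      by (intro Bochner_Integration.integral_diff iA Bochner_Integration.integrable_diff i)
    also have "\<dots> = 0" using os(2)[OF \<rho> A] os(2)[OF D AD] by simp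
    finally show ?thesis .
  qed
  have m: "\<rho> \<in> borel_measurable M" "D \<in> borel_measurable M"
    using stopping_measurable stime_stopping \<rho> D by auto
  have ig: "integrable M (\<lambda>\<omega>. LINT s:{\<rho> \<omega>..D \<omega>}|lborel. g s \<omega>)"
    using le stime_range[OF \<rho>] stime_range[OF D] by (intro running_integral_integrable[OF g m]) auto
  let ?R = "\<lambda>\<omega>. (LINT s:{\<rho> \<omega>..D \<omega>}|lborel. g s \<omega>) + y (D \<omega>) \<omega> + (k (D \<omega>) \<omega> - k (\<rho> \<omega>) \<omega>)"
  have iR: "integrable M ?R"
    by (intro Bochner_Integration.integrable_add Bochner_Integration.integrable_diff ig decomposed_integrable[OF d] \<rho> D)
  have "(\<integral>\<omega>. indicator A \<omega> * y (\<rho> \<omega>) \<omega> \<partial>M) = (\<integral>\<omega>. indicator A \<omega> * ?R \<omega> - indicator A \<omega> * (I (D \<omega>) \<omega> - I (\<rho> \<omega>) \<omega>) \<partial>M)"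
  proof (rule integral_cong_AE)
    show "AE \<omega> in M. indicator A \<omega> * y (\<rho> \<omega>) \<omega> = indicator A \<omega> * ?R \<omega> - indicator A \<omega> * (I (D \<omega>) \<omega> - I (\<rho> \<omega>) \<omega>)"
      using eq AE_space
    proof eventually_elim
      case (elim \<omega>)
      note r = stime_range[OF \<rho> elim(2)] stime_range[OF D elim(2)] le[OF elim(2)]
      have "(LINT s:{\<rho> \<omega>..T}|lborel. g s \<omega>) = (LINT s:{\<rho> \<omega>..D \<omega>}|lborel. g s \<omega>) + (LINT s:{D \<omega>..T}|lborel. g s \<omega>)"
        by (rule running_integral_split[OF g elim(2)]) (use r in auto)
      moreover have "y (\<rho> \<omega>) \<omega> = (LINT s:{\<rho> \<omega>..T}|lborel. g s \<omega>) + k T \<omega> - k (\<rho> \<omega>) \<omega> - (I T \<omega> - I (\<rho> \<omega>) \<omega>)"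
        "y (D \<omega>) \<omega> = (LINT s:{D \<omega>..T}|lborel. g s \<omega>) + k T \<omega> - k (D \<omega>) \<omega> - (I T \<omega> - I (D \<omega>) \<omega>)"
        using elim(1) r by auto
      ultimately have "y (\<rho> \<omega>) \<omega> = ?R \<omega> - (I (D \<omega>) \<omega> - I (\<rho> \<omega>) \<omega>)" by simp
      then show ?case by (simp only: right_diff_distrib)
    qed
  qed (intro borel_measurable_integrable Bochner_Integration.integrable_diff iA iR i decomposed_integrable[OF d] \<rho>)+
  also have "\<dots> = (\<integral>\<omega>. indicator A \<omega> * ?R \<omega> \<partial>M) - (\<integral>\<omega>. indicator A \<omega> * (I (D \<omega>) \<omega> - I (\<rho> \<omega>) \<omega>) \<partial>M)"
    by (intro Bochner_Integration.integral_diff iA Bochner_Integration.integrable_diff iR i)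
  finally show ?thesis using z by simp
qed

text \<open>The hypothesis is tested on the part of \<open>A0\<close> where \<open>f\<close> is
  positive. This event belongs to the same sigma-algebra, and the integral of \<open>f\<close> over
  it is both nonnegative and at most zero.\<close>

lemma AE_nonpos_on:
  fixes f :: "'w \<Rightarrow> real"
  assumes \<rho>: "stime \<rho>" and f: "f \<in> borel_measurable (Fs \<rho>)" "integrable M f" and A0: "A0 \<in> sets (Fs \<rho>)"
    and le: "\<And>A. A \<in> sets (Fs \<rho>) \<Longrightarrow> A \<subseteq> A0 \<Longrightarrow> (\<integral>\<omega>. indicator A \<omega> * f \<omega> \<partial>M) \<le> 0"
  shows "AE \<omega> in M. \<omega> \<in> A0 \<longrightarrow> f \<omega> \<le> 0"
proof -
  let ?A = "A0 \<inter> {\<omega>\<in>space (Fs \<rho>). 0 < f \<omega>}"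
  have "{\<omega>\<in>space (Fs \<rho>). 0 < f \<omega>} \<in> sets (Fs \<rho>)" using f(1) by measurable
  then have A: "?A \<in> sets (Fs \<rho>)" using A0 by auto
  then have AM: "?A \<in> sets M" using sets_Fs_subset[OF stime_stopping[OF \<rho>]] by auto
  have int: "integrable M (\<lambda>\<omega>. indicator ?A \<omega> * f \<omega>)"
    using integrable_real_mult_indicator[OF AM f(2)] by (simp add: mult.commute)
  have nn: "AE \<omega> in M. 0 \<le> indicator ?A \<omega> * f \<omega>" by (intro AE_I2) (auto simp: indicator_def)
  have "(\<integral>\<omega>. indicator ?A \<omega> * f \<omega> \<partial>M) = 0"
    using le[OF A] integral_nonneg_AE[OF nn] by auto
  then have "AE \<omega> in M. indicator ?A \<omega> * f \<omega> = 0"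
    using integral_nonneg_eq_0_iff_AE[OF int nn] by simp
  then show ?thesis using AE_space by eventually_elim (auto simp: indicator_def split: if_splits)
qed

text \<open>Between \<open>\<rho>\<close> and \<open>D\<close> the process \<open>k\<close> of the
  smaller solution is flat, whereas \<open>k'\<close> can only push the larger one up. The
  generators agree there on \<open>A0\<close>, so the order at \<open>D\<close> is carried back to
  \<open>\<rho>\<close> on every subevent known at \<open>\<rho>\<close>. Only the smaller solution
  has to be flat, hence \<open>D\<close> is later taken to be its contact time.\<close>

lemma comparison:
  assumes g: "running g C" "running g' C'" and d: "decomposed g y k" "decomposed g' y' k'"
    and \<rho>: "stime \<rho>" and D: "stime D" and le: "\<And>\<omega>. \<omega> \<in> space M \<Longrightarrow> \<rho> \<omega> \<le> D \<omega>" and A0: "A0 \<in> sets (Fs \<rho>)"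
    and gg: "\<And>\<omega> s. \<omega> \<in> A0 \<Longrightarrow> \<rho> \<omega> \<le> s \<Longrightarrow> s \<le> T \<Longrightarrow> g s \<omega> = g' s \<omega>"
    and k: "AE \<omega> in M. k (D \<omega>) \<omega> = k (\<rho> \<omega>) \<omega>" and y: "AE \<omega> in M. \<omega> \<in> A0 \<longrightarrow> y (D \<omega>) \<omega> \<le> y' (D \<omega>) \<omega>"
  shows "AE \<omega> in M. \<omega> \<in> A0 \<longrightarrow> y (\<rho> \<omega>) \<omega> \<le> y' (\<rho> \<omega>) \<omega>"
proof -
  let ?f = "\<lambda>\<omega>. y (\<rho> \<omega>) \<omega> - y' (\<rho> \<omega>) \<omega>"
  note int = decomposed_integrable[OF d(1)] decomposed_integrable[OF d(2)]
  have m: "\<rho> \<in> borel_measurable M" "D \<in> borel_measurable M"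
    using stopping_measurable stime_stopping \<rho> D by auto
  have ig: "integrable M (\<lambda>\<omega>. LINT s:{\<rho> \<omega>..D \<omega>}|lborel. g s \<omega>)" "integrable M (\<lambda>\<omega>. LINT s:{\<rho> \<omega>..D \<omega>}|lborel. g' s \<omega>)"
    by (rule running_integral_integrable[OF g(1) m] running_integral_integrable[OF g(2) m],
        use le stime_range[OF \<rho>] stime_range[OF D] in simp)+
  have "AE \<omega> in M. \<omega> \<in> A0 \<longrightarrow> ?f \<omega> \<le> 0"
  proof (rule AE_nonpos_on[OF \<rho> _ _ A0])
    show "?f \<in> borel_measurable (Fs \<rho>)"
      using d decomposed_path(1) \<rho> by (intro borel_measurable_diff progressive_stopped)
    show "integrable M ?f" using int \<rho> by simp
    fix A assume A: "A \<in> sets (Fs \<rho>)" "A \<subseteq> A0"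
    have AM: "A \<in> sets M" using A sets_Fs_subset[OF stime_stopping[OF \<rho>]] by auto
    have iA: "integrable M (\<lambda>\<omega>. indicator A \<omega> * f \<omega>)" if "integrable M f" for f :: "'w \<Rightarrow> real"
      using integrable_real_mult_indicator[OF AM that] by (simp add: mult.commute)
    have "(\<integral>\<omega>. indicator A \<omega> * ((LINT s:{\<rho> \<omega>..D \<omega>}|lborel. g s \<omega>) + y (D \<omega>) \<omega> + (k (D \<omega>) \<omega> - k (\<rho> \<omega>) \<omega>)) \<partial>M) \<le>
       (\<integral>\<omega>. indicator A \<omega> * ((LINT s:{\<rho> \<omega>..D \<omega>}|lborel. g' s \<omega>) + y' (D \<omega>) \<omega> + (k' (D \<omega>) \<omega> - k' (\<rho> \<omega>) \<omega>)) \<partial>M)"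
    proof (rule integral_mono_AE)
      show "AE \<omega> in M. indicator A \<omega> * ((LINT s:{\<rho> \<omega>..D \<omega>}|lborel. g s \<omega>) + y (D \<omega>) \<omega> + (k (D \<omega>) \<omega> - k (\<rho> \<omega>) \<omega>))
         \<le> indicator A \<omega> * ((LINT s:{\<rho> \<omega>..D \<omega>}|lborel. g' s \<omega>) + y' (D \<omega>) \<omega> + (k' (D \<omega>) \<omega> - k' (\<rho> \<omega>) \<omega>))"
        using k y AE_space
      proof eventually_elim
        case (elim \<omega>)
        note r = stime_range[OF \<rho> elim(3)] stime_range[OF D elim(3)] le[OF elim(3)]
        have k': "k' (\<rho> \<omega>) \<omega> \<le> k' (D \<omega>) \<omega>"
          using decomposed_path(5)[OF d(2) elim(3)] r by (auto simp: mono_on_def)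
        show ?case
        proof (cases "\<omega> \<in> A")
          case True
          then have "(LINT s:{\<rho> \<omega>..D \<omega>}|lborel. g s \<omega>) = (LINT s:{\<rho> \<omega>..D \<omega>}|lborel. g' s \<omega>)"
            using gg A r by (intro set_lebesgue_integral_cong) auto
          then show ?thesis using True elim k' A by auto
        qed simp
      qed
    qed (intro iA Bochner_Integration.integrable_add Bochner_Integration.integrable_diff ig int \<rho> D)+
    then have "(\<integral>\<omega>. indicator A \<omega> * y (\<rho> \<omega>) \<omega> \<partial>M) \<le> (\<integral>\<omega>. indicator A \<omega> * y' (\<rho> \<omega>) \<omega> \<partial>M)"
      using decomposed_stopped[OF g(1) d(1) \<rho> D le A(1)] decomposed_stopped[OF g(2) d(2) \<rho> D le A(1)] by simp
    moreover have "(\<integral>\<omega>. indicator A \<omega> * ?f \<omega> \<partial>M) = (\<integral>\<omega>. indicator A \<omega> * y (\<rho> \<omega>) \<omega> \<partial>M) - (\<integral>\<omega>. indicator A \<omega> * y' (\<rho> \<omega>) \<omega> \<partial>M)"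
      unfolding right_diff_distrib by (intro Bochner_Integration.integral_diff iA int \<rho>)
    ultimately show "(\<integral>\<omega>. indicator A \<omega> * ?f \<omega> \<partial>M) \<le> 0" by simp
  qed
  then show ?thesis by eventually_elim auto
qed

lemma reflection_flat:
  assumes r: "rbsde_solution M T B g ob y z k"
    and ob: "\<And>\<omega>. \<omega> \<in> space M \<Longrightarrow> continuous_on {0..T} (\<lambda>t. ob t \<omega>)" and \<rho>: "stime \<rho>"
  shows "AE \<omega> in M. k (hit \<rho> (\<lambda>t \<omega>. y t \<omega> - ob t \<omega>) \<omega>) \<omega> = k (\<rho> \<omega>) \<omega>"
proof -
  note d = decomposed_path[OF rbsde_decomposed[OF r]]
  have "AE \<omega> in M. \<forall>t\<in>{0..T}. y t \<omega> \<ge> ob t \<omega>"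
    "AE \<omega> in M. (LINT t:{0..T}|interval_measure (\<lambda>u. k (max 0 (min T u)) \<omega>). y t \<omega> - ob t \<omega>) = 0"
    using r by (auto simp: rbsde_solution_def)
  then show ?thesis using AE_space
  proof eventually_elim
    case (elim \<omega>)
    have c: "continuous_on {0..T} (\<lambda>t. y t \<omega> - ob t \<omega>)"
      using d(3) ob elim(3) by (intro continuous_intros) auto
    note h = hit_props[where X="\<lambda>t \<omega>. y t \<omega> - ob t \<omega>" and \<rho>=\<rho>, OF c stime_range[OF \<rho> elim(3)]]
    show ?case
      by (rule stieltjes_flat[where X="\<lambda>t. y t \<omega> - ob t \<omega>", OF T_pos d(4,5)[OF elim(3)] c _ elim(2)])
        (use elim h stime_range[OF \<rho> elim(3)] in auto)
  qed
qed

end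

section \<open>Locality of the approximating processes\<close>

lemma continuous_on_Max_image:
  fixes f :: "'i \<Rightarrow> 'a::topological_space \<Rightarrow> real"
  assumes "finite U" "U \<noteq> {}" "\<And>\<beta>. \<beta> \<in> U \<Longrightarrow> continuous_on S (f \<beta>)"
  shows "continuous_on S (\<lambda>x. Max ((\<lambda>\<beta>. f \<beta> x) ` U))"
  using assms
proof (induction U rule: finite_ne_induct)
  case (insert a U)
  then show ?case by (simp add: Max_insert continuous_on_max)
qed simp

text \<open>Elements are added one at a time, each being compared with the maximum over those
  already treated; ties go to the newcomer.\<close>

lemma measurable_argmax:
  fixes v :: "'i::topological_space \<Rightarrow> 'a \<Rightarrow> real"
  assumes "finite U" "U \<noteq> {}" "\<And>\<beta>. \<beta> \<in> U \<Longrightarrow> v \<beta> \<in> borel_measurable N"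
  shows "\<exists>\<eta>\<in>borel_measurable N. \<forall>\<omega>\<in>space N. \<eta> \<omega> \<in> U \<and> v (\<eta> \<omega>) \<omega> = Max ((\<lambda>\<beta>. v \<beta> \<omega>) ` U)"
  using assms
proof (induction U rule: finite_ne_induct)
  case (singleton a)
  then show ?case by (intro bexI[of _ "\<lambda>_. a"]) auto
next
  case (insert a U)
  then obtain \<eta> where \<eta>: "\<eta> \<in> borel_measurable N" "\<And>\<omega>. \<omega> \<in> space N \<Longrightarrow> \<eta> \<omega> \<in> U \<and> v (\<eta> \<omega>) \<omega> = Max ((\<lambda>\<beta>. v \<beta> \<omega>) ` U)"
    by auto
  let ?m = "\<lambda>\<omega>. Max ((\<lambda>\<beta>. v \<beta> \<omega>) ` U)"
  have m: "?m \<in> borel_measurable N" using insert by (intro borel_measurable_Max) auto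
  have a: "v a \<in> borel_measurable N" using insert by auto
  show ?case
  proof (intro bexI ballI)
    show "(\<lambda>\<omega>. if ?m \<omega> \<le> v a \<omega> then a else \<eta> \<omega>) \<in> borel_measurable N"
      using m a \<eta>(1) by measurable
    fix \<omega> assume "\<omega> \<in> space N"
    then show "(if ?m \<omega> \<le> v a \<omega> then a else \<eta> \<omega>) \<in> insert a U \<and>
       v (if ?m \<omega> \<le> v a \<omega> then a else \<eta> \<omega>) \<omega> = Max ((\<lambda>\<beta>. v \<beta> \<omega>) ` insert a U)"
      using \<eta>(2)[of \<omega>] Max_insert[of "(\<lambda>\<beta>. v \<beta> \<omega>) ` U" "v a \<omega>"] insert(1,2) by (auto simp: max_def simp del: Max_insert Max_le_iff)
  qed
qed

text \<open>On a finite range any function is a finite combination of indicators of points. This is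
  how the cost \<open>\<psi>\<close>, about which no measurability is assumed, becomes measurable
  along an impulse.\<close>

lemma measurable_finite_range:
  fixes \<eta> :: "'a \<Rightarrow> 'b::t1_space" and f :: "'b \<Rightarrow> real"
  assumes U: "finite U" and \<eta>: "\<eta> \<in> borel_measurable N" "\<And>\<omega>. \<omega> \<in> space N \<Longrightarrow> \<eta> \<omega> \<in> U"
  shows "(\<lambda>\<omega>. f (\<eta> \<omega>)) \<in> borel_measurable N"
proof -
  have "(\<lambda>\<omega>. f (\<eta> \<omega>)) \<in> borel_measurable N \<longleftrightarrow> (\<lambda>\<omega>. \<Sum>\<beta>\<in>U. indicator {\<beta>} (\<eta> \<omega>) * f \<beta>) \<in> borel_measurable N"
    using U \<eta>(2) by (intro measurable_cong) (simp add: indicator_def if_distrib[of "\<lambda>x. x * _"] sum.delta cong: if_cong)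
  also have "\<dots>" using \<eta>(1) by (intro borel_measurable_sum borel_measurable_times borel_measurable_const
     measurable_compose[OF \<eta>(1) borel_measurable_indicator]) auto
  finally show ?thesis .
qed

locale impulse_control = brownian M T B for M :: "'w measure" and T :: real and B :: "real \<Rightarrow> 'w \<Rightarrow> real ^ 'd::finite" +
  fixes L :: "real \<Rightarrow> 'w \<Rightarrow> real ^ 'l::finite"
    and U :: "(real ^ 'l) set"
    and h :: "real \<Rightarrow> 'w \<Rightarrow> real ^ 'l \<Rightarrow> real" and \<gamma> :: real
    and \<psi> :: "real ^ 'l \<Rightarrow> real"
    and Y :: "nat \<Rightarrow> ('w \<Rightarrow> real) \<Rightarrow> ('w \<Rightarrow> real ^ 'l) \<Rightarrow> real \<Rightarrow> 'w \<Rightarrow> real"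
    and Z :: "nat \<Rightarrow> ('w \<Rightarrow> real) \<Rightarrow> ('w \<Rightarrow> real ^ 'l) \<Rightarrow> real \<Rightarrow> 'w \<Rightarrow> real ^ 'd"
    and K :: "nat \<Rightarrow> ('w \<Rightarrow> real) \<Rightarrow> ('w \<Rightarrow> real ^ 'l) \<Rightarrow> real \<Rightarrow> 'w \<Rightarrow> real"
  assumes L_H2: "L \<in> H2 M T B"
    and U: "finite U" "U \<noteq> {}"
    and h_measurable: "(\<lambda>(p, x). h (fst p) (snd p) x)
           \<in> borel_measurable (progressive_sigma M T B \<Otimes>\<^sub>M borel)"
    and h_bounds: "\<And>t \<omega> x. t \<in> {0..T} \<Longrightarrow> \<omega> \<in> space M \<Longrightarrow> 0 \<le> h t \<omega> x \<and> h t \<omega> x \<le> \<gamma>"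
    and Y_0: "\<And>\<nu> \<xi>. start_data M T B \<nu> \<xi> \<Longrightarrow>
           bsde_solution M T B (shifted_running_reward L h \<nu> \<xi>) (Y 0 \<nu> \<xi>) (Z 0 \<nu> \<xi>)"
    and Y_Suc: "\<And>m \<nu> \<xi>. start_data M T B \<nu> \<xi> \<Longrightarrow>
           rbsde_solution M T B (shifted_running_reward L h \<nu> \<xi>)
             (impulse_obstacle U \<psi> (Y m) \<nu> \<xi>) (Y (Suc m) \<nu> \<xi>) (Z (Suc m) \<nu> \<xi>) (K (Suc m) \<nu> \<xi>)"
begin

lemma start_data_iff: "start_data M T B \<nu> \<xi> \<longleftrightarrow> stime \<nu> \<and> \<xi> \<in> borel_measurable (Fs \<nu>)"
  by (auto simp: start_data_def stime_def)

lemma start_stime: "start_data M T B \<nu> \<xi> \<Longrightarrow> stime \<nu>"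
  by (simp add: start_data_iff)

lemma start_measurable: "start_data M T B \<nu> \<xi> \<Longrightarrow> \<xi> \<in> borel_measurable M"
  using Fs_measurable[OF stime_stopping] by (auto simp: start_data_iff)

lemma start_shift: "start_data M T B \<nu> \<xi> \<Longrightarrow> start_data M T B \<nu> (\<lambda>\<omega>. \<xi> \<omega> + \<beta>)"
  by (auto simp: start_data_iff intro!: borel_measurable_add)

lemma start_later:
  assumes "start_data M T B \<nu> \<xi>" "stime \<tau>" "\<And>\<omega>. \<omega> \<in> space M \<Longrightarrow> \<nu> \<omega> \<le> \<tau> \<omega>" "\<eta> \<in> borel_measurable (Fs \<tau>)"
  shows "start_data M T B \<tau> (\<lambda>\<omega>. \<xi> \<omega> + \<eta> \<omega>)"
proof -
  have "\<xi> \<in> borel_measurable (Fs \<tau>)"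
    using Fs_mono_measurable[OF stime_stopping stime_stopping] assms by (auto simp: start_data_iff)
  then show ?thesis using assms by (auto simp: start_data_iff intro!: borel_measurable_add)
qed

lemma fst_restricted_measurable [measurable]: "fst \<in> borel_measurable (restrict_space borel {0..T::real} \<Otimes>\<^sub>M M)"
  by (rule measurable_compose[OF measurable_fst]) (rule measurable_restrict_space1, simp)

lemma L_joint_measurable: "(\<lambda>(s, \<omega>). L s \<omega>) \<in> borel_measurable (restrict_space borel {0..T} \<Otimes>\<^sub>M M)"
  using measurable_compose[OF measurable_progressive_joint] L_H2
  by (auto simp: H2_def progressive_def case_prod_unfold)

text \<open>Stated for an arbitrary jointly measurable state \<open>f\<close>, as it serves both the
  shifted process \<open>L + \<xi>\<close> and the controlled process.\<close>

lemma running_h: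
  assumes "(\<lambda>(s, \<omega>). f s \<omega>) \<in> borel_measurable (restrict_space borel {0..T} \<Otimes>\<^sub>M M)"
  shows "running (\<lambda>s \<omega>. h s \<omega> (f s \<omega>)) \<gamma>"
proof -
  have "(\<lambda>p. (p, f (fst p) (snd p))) \<in> measurable (restrict_space borel {0..T} \<Otimes>\<^sub>M M) (progressive_sigma M T B \<Otimes>\<^sub>M borel)"
    using assms by (intro measurable_Pair measurable_progressive_joint) (simp add: case_prod_beta)
  from measurable_compose[OF this h_measurable]
  have "(\<lambda>(s, \<omega>). h s \<omega> (f s \<omega>)) \<in> borel_measurable (restrict_space borel {0..T} \<Otimes>\<^sub>M M)"
    by (simp add: case_prod_beta)
  then show ?thesis using h_bounds by (auto simp: running_def)
qed

lemma running_shifted: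
  assumes s: "start_data M T B \<nu> \<xi>"
  shows "running (shifted_running_reward L h \<nu> \<xi>) \<gamma>"
proof -
  note [measurable] = start_measurable[OF s] L_joint_measurable stopping_measurable[OF stime_stopping[OF start_stime[OF s]]]
  have "(\<lambda>(s, \<omega>). L s \<omega> + \<xi> \<omega>) \<in> borel_measurable (restrict_space borel {0..T} \<Otimes>\<^sub>M M)"
    using L_joint_measurable unfolding case_prod_beta by measurable
  from running_h[OF this] have r: "running (\<lambda>s \<omega>. h s \<omega> (L s \<omega> + \<xi> \<omega>)) \<gamma>" .
  then have [measurable]: "(\<lambda>(s, \<omega>). h s \<omega> (L s \<omega> + \<xi> \<omega>)) \<in> borel_measurable (restrict_space borel {0..T} \<Otimes>\<^sub>M M)"
    by (simp add: running_def)
  have "(\<lambda>p. (\<lambda>(s, \<omega>). h s \<omega> (L s \<omega> + \<xi> \<omega>)) p * (if \<nu> (snd p) \<le> fst p then 1 else 0)) \<in> borel_measurable (restrict_space borel {0..T} \<Otimes>\<^sub>M M)"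
    by measurable
  moreover have "\<bar>h s \<omega> (L s \<omega> + \<xi> \<omega>) * indicator {\<nu> \<omega>..} s\<bar> \<le> \<gamma>" if "s \<in> {0..T}" "\<omega> \<in> space M" for s \<omega>
    using h_bounds[OF that, of "L s \<omega> + \<xi> \<omega>"] by (auto simp: indicator_def)
  ultimately show ?thesis
    by (auto simp: running_def shifted_running_reward_def case_prod_beta indicator_def)
qed

text \<open>Extends the increasing parts to level \<open>0\<close> by zero, so that all levels share
  one decomposition.\<close>

definition KK :: "nat \<Rightarrow> ('w \<Rightarrow> real) \<Rightarrow> ('w \<Rightarrow> real ^ 'l) \<Rightarrow> real \<Rightarrow> 'w \<Rightarrow> real" where
  "KK m \<nu> \<xi> = (if m = 0 then (\<lambda>_ _. 0) else K m \<nu> \<xi>)"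

lemma Y_decomposed:
  assumes "start_data M T B \<nu> \<xi>"
  shows "decomposed (shifted_running_reward L h \<nu> \<xi>) (Y m \<nu> \<xi>) (KK m \<nu> \<xi>)"
  using bsde_decomposed[OF Y_0[OF assms]] rbsde_decomposed[OF Y_Suc[OF assms]]
  by (cases m) (auto simp: KK_def)

lemma Y_stopped_integrable: "start_data M T B \<nu> \<xi> \<Longrightarrow> stime \<rho> \<Longrightarrow> integrable M (\<lambda>\<omega>. Y m \<nu> \<xi> (\<rho> \<omega>) \<omega>)"
  using decomposed_integrable(1) Y_decomposed by blast

lemma Y_terminal: "start_data M T B \<nu> \<xi> \<Longrightarrow> AE \<omega> in M. Y m \<nu> \<xi> T \<omega> = 0"
  using decomposed_terminal Y_decomposed by blast

abbreviation obst where "obst m \<equiv> impulse_obstacle U \<psi> (Y m)"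

lemma obst_path:
  assumes s: "start_data M T B \<nu> \<xi>"
  shows "progressive M T B (obst m \<nu> \<xi>)" "\<omega> \<in> space M \<Longrightarrow> continuous_on {0..T} (\<lambda>t. obst m \<nu> \<xi> t \<omega>)"
proof -
  note d = decomposed_path[OF Y_decomposed[OF start_shift[OF s]]]
  show "progressive M T B (obst m \<nu> \<xi>)"
    using d(1) unfolding progressive_def impulse_obstacle_def
    by (intro borel_measurable_Max U(1) borel_measurable_add borel_measurable_const)
  show "\<omega> \<in> space M \<Longrightarrow> continuous_on {0..T} (\<lambda>t. obst m \<nu> \<xi> t \<omega>)"
    unfolding impulse_obstacle_def by (intro continuous_on_Max_image U continuous_intros d(3))
qed

text \<open>The index \<open>m\<close> is the level of the family inside the obstacle; the reflected
  solution is one level higher.\<close>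

definition first_contact :: "nat \<Rightarrow> ('w \<Rightarrow> real) \<Rightarrow> ('w \<Rightarrow> real ^ 'l) \<Rightarrow> ('w \<Rightarrow> real) \<Rightarrow> 'w \<Rightarrow> real" where
  "first_contact m \<nu> \<xi> \<rho> = hit \<rho> (\<lambda>t \<omega>. Y (Suc m) \<nu> \<xi> t \<omega> - obst m \<nu> \<xi> t \<omega>)"

lemma first_contact:
  assumes s: "start_data M T B \<nu> \<xi>" and \<rho>: "stime \<rho>"
  shows "stime (first_contact m \<nu> \<xi> \<rho>)"
    "\<omega> \<in> space M \<Longrightarrow> \<rho> \<omega> \<le> first_contact m \<nu> \<xi> \<rho> \<omega>"
    "AE \<omega> in M. KK (Suc m) \<nu> \<xi> (first_contact m \<nu> \<xi> \<rho> \<omega>) \<omega> = KK (Suc m) \<nu> \<xi> (\<rho> \<omega>) \<omega>"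
    "\<omega> \<in> space M \<Longrightarrow> first_contact m \<nu> \<xi> \<rho> \<omega> < T \<Longrightarrow>
       Y (Suc m) \<nu> \<xi> (first_contact m \<nu> \<xi> \<rho> \<omega>) \<omega> \<le> obst m \<nu> \<xi> (first_contact m \<nu> \<xi> \<rho> \<omega>) \<omega>"
proof -
  note d = decomposed_path[OF Y_decomposed[OF s, of "Suc m"]] and o = obst_path[where m=m, OF s]
  have p: "progressive M T B (\<lambda>t \<omega>. Y (Suc m) \<nu> \<xi> t \<omega> - obst m \<nu> \<xi> t \<omega>)"
    using d(1) o(1) by (simp add: progressive_def)
  have c: "\<And>\<omega>. \<omega> \<in> space M \<Longrightarrow> continuous_on {0..T} (\<lambda>t. Y (Suc m) \<nu> \<xi> t \<omega> - obst m \<nu> \<xi> t \<omega>)"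
    using d(3) o(2) by (intro continuous_intros)
  show "stime (first_contact m \<nu> \<xi> \<rho>)" unfolding first_contact_def by (rule hit_stime[OF p c \<rho>])
  note h = hit_props[where \<rho>=\<rho> and X="\<lambda>t \<omega>. Y (Suc m) \<nu> \<xi> t \<omega> - obst m \<nu> \<xi> t \<omega>", OF c stime_range[OF \<rho>]]
  show "\<omega> \<in> space M \<Longrightarrow> \<rho> \<omega> \<le> first_contact m \<nu> \<xi> \<rho> \<omega>"
    using h(1) by (simp add: first_contact_def)
  show "\<omega> \<in> space M \<Longrightarrow> first_contact m \<nu> \<xi> \<rho> \<omega> < T \<Longrightarrow>
       Y (Suc m) \<nu> \<xi> (first_contact m \<nu> \<xi> \<rho> \<omega>) \<omega> \<le> obst m \<nu> \<xi> (first_contact m \<nu> \<xi> \<rho> \<omega>) \<omega>"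
    using h(3) by (simp add: first_contact_def)
  show "AE \<omega> in M. KK (Suc m) \<nu> \<xi> (first_contact m \<nu> \<xi> \<rho> \<omega>) \<omega> = KK (Suc m) \<nu> \<xi> (\<rho> \<omega>) \<omega>"
    using reflection_flat[OF Y_Suc[OF s] o(2) \<rho>] by (simp add: first_contact_def KK_def)
qed

lemma Y_above_obst:
  "start_data M T B \<nu> \<xi> \<Longrightarrow> AE \<omega> in M. \<forall>t\<in>{0..T}. obst m \<nu> \<xi> t \<omega> \<le> Y (Suc m) \<nu> \<xi> t \<omega>"
  using Y_Suc by (auto simp: rbsde_solution_def)

text \<open>Only one inequality is proved, since the hypotheses are symmetric in the two data. The
  comparison runs up to the contact time of the smaller solution. If this is before
  \<open>T\<close>, the smaller solution is at most its obstacle, the induction hypothesis bounds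
  that obstacle by the other one, and the larger solution stays above the latter; at
  \<open>T\<close> both solutions vanish.\<close>

lemma locality_le:
  assumes "start_data M T B \<nu> \<xi>" "start_data M T B \<nu>' \<xi>'" "stime \<rho>"
    "\<And>\<omega>. \<omega> \<in> space M \<Longrightarrow> \<nu> \<omega> \<le> \<rho> \<omega>" "\<And>\<omega>. \<omega> \<in> space M \<Longrightarrow> \<nu>' \<omega> \<le> \<rho> \<omega>"
    "A \<in> sets (Fs \<rho>)" "\<And>\<omega>. \<omega> \<in> A \<Longrightarrow> \<xi> \<omega> = \<xi>' \<omega>"
  shows "AE \<omega> in M. \<omega> \<in> A \<longrightarrow> Y m \<nu> \<xi> (\<rho> \<omega>) \<omega> \<le> Y m \<nu>' \<xi>' (\<rho> \<omega>) \<omega>"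
  using assms
proof (induction m arbitrary: \<nu> \<xi> \<nu>' \<xi>' \<rho>)
  case (0 \<nu> \<xi> \<nu>' \<xi>' \<rho>)
  note d = Y_decomposed[where m=0, OF 0(1)] Y_decomposed[where m=0, OF 0(2)]
  have AM: "A \<subseteq> space M" using sets.sets_into_space[OF 0(6)] by simp
  \<comment> \<open>Level \<open>0\<close> has no reflecting term, so the comparison can run up to
    the horizon.\<close>
  show ?case
  proof (rule comparison[OF running_shifted[OF 0(1)] running_shifted[OF 0(2)] d 0(3) stime_const[of T] _ 0(6)])
    show "T \<in> {0..T}" using T_pos by simp
    show "\<And>\<omega>. \<omega> \<in> space M \<Longrightarrow> \<rho> \<omega> \<le> T" using stime_range[OF 0(3)] by auto
    show "AE \<omega> in M. KK 0 \<nu> \<xi> T \<omega> = KK 0 \<nu> \<xi> (\<rho> \<omega>) \<omega>" by (simp add: KK_def)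
    show "AE \<omega> in M. \<omega> \<in> A \<longrightarrow> Y 0 \<nu> \<xi> T \<omega> \<le> Y 0 \<nu>' \<xi>' T \<omega>"
      using Y_terminal[OF 0(1), of 0] Y_terminal[OF 0(2), of 0] by eventually_elim simp
    fix \<omega> s assume "\<omega> \<in> A" "\<rho> \<omega> \<le> s" "s \<le> T"
    then show "shifted_running_reward L h \<nu> \<xi> s \<omega> = shifted_running_reward L h \<nu>' \<xi>' s \<omega>"
      using 0(4,5,7)[of \<omega>] AM by (auto simp: shifted_running_reward_def indicator_def)
  qed
next
  case (Suc m \<nu> \<xi> \<nu>' \<xi>' \<rho>)
  note d = Y_decomposed[OF Suc.prems(1), of "Suc m"] Y_decomposed[OF Suc.prems(2), of "Suc m"]
  define D where "D = first_contact m \<nu> \<xi> \<rho>"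
  note D = first_contact[where m=m, OF Suc.prems(1,3), folded D_def]
  have AM: "A \<subseteq> space M" using sets.sets_into_space[OF Suc.prems(6)] by simp
  have AD: "A \<in> sets (Fs D)"
    using Suc.prems(6) filt.mono_pre_sigma[OF stime_stopping[OF Suc.prems(3)] stime_stopping[OF D(1)]] D(2) by auto
  \<comment> \<open>The induction hypothesis is used at the later time \<open>D\<close>, when
    \<open>A\<close> is still known, and with both data shifted by \<open>\<beta>\<close>. Each
    \<open>\<beta>\<close> brings its own null set; finiteness of \<open>U\<close> merges
    them.\<close>
  have "AE \<omega> in M. \<forall>\<beta>\<in>U. \<omega> \<in> A \<longrightarrow> Y m \<nu> (\<lambda>\<omega>. \<xi> \<omega> + \<beta>) (D \<omega>) \<omega> \<le> Y m \<nu>' (\<lambda>\<omega>. \<xi>' \<omega> + \<beta>) (D \<omega>) \<omega>"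
    using U(1)
  proof (rule AE_finite_allI)
    fix \<beta>
    show "AE \<omega> in M. \<omega> \<in> A \<longrightarrow> Y m \<nu> (\<lambda>\<omega>. \<xi> \<omega> + \<beta>) (D \<omega>) \<omega> \<le> Y m \<nu>' (\<lambda>\<omega>. \<xi>' \<omega> + \<beta>) (D \<omega>) \<omega>"
      by (rule Suc.IH[OF start_shift[OF Suc.prems(1)] start_shift[OF Suc.prems(2)] D(1) _ _ AD])
        (use order_trans[OF Suc.prems(4) D(2)] order_trans[OF Suc.prems(5) D(2)] Suc.prems(7) in auto)
  qed
  then have y: "AE \<omega> in M. \<omega> \<in> A \<longrightarrow> Y (Suc m) \<nu> \<xi> (D \<omega>) \<omega> \<le> Y (Suc m) \<nu>' \<xi>' (D \<omega>) \<omega>"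
    using Y_above_obst[OF Suc.prems(2), of m] Y_terminal[OF Suc.prems(1), of "Suc m"] Y_terminal[OF Suc.prems(2), of "Suc m"] AE_space
  proof eventually_elim
    case (elim \<omega>)
    show ?case
    proof
      assume A: "\<omega> \<in> A"
      have r: "D \<omega> \<in> {0..T}" using stime_range[OF D(1) elim(5)] by simp
      show "Y (Suc m) \<nu> \<xi> (D \<omega>) \<omega> \<le> Y (Suc m) \<nu>' \<xi>' (D \<omega>) \<omega>"
      proof (cases "D \<omega> < T")
        case True
        have "obst m \<nu> \<xi> (D \<omega>) \<omega> \<le> obst m \<nu>' \<xi>' (D \<omega>) \<omega>"
          unfolding impulse_obstacle_def
        proof (rule Max.boundedI)
          fix x assume "x \<in> (\<lambda>\<beta>. - \<psi> \<beta> + Y m \<nu> (\<lambda>\<omega>'. \<xi> \<omega>' + \<beta>) (D \<omega>) \<omega>) ` U"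
          then obtain \<beta> where \<beta>: "\<beta> \<in> U" "x = - \<psi> \<beta> + Y m \<nu> (\<lambda>\<omega>'. \<xi> \<omega>' + \<beta>) (D \<omega>) \<omega>" by auto
          then have "x \<le> - \<psi> \<beta> + Y m \<nu>' (\<lambda>\<omega>'. \<xi>' \<omega>' + \<beta>) (D \<omega>) \<omega>" using elim(1) A by auto
          also have "\<dots> \<le> Max ((\<lambda>\<beta>. - \<psi> \<beta> + Y m \<nu>' (\<lambda>\<omega>'. \<xi>' \<omega>' + \<beta>) (D \<omega>) \<omega>) ` U)"
            using U \<beta> by (intro Max_ge) auto
          finally show "x \<le> Max ((\<lambda>\<beta>. - \<psi> \<beta> + Y m \<nu>' (\<lambda>\<omega>'. \<xi>' \<omega>' + \<beta>) (D \<omega>) \<omega>) ` U)" .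
        qed (use U in auto)
        then show ?thesis using D(4)[OF elim(5) True] elim(2) r by fastforce
      next
        case False
        then have "D \<omega> = T" using r by auto
        then show ?thesis using elim by simp
      qed
    qed
  qed
  show ?case
  proof (rule comparison[OF running_shifted[OF Suc.prems(1)] running_shifted[OF Suc.prems(2)] d Suc.prems(3) D(1,2) Suc.prems(6) _ D(3) y])
    fix \<omega> s assume "\<omega> \<in> A" "\<rho> \<omega> \<le> s" "s \<le> T"
    then show "shifted_running_reward L h \<nu> \<xi> s \<omega> = shifted_running_reward L h \<nu>' \<xi>' s \<omega>"
      using Suc.prems(4,5,7)[of \<omega>] AM by (auto simp: shifted_running_reward_def indicator_def)
  qed
qed

text \<open>On the right \<open>\<eta> \<omega>\<close> is frozen: the process is the one for a
  constant impulse, selected afterwards according to the scenario. Both sides agree on each event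
  \<open>\<eta> = \<beta>\<close> by \<open>locality_le\<close> in both directions, and these
  finitely many events cover the space.\<close>

lemma locality_random:
  assumes s: "start_data M T B \<nu> \<xi>" and \<tau>: "stime \<tau>" and le: "\<And>\<omega>. \<omega> \<in> space M \<Longrightarrow> \<nu> \<omega> \<le> \<tau> \<omega>"
    and \<eta>: "\<eta> \<in> borel_measurable (Fs \<tau>)" "\<And>\<omega>. \<omega> \<in> space M \<Longrightarrow> \<eta> \<omega> \<in> U"
  shows "AE \<omega> in M. Y m \<tau> (\<lambda>\<omega>. \<xi> \<omega> + \<eta> \<omega>) (\<tau> \<omega>) \<omega> = Y m \<nu> (\<lambda>\<omega>'. \<xi> \<omega>' + \<eta> \<omega>) (\<tau> \<omega>) \<omega>"
proof -
  note s' = start_later[OF s \<tau> le \<eta>(1)]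
  have "AE \<omega> in M. \<forall>\<beta>\<in>U. \<eta> \<omega> = \<beta> \<longrightarrow> Y m \<tau> (\<lambda>\<omega>. \<xi> \<omega> + \<eta> \<omega>) (\<tau> \<omega>) \<omega> = Y m \<nu> (\<lambda>\<omega>'. \<xi> \<omega>' + \<beta>) (\<tau> \<omega>) \<omega>"
    using U(1)
  proof (rule AE_finite_allI)
    fix \<beta>
    let ?A = "{\<omega>\<in>space (Fs \<tau>). \<eta> \<omega> = \<beta>}"
    have A: "?A \<in> sets (Fs \<tau>)" using \<eta>(1) by measurable
    have "AE \<omega> in M. \<omega> \<in> ?A \<longrightarrow> Y m \<tau> (\<lambda>\<omega>. \<xi> \<omega> + \<eta> \<omega>) (\<tau> \<omega>) \<omega> \<le> Y m \<nu> (\<lambda>\<omega>'. \<xi> \<omega>' + \<beta>) (\<tau> \<omega>) \<omega>"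
      by (rule locality_le[OF s' start_shift[OF s] \<tau> _ _ A]) (use le in auto)
    moreover have "AE \<omega> in M. \<omega> \<in> ?A \<longrightarrow> Y m \<nu> (\<lambda>\<omega>'. \<xi> \<omega>' + \<beta>) (\<tau> \<omega>) \<omega> \<le> Y m \<tau> (\<lambda>\<omega>. \<xi> \<omega> + \<eta> \<omega>) (\<tau> \<omega>) \<omega>"
      by (rule locality_le[OF start_shift[OF s] s' \<tau> _ _ A]) (use le in auto)
    ultimately show "AE \<omega> in M. \<eta> \<omega> = \<beta> \<longrightarrow> Y m \<tau> (\<lambda>\<omega>. \<xi> \<omega> + \<eta> \<omega>) (\<tau> \<omega>) \<omega> = Y m \<nu> (\<lambda>\<omega>'. \<xi> \<omega>' + \<beta>) (\<tau> \<omega>) \<omega>"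
      using AE_space by eventually_elim auto
  qed
  then show ?thesis using AE_space by eventually_elim (use \<eta>(2) in auto)
qed

end

section \<open>One impulse at a time\<close>

context brownian begin

text \<open>The right endpoint is left out of the agreement because the controlled process already
  jumps there, at the time of the next impulse.\<close>

lemma running_integral_cong:
  assumes f: "running f C" and g: "running g C'" and \<omega>: "\<omega> \<in> space M" and ab: "0 \<le> a" "b \<le> T"
    and eq: "\<And>s. a \<le> s \<Longrightarrow> s < b \<Longrightarrow> f s \<omega> = g s \<omega>"
  shows "(LINT s:{a..b}|lborel. f s \<omega>) = (LINT s:{a..b}|lborel. g s \<omega>)"
  unfolding set_lebesgue_integral_def
proof (rule integral_cong_AE)
  have "{a..b} \<in> sets borel" "{a..b} \<subseteq> {0..T}" using ab by auto
  note i = running_set_integrable[OF _ \<omega> this, unfolded set_integrable_def, THEN borel_measurable_integrable]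
  show "(\<lambda>s. indicator {a..b} s *\<^sub>R f s \<omega>) \<in> borel_measurable lborel"
    "(\<lambda>s. indicator {a..b} s *\<^sub>R g s \<omega>) \<in> borel_measurable lborel"
    using i[OF f] i[OF g] by auto
  show "AE s in lborel. indicator {a..b} s *\<^sub>R f s \<omega> = indicator {a..b} s *\<^sub>R g s \<omega>"
    using AE_lborel_singleton[of b]
  proof eventually_elim
    case (elim s)
    then show ?case using eq[of s] by (auto simp: indicator_def)
  qed
qed

text \<open>At every level \<open>t\<close> the two traces of an event differ by null sets, and the
  completed filtration contains these. It allows the impulses of a strategy to be attached to
  corrected versions of its stopping times.\<close>

lemma Fs_subset_AE_eq:
  assumes st: "stopping_time F \<tau>" "stopping_time F \<tau>'" and eq: "AE \<omega> in M. \<tau> \<omega> = \<tau>' \<omega>"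
  shows "sets (Fs \<tau>) \<subseteq> sets (Fs \<tau>')"
proof
  fix A assume A: "A \<in> sets (Fs \<tau>)"
  then have AM: "A \<in> sets M" using sets_Fs_subset[OF st(1)] by auto
  note [measurable] = st[THEN stopping_measurable] AM
  show "A \<in> sets (Fs \<tau>')"
  proof (rule filt.sets_pre_sigmaI[OF st(2)])
    fix t
    have null: "{\<omega>\<in>space M. \<not> \<tau> \<omega> = \<tau>' \<omega>} \<in> null_sets M"
      using eq by (subst (asm) AE_iff_null) auto
    let ?N = "\<lambda>P. {\<omega>\<in>space M. \<omega> \<in> A \<and> P \<omega>}"
    have N: "?N (\<lambda>\<omega>. \<tau> \<omega> \<le> t \<and> \<not> \<tau>' \<omega> \<le> t) \<in> sets (F t)" "?N (\<lambda>\<omega>. \<tau>' \<omega> \<le> t \<and> \<not> \<tau> \<omega> \<le> t) \<in> sets (F t)"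
      by (rule null_sets_F[OF null_sets_subset[OF null]]; force)+
    have "{\<omega>\<in>A. \<tau>' \<omega> \<le> t} = ({\<omega>\<in>A. \<tau> \<omega> \<le> t} - ?N (\<lambda>\<omega>. \<tau> \<omega> \<le> t \<and> \<not> \<tau>' \<omega> \<le> t)) \<union> ?N (\<lambda>\<omega>. \<tau>' \<omega> \<le> t \<and> \<not> \<tau> \<omega> \<le> t)"
      using sets.sets_into_space[OF AM] by auto
    also have "\<dots> \<in> sets (F t)" using N filt.sets_pre_sigmaD[OF st(1) A] by blast
    finally show "{\<omega>\<in>A. \<tau>' \<omega> \<le> t} \<in> sets (F t)" .
  qed
qed

end

text \<open>The times of a strategy are ordered and lie in \<open>{0..T}\<close> only almost surely; \<open>clipped_max\<close>
  produces versions for which this holds everywhere, shifted by one index to start at time \<open>0\<close>.\<close>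

primrec clipped_max :: "real \<Rightarrow> (nat \<Rightarrow> 'w \<Rightarrow> real) \<Rightarrow> nat \<Rightarrow> 'w \<Rightarrow> real" where
  "clipped_max T t 0 = (\<lambda>_. 0)"
| "clipped_max T t (Suc k) = (\<lambda>\<omega>. max (clipped_max T t k \<omega>) (min T (t k \<omega>)))"

lemma clipped_max_eq:
  assumes "0 \<le> t 0 \<omega>" "\<And>k. t k \<omega> \<le> t (Suc k) \<omega>" "\<And>k. t k \<omega> \<le> T"
  shows "clipped_max T t (Suc k) \<omega> = t k \<omega>"
proof (induction k)
  case (Suc k)
  then show ?case using assms(2)[of k] assms(3)[of "Suc k"] by (subst clipped_max.simps(2)) simp
qed (use assms(1) assms(3)[of 0] in simp)

context brownian begin

lemma clipped_max_stime:
  assumes "\<And>k. stopping_time F (t k)" shows "stime (clipped_max T t k)"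
proof (induction k)
  case 0
  then show ?case using T_pos by (simp add: stime_const)
next
  case (Suc k)
  then show ?case using assms
    by (auto simp: stime_def le_max_iff_disj min_le_iff_disj intro!: stopping_time_max stopping_time_min stopping_time_const)
qed

end

context impulse_control begin

section \<open>Expected gain, cost and continuation value of a single impulse\<close>

definition gain :: "('w \<Rightarrow> real) \<Rightarrow> ('w \<Rightarrow> real ^ 'l) \<Rightarrow> ('w \<Rightarrow> real) \<Rightarrow> real" where
  "gain \<nu> \<xi> \<tau> = (\<integral>\<omega>. (LINT s:{\<nu> \<omega>..\<tau> \<omega>}|lborel. shifted_running_reward L h \<nu> \<xi> s \<omega>) \<partial>M)"

definition cost :: "('w \<Rightarrow> real) \<Rightarrow> ('w \<Rightarrow> real ^ 'l) \<Rightarrow> real" where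
  "cost \<tau> \<eta> = (\<integral>\<omega>. \<psi> (\<eta> \<omega>) * indicator {..<T} (\<tau> \<omega>) \<partial>M)"

text \<open>The candidate for the best expected reward from \<open>\<nu>\<close> on with
  \<open>m\<close> impulses left, when the impulses made so far add up to
  \<open>\<xi>\<close>.\<close>

definition W :: "nat \<Rightarrow> ('w \<Rightarrow> real) \<Rightarrow> ('w \<Rightarrow> real ^ 'l) \<Rightarrow> real" where
  "W m \<nu> \<xi> = (\<integral>\<omega>. Y m \<nu> \<xi> (\<nu> \<omega>) \<omega> \<partial>M)"

lemma gain_integrable:
  assumes s: "start_data M T B \<nu> \<xi>" and \<tau>: "stime \<tau>" "\<And>\<omega>. \<omega> \<in> space M \<Longrightarrow> \<nu> \<omega> \<le> \<tau> \<omega>"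
  shows "integrable M (\<lambda>\<omega>. LINT s:{\<nu> \<omega>..\<tau> \<omega>}|lborel. shifted_running_reward L h \<nu> \<xi> s \<omega>)"
  by (rule running_integral_integrable[OF running_shifted[OF s]])
    (use stopping_measurable stime_stopping start_stime[OF s] stime_range[OF start_stime[OF s]] stime_range[OF \<tau>(1)] \<tau> in auto)

lemma psi_measurable:
  "\<eta> \<in> borel_measurable N \<Longrightarrow> (\<And>\<omega>. \<omega> \<in> space N \<Longrightarrow> \<eta> \<omega> \<in> U) \<Longrightarrow> (\<lambda>\<omega>. \<psi> (\<eta> \<omega>)) \<in> borel_measurable N"
  by (rule measurable_finite_range[OF U(1)])

lemma cost_integrable:
  assumes [measurable]: "\<tau> \<in> borel_measurable M" and \<eta>: "\<eta> \<in> borel_measurable M" "\<And>\<omega>. \<omega> \<in> space M \<Longrightarrow> \<eta> \<omega> \<in> U"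
  shows "integrable M (\<lambda>\<omega>. \<psi> (\<eta> \<omega>) * indicator {..<T} (\<tau> \<omega>))"
proof (rule integrable_const_bound[where B = "Max ((\<lambda>\<beta>. \<bar>\<psi> \<beta>\<bar>) ` U)"])
  have "\<bar>\<psi> (\<eta> \<omega>)\<bar> \<le> Max ((\<lambda>\<beta>. \<bar>\<psi> \<beta>\<bar>) ` U)" if "\<omega> \<in> space M" for \<omega>
    using U \<eta>(2)[OF that] by (intro Max_ge) auto
  then show "AE \<omega> in M. norm (\<psi> (\<eta> \<omega>) * indicator {..<T} (\<tau> \<omega>)) \<le> Max ((\<lambda>\<beta>. \<bar>\<psi> \<beta>\<bar>) ` U)"
    by (intro AE_I2) (auto simp: indicator_def intro: order_trans[OF abs_ge_zero])
  show "(\<lambda>\<omega>. \<psi> (\<eta> \<omega>) * indicator {..<T} (\<tau> \<omega>)) \<in> borel_measurable M"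
    using psi_measurable[OF \<eta>] by measurable
qed

lemma W_stopped:
  assumes s: "start_data M T B \<nu> \<xi>" and \<tau>: "stime \<tau>" "\<And>\<omega>. \<omega> \<in> space M \<Longrightarrow> \<nu> \<omega> \<le> \<tau> \<omega>"
  shows "W m \<nu> \<xi> = (\<integral>\<omega>. (LINT s:{\<nu> \<omega>..\<tau> \<omega>}|lborel. shifted_running_reward L h \<nu> \<xi> s \<omega>) + Y m \<nu> \<xi> (\<tau> \<omega>) \<omega>
     + (KK m \<nu> \<xi> (\<tau> \<omega>) \<omega> - KK m \<nu> \<xi> (\<nu> \<omega>) \<omega>) \<partial>M)"
    "integrable M (\<lambda>\<omega>. (LINT s:{\<nu> \<omega>..\<tau> \<omega>}|lborel. shifted_running_reward L h \<nu> \<xi> s \<omega>) + Y m \<nu> \<xi> (\<tau> \<omega>) \<omega>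
     + (KK m \<nu> \<xi> (\<tau> \<omega>) \<omega> - KK m \<nu> \<xi> (\<nu> \<omega>) \<omega>))"
proof -
  have ind: "(\<integral>\<omega>. f \<omega> \<partial>M) = (\<integral>\<omega>. indicator (space M) \<omega> * f \<omega> \<partial>M)" for f :: "'w \<Rightarrow> real"
    by (intro Bochner_Integration.integral_cong) auto
  have sp: "space M \<in> sets (Fs \<nu>)" using sets.top[of "Fs \<nu>"] by simp
  show "W m \<nu> \<xi> = (\<integral>\<omega>. (LINT s:{\<nu> \<omega>..\<tau> \<omega>}|lborel. shifted_running_reward L h \<nu> \<xi> s \<omega>) + Y m \<nu> \<xi> (\<tau> \<omega>) \<omega>
     + (KK m \<nu> \<xi> (\<tau> \<omega>) \<omega> - KK m \<nu> \<xi> (\<nu> \<omega>) \<omega>) \<partial>M)"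
    unfolding W_def by (subst (1 2) ind) (rule decomposed_stopped[OF running_shifted[OF s] Y_decomposed[OF s] start_stime[OF s] \<tau> sp])
  show "integrable M (\<lambda>\<omega>. (LINT s:{\<nu> \<omega>..\<tau> \<omega>}|lborel. shifted_running_reward L h \<nu> \<xi> s \<omega>) + Y m \<nu> \<xi> (\<tau> \<omega>) \<omega>
     + (KK m \<nu> \<xi> (\<tau> \<omega>) \<omega> - KK m \<nu> \<xi> (\<nu> \<omega>) \<omega>))"
    by (intro Bochner_Integration.integrable_add Bochner_Integration.integrable_diff gain_integrable s \<tau>
        decomposed_integrable[OF Y_decomposed[OF s]] start_stime[OF s])
qed

text \<open>At level \<open>0\<close> nothing reflects and the terminal value is zero, so only the
  running reward up to \<open>T\<close> remains.\<close>

lemma W_0: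
  assumes s: "start_data M T B \<nu> \<xi>" shows "W 0 \<nu> \<xi> = gain \<nu> \<xi> (\<lambda>_. T)"
proof -
  have T: "stime (\<lambda>_. T)" "\<And>\<omega>. \<omega> \<in> space M \<Longrightarrow> \<nu> \<omega> \<le> T"
    using T_pos stime_range[OF start_stime[OF s]] by (auto intro: stime_const)
  show ?thesis
    unfolding gain_def
  proof (subst W_stopped(1)[OF s T], assumption, rule integral_cong_AE)
    show "AE \<omega> in M. (LINT s:{\<nu> \<omega>..T}|lborel. shifted_running_reward L h \<nu> \<xi> s \<omega>) + Y 0 \<nu> \<xi> T \<omega>
     + (KK 0 \<nu> \<xi> T \<omega> - KK 0 \<nu> \<xi> (\<nu> \<omega>) \<omega>) = (LINT s:{\<nu> \<omega>..T}|lborel. shifted_running_reward L h \<nu> \<xi> s \<omega>)"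
      using Y_terminal[OF s, of 0] by eventually_elim (simp add: KK_def)
  qed (use W_stopped(2)[OF s T, of 0] gain_integrable[OF s T] in \<open>auto intro: borel_measurable_integrable\<close>)
qed

text \<open>Gathers the three expectations under one integral, to be compared scenario by scenario
  with the integrand of \<open>W_stopped\<close>.\<close>

lemma step_value:
  assumes s: "start_data M T B \<nu> \<xi>" and \<tau>: "stime \<tau>" "\<And>\<omega>. \<omega> \<in> space M \<Longrightarrow> \<nu> \<omega> \<le> \<tau> \<omega>"
    and \<eta>: "\<eta> \<in> borel_measurable (Fs \<tau>)" "\<And>\<omega>. \<omega> \<in> space M \<Longrightarrow> \<eta> \<omega> \<in> U"
  shows "gain \<nu> \<xi> \<tau> - cost \<tau> \<eta> + W m \<tau> (\<lambda>\<omega>. \<xi> \<omega> + \<eta> \<omega>) =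
     (\<integral>\<omega>. (LINT s:{\<nu> \<omega>..\<tau> \<omega>}|lborel. shifted_running_reward L h \<nu> \<xi> s \<omega>)
       - \<psi> (\<eta> \<omega>) * indicator {..<T} (\<tau> \<omega>) + Y m \<tau> (\<lambda>\<omega>. \<xi> \<omega> + \<eta> \<omega>) (\<tau> \<omega>) \<omega> \<partial>M)"
    "integrable M (\<lambda>\<omega>. (LINT s:{\<nu> \<omega>..\<tau> \<omega>}|lborel. shifted_running_reward L h \<nu> \<xi> s \<omega>)
       - \<psi> (\<eta> \<omega>) * indicator {..<T} (\<tau> \<omega>) + Y m \<tau> (\<lambda>\<omega>. \<xi> \<omega> + \<eta> \<omega>) (\<tau> \<omega>) \<omega>)"
proof -
  note st = stime_stopping[OF \<tau>(1)]
  note i = gain_integrable[OF s \<tau>] cost_integrable[OF stopping_measurable[OF st] Fs_measurable[OF st \<eta>(1)] \<eta>(2)]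
    Y_stopped_integrable[OF start_later[OF s \<tau> \<eta>(1)] \<tau>(1), of m]
  show "gain \<nu> \<xi> \<tau> - cost \<tau> \<eta> + W m \<tau> (\<lambda>\<omega>. \<xi> \<omega> + \<eta> \<omega>) =
     (\<integral>\<omega>. (LINT s:{\<nu> \<omega>..\<tau> \<omega>}|lborel. shifted_running_reward L h \<nu> \<xi> s \<omega>)
       - \<psi> (\<eta> \<omega>) * indicator {..<T} (\<tau> \<omega>) + Y m \<tau> (\<lambda>\<omega>. \<xi> \<omega> + \<eta> \<omega>) (\<tau> \<omega>) \<omega> \<partial>M)"
    unfolding gain_def cost_def W_def
    by (subst Bochner_Integration.integral_add) (use i in simp_all)
  show "integrable M (\<lambda>\<omega>. (LINT s:{\<nu> \<omega>..\<tau> \<omega>}|lborel. shifted_running_reward L h \<nu> \<xi> s \<omega>)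
       - \<psi> (\<eta> \<omega>) * indicator {..<T} (\<tau> \<omega>) + Y m \<tau> (\<lambda>\<omega>. \<xi> \<omega> + \<eta> \<omega>) (\<tau> \<omega>) \<omega>)"
    using i by simp
qed

text \<open>Two losses separate the sides: the growth of \<open>KK\<close> between
  \<open>\<nu>\<close> and \<open>\<tau>\<close>, and the gap at \<open>\<tau>\<close> between the
  chosen impulse followed by level \<open>m\<close> and the reflected value. The first is
  nonnegative by monotonicity; the second is so because \<open>locality_random\<close> turns the
  continuation value into one of the terms of the obstacle.\<close>

lemma step_le:
  assumes s: "start_data M T B \<nu> \<xi>" and \<tau>: "stime \<tau>" "\<And>\<omega>. \<omega> \<in> space M \<Longrightarrow> \<nu> \<omega> \<le> \<tau> \<omega>"
    and \<eta>: "\<eta> \<in> borel_measurable (Fs \<tau>)" "\<And>\<omega>. \<omega> \<in> space M \<Longrightarrow> \<eta> \<omega> \<in> U"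
  shows "gain \<nu> \<xi> \<tau> - cost \<tau> \<eta> + W m \<tau> (\<lambda>\<omega>. \<xi> \<omega> + \<eta> \<omega>) \<le> W (Suc m) \<nu> \<xi>"
proof -
  have loc: "AE \<omega> in M. Y m \<tau> (\<lambda>\<omega>. \<xi> \<omega> + \<eta> \<omega>) (\<tau> \<omega>) \<omega> = Y m \<nu> (\<lambda>\<omega>'. \<xi> \<omega>' + \<eta> \<omega>) (\<tau> \<omega>) \<omega>"
    by (rule locality_random[OF s \<tau> \<eta>])
  have start': "start_data M T B \<tau> (\<lambda>\<omega>. \<xi> \<omega> + \<eta> \<omega>)" by (rule start_later[OF s \<tau> \<eta>(1)])
  let ?X = "\<lambda>\<omega>. (LINT s:{\<nu> \<omega>..\<tau> \<omega>}|lborel. shifted_running_reward L h \<nu> \<xi> s \<omega>)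
       - \<psi> (\<eta> \<omega>) * indicator {..<T} (\<tau> \<omega>) + Y m \<tau> (\<lambda>\<omega>. \<xi> \<omega> + \<eta> \<omega>) (\<tau> \<omega>) \<omega>"
  let ?Z = "\<lambda>\<omega>. (LINT s:{\<nu> \<omega>..\<tau> \<omega>}|lborel. shifted_running_reward L h \<nu> \<xi> s \<omega>) + Y (Suc m) \<nu> \<xi> (\<tau> \<omega>) \<omega>
     + (KK (Suc m) \<nu> \<xi> (\<tau> \<omega>) \<omega> - KK (Suc m) \<nu> \<xi> (\<nu> \<omega>) \<omega>)"
  have "gain \<nu> \<xi> \<tau> - cost \<tau> \<eta> + W m \<tau> (\<lambda>\<omega>. \<xi> \<omega> + \<eta> \<omega>) = (\<integral>\<omega>. ?X \<omega> \<partial>M)"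
    by (rule step_value(1)[OF s \<tau> \<eta>])
  moreover have "W (Suc m) \<nu> \<xi> = (\<integral>\<omega>. ?Z \<omega> \<partial>M)" by (rule W_stopped(1)[OF s \<tau>])
  moreover have iX: "integrable M ?X" by (rule step_value(2)[OF s \<tau> \<eta>])
  moreover have iZ: "integrable M ?Z" by (rule W_stopped(2)[OF s \<tau>])
  moreover have "AE \<omega> in M. ?X \<omega> \<le> ?Z \<omega>"
    using loc Y_above_obst[OF s, of m] Y_terminal[OF s, of "Suc m"]
      Y_terminal[OF start', of m] AE_space
  proof eventually_elim
    case (elim \<omega>)
    note r = stime_range[OF \<tau>(1) elim(5)] stime_range[OF start_stime[OF s] elim(5)] \<tau>(2)[OF elim(5)]
    have "KK (Suc m) \<nu> \<xi> (\<nu> \<omega>) \<omega> \<le> KK (Suc m) \<nu> \<xi> (\<tau> \<omega>) \<omega>"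
      using decomposed_path(5)[OF Y_decomposed[OF s] elim(5)] r by (auto simp: mono_on_def)
    moreover have "- \<psi> (\<eta> \<omega>) * indicator {..<T} (\<tau> \<omega>) + Y m \<tau> (\<lambda>\<omega>. \<xi> \<omega> + \<eta> \<omega>) (\<tau> \<omega>) \<omega> \<le> Y (Suc m) \<nu> \<xi> (\<tau> \<omega>) \<omega>"
    proof (cases "\<tau> \<omega> < T")
      case True
      have "- \<psi> (\<eta> \<omega>) + Y m \<nu> (\<lambda>\<omega>'. \<xi> \<omega>' + \<eta> \<omega>) (\<tau> \<omega>) \<omega> \<le> obst m \<nu> \<xi> (\<tau> \<omega>) \<omega>"
        unfolding impulse_obstacle_def using U \<eta>(2)[OF elim(5)] by (intro Max_ge) auto
      also have "\<dots> \<le> Y (Suc m) \<nu> \<xi> (\<tau> \<omega>) \<omega>" using elim(2) r by auto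
      finally show ?thesis using elim(1) True by simp
    next
      case False
      then have "\<tau> \<omega> = T" using r by simp
      then show ?thesis using elim by simp
    qed
    ultimately show ?case by simp
  qed
  ultimately show ?thesis using integral_mono_AE[OF iX iZ] by simp
qed

text \<open>Both losses in \<open>step_le\<close> vanish: \<open>KK\<close> is flat up to the
  contact time, and at contact the maximising impulse gives exactly the reflected value.\<close>

lemma step_attained:
  assumes s: "start_data M T B \<nu> \<xi>"
  shows "\<exists>\<tau> \<eta>. stime \<tau> \<and> (\<forall>\<omega>\<in>space M. \<nu> \<omega> \<le> \<tau> \<omega>) \<and> \<eta> \<in> borel_measurable (Fs \<tau>) \<and> (\<forall>\<omega>\<in>space M. \<eta> \<omega> \<in> U) \<and>
     gain \<nu> \<xi> \<tau> - cost \<tau> \<eta> + W m \<tau> (\<lambda>\<omega>. \<xi> \<omega> + \<eta> \<omega>) = W (Suc m) \<nu> \<xi>"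
proof -
  define \<tau> where "\<tau> = first_contact m \<nu> \<xi> \<nu>"
  note fc = first_contact[where m=m, OF s start_stime[OF s], folded \<tau>_def]
  note \<tau> = fc(1,2)
  let ?v = "\<lambda>\<beta> \<omega>. - \<psi> \<beta> + Y m \<nu> (\<lambda>\<omega>'. \<xi> \<omega>' + \<beta>) (\<tau> \<omega>) \<omega>"
  have "?v \<beta> \<in> borel_measurable (Fs \<tau>)" for \<beta>
    using progressive_stopped[OF decomposed_path(1)[OF Y_decomposed[OF start_shift[OF s]]] \<tau>(1)]
    by (intro borel_measurable_add borel_measurable_const)
  from measurable_argmax[where v="?v", OF U this]
  obtain \<eta> where \<eta>: "\<eta> \<in> borel_measurable (Fs \<tau>)" and \<eta>': "\<And>\<omega>. \<omega> \<in> space M \<Longrightarrow> \<eta> \<omega> \<in> U \<and> ?v (\<eta> \<omega>) \<omega> = Max ((\<lambda>\<beta>. ?v \<beta> \<omega>) ` U)"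
    by auto
  then have \<eta>U: "\<And>\<omega>. \<omega> \<in> space M \<Longrightarrow> \<eta> \<omega> \<in> U" by blast
  have loc: "AE \<omega> in M. Y m \<tau> (\<lambda>\<omega>. \<xi> \<omega> + \<eta> \<omega>) (\<tau> \<omega>) \<omega> = Y m \<nu> (\<lambda>\<omega>'. \<xi> \<omega>' + \<eta> \<omega>) (\<tau> \<omega>) \<omega>"
    by (rule locality_random[OF s \<tau> \<eta> \<eta>U])
  have start': "start_data M T B \<tau> (\<lambda>\<omega>. \<xi> \<omega> + \<eta> \<omega>)" by (rule start_later[OF s \<tau> \<eta>])
  let ?X = "\<lambda>\<omega>. (LINT s:{\<nu> \<omega>..\<tau> \<omega>}|lborel. shifted_running_reward L h \<nu> \<xi> s \<omega>)
       - \<psi> (\<eta> \<omega>) * indicator {..<T} (\<tau> \<omega>) + Y m \<tau> (\<lambda>\<omega>. \<xi> \<omega> + \<eta> \<omega>) (\<tau> \<omega>) \<omega>"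
  let ?Z = "\<lambda>\<omega>. (LINT s:{\<nu> \<omega>..\<tau> \<omega>}|lborel. shifted_running_reward L h \<nu> \<xi> s \<omega>) + Y (Suc m) \<nu> \<xi> (\<tau> \<omega>) \<omega>
     + (KK (Suc m) \<nu> \<xi> (\<tau> \<omega>) \<omega> - KK (Suc m) \<nu> \<xi> (\<nu> \<omega>) \<omega>)"
  have "gain \<nu> \<xi> \<tau> - cost \<tau> \<eta> + W m \<tau> (\<lambda>\<omega>. \<xi> \<omega> + \<eta> \<omega>) = (\<integral>\<omega>. ?X \<omega> \<partial>M)"
    by (rule step_value(1)[OF s \<tau> \<eta> \<eta>U])
  also have "\<dots> = (\<integral>\<omega>. ?Z \<omega> \<partial>M)"
  proof (rule integral_cong_AE)
    show "?X \<in> borel_measurable M"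
      by (intro borel_measurable_integrable) (rule step_value(2)[OF s \<tau> \<eta> \<eta>U])
    show "?Z \<in> borel_measurable M"
      by (intro borel_measurable_integrable) (rule W_stopped(2)[OF s \<tau>])
    show "AE \<omega> in M. ?X \<omega> = ?Z \<omega>"
      using loc Y_above_obst[OF s, of m] Y_terminal[OF s, of "Suc m"]
        Y_terminal[OF start', of m] fc(3) AE_space
    proof eventually_elim
      case (elim \<omega>)
      note r = stime_range[OF \<tau>(1) elim(6)]
      have "- \<psi> (\<eta> \<omega>) * indicator {..<T} (\<tau> \<omega>) + Y m \<tau> (\<lambda>\<omega>. \<xi> \<omega> + \<eta> \<omega>) (\<tau> \<omega>) \<omega> = Y (Suc m) \<nu> \<xi> (\<tau> \<omega>) \<omega>"
      proof (cases "\<tau> \<omega> < T")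
        case True
        have "?v (\<eta> \<omega>) \<omega> = obst m \<nu> \<xi> (\<tau> \<omega>) \<omega>"
          using \<eta>'[OF elim(6)] by (simp add: impulse_obstacle_def)
        also have "\<dots> = Y (Suc m) \<nu> \<xi> (\<tau> \<omega>) \<omega>" using elim(2) r fc(4)[OF elim(6) True] by (intro antisym) auto
        finally show ?thesis using elim(1) True by simp
      next
        \<comment> \<open>Here \<open>\<tau>\<close> may be the default value, without contact. Both
          values are zero at \<open>T\<close> and no cost is charged, so equality holds for whatever
          impulse was selected.\<close>
        case False
        then have "\<tau> \<omega> = T" using r by simp
        then show ?thesis using elim by simp
      qed
      then show ?case using elim(5) by simp
    qed
  qed
  also have "\<dots> = W (Suc m) \<nu> \<xi>" by (rule W_stopped(1)[OF s \<tau>, symmetric])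
  finally show ?thesis using \<tau> \<eta> \<eta>U by blast
qed

text \<open>Indices are shifted: \<open>\<sigma> 0\<close> is the starting time, impulse number
  \<open>k\<close> takes place at \<open>\<sigma> (Suc k)\<close>, and \<open>S k\<close> is the
  accumulated shift in force between \<open>\<sigma> k\<close> and
  \<open>\<sigma> (Suc k)\<close>.\<close>

definition chain :: "nat \<Rightarrow> (nat \<Rightarrow> 'w \<Rightarrow> real) \<Rightarrow> (nat \<Rightarrow> 'w \<Rightarrow> real ^ 'l) \<Rightarrow> (nat \<Rightarrow> 'w \<Rightarrow> real ^ 'l) \<Rightarrow> bool" where
  "chain n \<sigma> S \<eta> \<longleftrightarrow> start_data M T B (\<sigma> 0) (S 0) \<and> (\<forall>k<n. stime (\<sigma> (Suc k)) \<and> (\<forall>\<omega>\<in>space M. \<sigma> k \<omega> \<le> \<sigma> (Suc k) \<omega>) \<and>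
     \<eta> k \<in> borel_measurable (Fs (\<sigma> (Suc k))) \<and> (\<forall>\<omega>\<in>space M. \<eta> k \<omega> \<in> U) \<and> S (Suc k) = (\<lambda>\<omega>. S k \<omega> + \<eta> k \<omega>))"

definition payoff :: "nat \<Rightarrow> (nat \<Rightarrow> 'w \<Rightarrow> real) \<Rightarrow> (nat \<Rightarrow> 'w \<Rightarrow> real ^ 'l) \<Rightarrow> (nat \<Rightarrow> 'w \<Rightarrow> real ^ 'l) \<Rightarrow> real" where
  "payoff n \<sigma> S \<eta> = (\<Sum>k<n. gain (\<sigma> k) (S k) (\<sigma> (Suc k)) - cost (\<sigma> (Suc k)) (\<eta> k)) + gain (\<sigma> n) (S n) (\<lambda>_. T)"

lemma payoff_Suc:
  "payoff (Suc n) \<sigma> S \<eta> = gain (\<sigma> 0) (S 0) (\<sigma> (Suc 0)) - cost (\<sigma> (Suc 0)) (\<eta> 0) +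
     payoff n (\<lambda>k. \<sigma> (Suc k)) (\<lambda>k. S (Suc k)) (\<lambda>k. \<eta> (Suc k))"
  unfolding payoff_def by (subst sum.lessThan_Suc_shift) simp

lemma chain_Suc:
  assumes "chain (Suc n) \<sigma> S \<eta>"
  shows "chain n (\<lambda>k. \<sigma> (Suc k)) (\<lambda>k. S (Suc k)) (\<lambda>k. \<eta> (Suc k))"
proof -
  have "start_data M T B (\<sigma> (Suc 0)) (S (Suc 0))"
    using assms start_later[of "\<sigma> 0" "S 0" "\<sigma> (Suc 0)" "\<eta> 0"] by (auto simp: chain_def)
  then show ?thesis using assms by (auto simp: chain_def)
qed

lemma chain_start: "chain n \<sigma> S \<eta> \<Longrightarrow> k \<le> n \<Longrightarrow> start_data M T B (\<sigma> k) (S k)"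
proof (induction k)
  case (Suc k)
  then show ?case using start_later[of "\<sigma> k" "S k" "\<sigma> (Suc k)" "\<eta> k"] by (auto simp: chain_def)
qed (simp add: chain_def)

text \<open>The first impulse is peeled off: what follows is a chain with one impulse fewer, started
  at the first impulse time with the enlarged shift, so that \<open>step_le\<close> closes the
  induction.\<close>

lemma payoff_le: "chain n \<sigma> S \<eta> \<Longrightarrow> payoff n \<sigma> S \<eta> \<le> W n (\<sigma> 0) (S 0)"
proof (induction n arbitrary: \<sigma> S \<eta>)
  case 0
  then show ?case using W_0 by (simp add: payoff_def chain_def)
next
  case (Suc n)
  have "payoff n (\<lambda>k. \<sigma> (Suc k)) (\<lambda>k. S (Suc k)) (\<lambda>k. \<eta> (Suc k)) \<le> W n (\<sigma> (Suc 0)) (S (Suc 0))"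
    by (rule Suc.IH[OF chain_Suc[OF Suc.prems]])
  moreover have "S (Suc 0) = (\<lambda>\<omega>. S 0 \<omega> + \<eta> 0 \<omega>)" using Suc.prems by (simp add: chain_def)
  moreover have "gain (\<sigma> 0) (S 0) (\<sigma> (Suc 0)) - cost (\<sigma> (Suc 0)) (\<eta> 0) + W n (\<sigma> (Suc 0)) (\<lambda>\<omega>. S 0 \<omega> + \<eta> 0 \<omega>) \<le> W (Suc n) (\<sigma> 0) (S 0)"
    by (rule step_le) (use Suc.prems in \<open>auto simp: chain_def\<close>)
  ultimately show ?case by (simp add: payoff_Suc)
qed

text \<open>An optimal first impulse is put in front of an optimal chain for the data it leads to;
  \<open>case_nat\<close> performs this prepending.\<close>

lemma payoff_attained:
  "start_data M T B \<nu> \<xi> \<Longrightarrow> \<exists>\<sigma> S \<eta>. chain n \<sigma> S \<eta> \<and> \<sigma> 0 = \<nu> \<and> S 0 = \<xi> \<and> payoff n \<sigma> S \<eta> = W n \<nu> \<xi>"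
proof (induction n arbitrary: \<nu> \<xi>)
  case 0
  then show ?case using W_0
    by (intro exI[of _ "\<lambda>_. \<nu>"] exI[of _ "\<lambda>_. \<xi>"]) (simp add: payoff_def chain_def)
next
  case (Suc n)
  obtain \<tau> \<eta> where \<tau>: "stime \<tau>" "\<forall>\<omega>\<in>space M. \<nu> \<omega> \<le> \<tau> \<omega>" and \<eta>: "\<eta> \<in> borel_measurable (Fs \<tau>)" "\<forall>\<omega>\<in>space M. \<eta> \<omega> \<in> U"
    and eq: "gain \<nu> \<xi> \<tau> - cost \<tau> \<eta> + W n \<tau> (\<lambda>\<omega>. \<xi> \<omega> + \<eta> \<omega>) = W (Suc n) \<nu> \<xi>"
    using step_attained[OF Suc.prems, of n] by auto
  have "start_data M T B \<tau> (\<lambda>\<omega>. \<xi> \<omega> + \<eta> \<omega>)" using start_later[OF Suc.prems \<tau>(1)] \<tau> \<eta> by auto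
  from Suc.IH[OF this] obtain \<sigma> S e where c: "chain n \<sigma> S e" "\<sigma> 0 = \<tau>" "S 0 = (\<lambda>\<omega>. \<xi> \<omega> + \<eta> \<omega>)"
    "payoff n \<sigma> S e = W n \<tau> (\<lambda>\<omega>. \<xi> \<omega> + \<eta> \<omega>)" by auto
  let ?\<sigma> = "case_nat \<nu> \<sigma>" and ?S = "case_nat \<xi> S" and ?e = "case_nat \<eta> e"
  have "chain (Suc n) ?\<sigma> ?S ?e"
    using c \<tau> \<eta> Suc.prems unfolding chain_def by (auto simp: less_Suc_eq_0_disj)
  moreover have "payoff (Suc n) ?\<sigma> ?S ?e = W (Suc n) \<nu> \<xi>"
    using eq c by (simp add: payoff_Suc)
  ultimately show ?case by (intro exI[of _ ?\<sigma>] exI[of _ ?S] exI[of _ ?e]) simp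
qed

end

section \<open>Rewards of strategies\<close>

context impulse_control begin

text \<open>A countable sum of jointly measurable step functions; this is the input that
  \<open>running_h\<close> expects for the running reward of a strategy.\<close>

lemma controlled_measurable:
  assumes "\<delta> \<in> strategies M T B U"
  shows "(\<lambda>(s, \<omega>). controlled L \<delta> s \<omega>) \<in> borel_measurable (restrict_space borel {0..T} \<Otimes>\<^sub>M M)"
proof -
  have st: "stopping_time F (fst (\<delta> n))" and "snd (\<delta> n) \<in> borel_measurable (Fs (fst (\<delta> n)))" for n
    using assms by (auto simp: strategies_def)
  then have [measurable]: "fst (\<delta> n) \<in> borel_measurable M" "snd (\<delta> n) \<in> borel_measurable M" for n
    using stopping_measurable Fs_measurable by blast+
  have *: "(\<lambda>p. (if fst (\<delta> n) (snd p) \<le> fst p then 1 else 0) *\<^sub>R snd (\<delta> n) (snd p)) \<in> borel_measurable (restrict_space borel {0..T} \<Otimes>\<^sub>M M)" for n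
    by measurable
  have "(\<lambda>p. (\<lambda>(s, \<omega>). L s \<omega>) p + (\<Sum>n. (if fst (\<delta> n) (snd p) \<le> fst p then 1 else 0) *\<^sub>R snd (\<delta> n) (snd p)))
     \<in> borel_measurable (restrict_space borel {0..T} \<Otimes>\<^sub>M M)"
    using L_joint_measurable * by (intro borel_measurable_add borel_measurable_suminf)
  then show ?thesis
    by (simp add: controlled_def case_prod_unfold indicator_def of_bool_def)
qed

text \<open>Between consecutive impulse times the controlled process is \<open>L\<close> plus the
  impulses already made, which is the shift \<open>S k\<close>, so the running reward splits into
  the gains. From index \<open>n\<close> on all times equal \<open>T\<close>, which adds neither
  cost nor any displacement before \<open>T\<close>. The times of strategy and chain are matched
  only almost surely, as one side may have been corrected on a null set.\<close>

lemma reward_eq_payoff: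
  assumes \<delta>: "\<delta> \<in> strategies_upto M T B U n" and c: "chain n \<sigma> S \<eta>" and c0: "\<sigma> 0 = (\<lambda>_. 0)" "S 0 = (\<lambda>_. 0)"
    and times: "AE \<omega> in M. \<forall>k<n. fst (\<delta> k) \<omega> = \<sigma> (Suc k) \<omega>" and imp: "\<And>k. k < n \<Longrightarrow> snd (\<delta> k) = \<eta> k"
  shows "reward M T L h \<psi> \<delta> = payoff n \<sigma> S \<eta>"
proof -
  have \<delta>s: "\<delta> \<in> strategies M T B U" using \<delta> by (simp add: strategies_upto_def finite_strategies_def)
  let ?f = "\<lambda>s \<omega>. h s \<omega> (controlled L \<delta> s \<omega>)"
  let ?g = "\<lambda>k \<omega>. LINT s:{\<sigma> k \<omega>..\<sigma> (Suc k) \<omega>}|lborel. shifted_running_reward L h (\<sigma> k) (S k) s \<omega>"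
  let ?gT = "\<lambda>\<omega>. LINT s:{\<sigma> n \<omega>..T}|lborel. shifted_running_reward L h (\<sigma> n) (S n) s \<omega>"
  let ?c = "\<lambda>k \<omega>. \<psi> (\<eta> k \<omega>) * indicator {..<T} (\<sigma> (Suc k) \<omega>)"
  let ?X = "\<lambda>\<omega>. (LINT s:{0..T}|lborel. ?f s \<omega>) - (\<Sum>k. \<psi> (snd (\<delta> k) \<omega>) * indicator {..<T} (fst (\<delta> k) \<omega>))"
  let ?R = "\<lambda>\<omega>. (\<Sum>k<n. ?g k \<omega> - ?c k \<omega>) + ?gT \<omega>"
  have rf: "running ?f \<gamma>" by (rule running_h[OF controlled_measurable[OF \<delta>s]])
  have sd: "start_data M T B (\<sigma> k) (S k)" if "k \<le> n" for k using chain_start[OF c that] .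
  have rg: "running (shifted_running_reward L h (\<sigma> k) (S k)) \<gamma>" if "k \<le> n" for k by (rule running_shifted[OF sd[OF that]])
  have \<sigma>r: "0 \<le> \<sigma> k \<omega>" "\<sigma> k \<omega> \<le> T" if "k \<le> n" "\<omega> \<in> space M" for k \<omega>
    using stime_range[OF start_stime[OF sd[OF that(1)]] that(2)] .
  have \<sigma>mono: "\<sigma> k \<omega> \<le> \<sigma> (Suc k) \<omega>" if "k < n" "\<omega> \<in> space M" for k \<omega> using c that by (auto simp: chain_def)
  have SS: "k \<le> n \<Longrightarrow> S k \<omega> = (\<Sum>i<k. \<eta> i \<omega>)" for k \<omega>
  proof (induction k)
    case (Suc k)
    then have "S (Suc k) \<omega> = S k \<omega> + \<eta> k \<omega>" using c by (simp add: chain_def)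
    then show ?case using Suc by simp
  qed (simp add: c0)
  have eq: "AE \<omega> in M. ?X \<omega> = ?R \<omega>"
  proof -
    have "AE \<omega> in M. 0 \<le> fst (\<delta> 0) \<omega> \<and> (\<forall>n. fst (\<delta> n) \<omega> \<le> fst (\<delta> (Suc n)) \<omega> \<and> fst (\<delta> n) \<omega> \<le> T)"
      "AE \<omega> in M. fst (\<delta> n) \<omega> = T"
      using \<delta> by (auto simp: strategies_upto_def finite_strategies_def strategies_def)
    then show ?thesis using times AE_space
    proof eventually_elim
      case (elim \<omega>)
      define t where "t k = fst (\<delta> k) \<omega>" for k
      have tm: "t i \<le> t j" if "i \<le> j" for i j
        by (rule lift_Suc_mono_le[OF _ that]) (use elim(1) in \<open>simp add: t_def\<close>)
      have tT: "k \<ge> n \<Longrightarrow> t k = T" for k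
        using tm[of n k] elim(1,2) unfolding t_def by (metis order.antisym)
      have t\<sigma>: "k < n \<Longrightarrow> \<sigma> (Suc k) \<omega> = t k" for k using elim(3) by (simp add: t_def)
      \<comment> \<open>For \<open>s\<close> between \<open>\<sigma> k\<close> and
        \<open>t k\<close>, exactly the impulses with index below \<open>k\<close> have occurred, so
        the infinite sum is finite. The case \<open>k = n\<close> is the last stretch before
        \<open>T\<close>, because \<open>t n = T\<close>.\<close>
      have fs: "?f s \<omega> = shifted_running_reward L h (\<sigma> k) (S k) s \<omega>" if k: "k \<le> n" and s: "\<sigma> k \<omega> \<le> s" "s < t k" for k s
      proof -
        have t1: "t i \<le> s" if "i < k" for i
        proof -
          have "t i \<le> t (k - 1)" using that by (intro tm) auto
          also have "\<dots> = \<sigma> k \<omega>" using t\<sigma>[of "k - 1"] that k by simp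
          finally show ?thesis using s by simp
        qed
        have t2: "s < t i" if "i \<ge> k" for i using tm[OF that] s by simp
        have "(\<Sum>i. indicator {t i..} s *\<^sub>R snd (\<delta> i) \<omega>) = (\<Sum>i<k. indicator {t i..} s *\<^sub>R snd (\<delta> i) \<omega>)"
        proof (rule suminf_finite)
          fix i assume "i \<notin> {..<k}"
          then show "indicator {t i..} s *\<^sub>R snd (\<delta> i) \<omega> = 0" using t2[of i] by simp
        qed simp
        also have "\<dots> = (\<Sum>i<k. \<eta> i \<omega>)" using t1 imp k by (intro sum.cong) (auto simp: indicator_def)
        finally show ?thesis
          using s SS[OF k] by (simp add: controlled_def shifted_running_reward_def t_def)
      qed
      have split: "j \<le> n \<Longrightarrow> (LINT s:{0..T}|lborel. ?f s \<omega>) = (\<Sum>k<j. LINT s:{\<sigma> k \<omega>..\<sigma> (Suc k) \<omega>}|lborel. ?f s \<omega>) + (LINT s:{\<sigma> j \<omega>..T}|lborel. ?f s \<omega>)" for j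
      proof (induction j)
        case (Suc j)
        have "(LINT s:{\<sigma> j \<omega>..T}|lborel. ?f s \<omega>) = (LINT s:{\<sigma> j \<omega>..\<sigma> (Suc j) \<omega>}|lborel. ?f s \<omega>) + (LINT s:{\<sigma> (Suc j) \<omega>..T}|lborel. ?f s \<omega>)"
          by (rule running_integral_split[OF rf elim(4)]) (use Suc.prems \<sigma>r[OF _ elim(4)] \<sigma>mono[OF _ elim(4)] in auto)
        then show ?case using Suc by simp
      qed (simp add: c0)
      have g: "(LINT s:{\<sigma> k \<omega>..\<sigma> (Suc k) \<omega>}|lborel. ?f s \<omega>) = ?g k \<omega>" if "k < n" for k
        by (rule running_integral_cong[OF rf rg elim(4)]) (use fs[of k] that t\<sigma>[OF that] \<sigma>r(1)[of k, OF _ elim(4)] \<sigma>r(2)[of "Suc k", OF _ elim(4)] in auto)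
      have gT: "(LINT s:{\<sigma> n \<omega>..T}|lborel. ?f s \<omega>) = ?gT \<omega>"
        by (rule running_integral_cong[OF rf rg elim(4)]) (use fs[of n] tT[of n] \<sigma>r[OF _ elim(4)] in auto)
      have "(\<Sum>k. \<psi> (snd (\<delta> k) \<omega>) * indicator {..<T} (t k)) = (\<Sum>k<n. \<psi> (snd (\<delta> k) \<omega>) * indicator {..<T} (t k))"
        by (rule suminf_finite) (use tT in auto)
      also have "\<dots> = (\<Sum>k<n. ?c k \<omega>)" using imp t\<sigma> by (intro sum.cong) auto
      finally show ?case
        using split[of n] g gT by (simp add: t_def sum_subtractf)
    qed
  qed
  have ig: "integrable M (?g k)" if "k < n" for k
    using that c by (intro gain_integrable sd) (auto simp: chain_def)
  have ic: "integrable M (?c k)" if "k < n" for k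
  proof -
    have "stime (\<sigma> (Suc k))" "\<eta> k \<in> borel_measurable (Fs (\<sigma> (Suc k)))" "\<And>\<omega>. \<omega> \<in> space M \<Longrightarrow> \<eta> k \<omega> \<in> U"
      using that c by (auto simp: chain_def)
    then show ?thesis by (intro cost_integrable stopping_measurable Fs_measurable[OF stime_stopping] stime_stopping)
  qed
  have iT: "integrable M ?gT"
    using gain_integrable[OF sd[of n], of "\<lambda>_. T"] \<sigma>r T_pos by (simp add: stime_const)
  have iR: "integrable M ?R" using ig ic iT by (intro Bochner_Integration.integrable_add Bochner_Integration.integrable_sum Bochner_Integration.integrable_diff) auto
  \<comment> \<open>not automatic from \<open>eq\<close>: \<open>M\<close> need not be complete, and the integral of a non-measurable function is \<open>0\<close>\<close>
  have mX: "?X \<in> borel_measurable M"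
  proof (intro borel_measurable_diff borel_measurable_suminf borel_measurable_times)
    show "(\<lambda>\<omega>. LINT s:{0..T}|lborel. ?f s \<omega>) \<in> borel_measurable M"
      using running_integral_integrable[OF rf, of "\<lambda>_. 0" "\<lambda>_. T"] T_pos by (auto intro: borel_measurable_integrable)
    fix k
    have st: "stopping_time F (fst (\<delta> k))" "snd (\<delta> k) \<in> borel_measurable (Fs (fst (\<delta> k)))" "\<And>\<omega>. \<omega> \<in> space M \<Longrightarrow> snd (\<delta> k) \<omega> \<in> U"
      using \<delta>s by (auto simp: strategies_def)
    show "(\<lambda>\<omega>. \<psi> (snd (\<delta> k) \<omega>)) \<in> borel_measurable M"
      by (rule psi_measurable[OF Fs_measurable[OF st(1,2)] st(3)])
    show "(\<lambda>\<omega>. indicat_real {..<T} (fst (\<delta> k) \<omega>)) \<in> borel_measurable M"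
      using stopping_measurable[OF st(1)] by measurable
  qed
  have "reward M T L h \<psi> \<delta> = (\<integral>\<omega>. ?R \<omega> \<partial>M)"
    unfolding reward_def by (rule integral_cong_AE[OF mX borel_measurable_integrable[OF iR] eq])
  also have "\<dots> = (\<integral>\<omega>. (\<Sum>k<n. ?g k \<omega> - ?c k \<omega>) \<partial>M) + (\<integral>\<omega>. ?gT \<omega> \<partial>M)"
    using ig ic iT by (intro Bochner_Integration.integral_add Bochner_Integration.integrable_sum Bochner_Integration.integrable_diff) auto
  also have "(\<integral>\<omega>. (\<Sum>k<n. ?g k \<omega> - ?c k \<omega>) \<partial>M) = (\<Sum>k<n. \<integral>\<omega>. ?g k \<omega> - ?c k \<omega> \<partial>M)"
    using ig ic by (intro Bochner_Integration.integral_sum Bochner_Integration.integrable_diff) auto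
  also have "\<dots> = (\<Sum>k<n. gain (\<sigma> k) (S k) (\<sigma> (Suc k)) - cost (\<sigma> (Suc k)) (\<eta> k))"
    using ig ic by (intro sum.cong refl) (simp add: gain_def cost_def)
  finally show ?thesis by (simp add: payoff_def gain_def)
qed

lemma start_zero: "start_data M T B (\<lambda>_. 0) (\<lambda>_. 0)"
  using T_pos by (simp add: start_data_iff stime_const)

lemma reward_le:
  assumes \<delta>: "\<delta> \<in> strategies_upto M T B U n"
  shows "reward M T L h \<psi> \<delta> \<le> W n (\<lambda>_. 0) (\<lambda>_. 0)"
proof -
  have \<delta>s: "\<delta> \<in> strategies M T B U" using \<delta> by (simp add: strategies_upto_def finite_strategies_def)
  have st: "stopping_time F (fst (\<delta> k))" "snd (\<delta> k) \<in> borel_measurable (Fs (fst (\<delta> k)))" "\<And>\<omega>. \<omega> \<in> space M \<Longrightarrow> snd (\<delta> k) \<omega> \<in> U" for k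
    using \<delta>s by (auto simp: strategies_def)
  \<comment> \<open>A chain requires ordered times in \<open>[0, T]\<close> in every scenario, while
    a strategy guarantees this only almost surely.\<close>
  define \<sigma> where "\<sigma> = clipped_max T (\<lambda>k. fst (\<delta> k))"
  define S where "S k \<omega> = (\<Sum>i<k. snd (\<delta> i) \<omega>)" for k \<omega>
  have \<sigma>: "stime (\<sigma> k)" for k unfolding \<sigma>_def by (rule clipped_max_stime[OF st(1)])
  have "AE \<omega> in M. 0 \<le> fst (\<delta> 0) \<omega> \<and> (\<forall>n. fst (\<delta> n) \<omega> \<le> fst (\<delta> (Suc n)) \<omega> \<and> fst (\<delta> n) \<omega> \<le> T)"
    using \<delta>s by (simp add: strategies_def)
  then have times: "AE \<omega> in M. \<forall>k. fst (\<delta> k) \<omega> = \<sigma> (Suc k) \<omega>"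
  proof eventually_elim
    case (elim \<omega>)
    then show ?case unfolding \<sigma>_def by (subst clipped_max_eq) auto
  qed
  \<comment> \<open>The impulses are known at the original times; equality almost surely with the
    clipped ones transfers this, as the filtration is complete.\<close>
  have imp: "snd (\<delta> k) \<in> borel_measurable (Fs (\<sigma> (Suc k)))" for k
  proof (rule measurable_from_subalg[OF _ st(2)])
    have "AE \<omega> in M. fst (\<delta> k) \<omega> = \<sigma> (Suc k) \<omega>" using times by eventually_elim simp
    then show "subalgebra (Fs (\<sigma> (Suc k))) (Fs (fst (\<delta> k)))"
      unfolding subalgebra_def space_Fs by (intro conjI refl Fs_subset_AE_eq st(1) stime_stopping \<sigma>)
  qed
  have zero: "\<sigma> 0 = (\<lambda>_. 0)" "S 0 = (\<lambda>_. 0)" by (auto simp: \<sigma>_def S_def)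
  have "chain n \<sigma> S (\<lambda>k. snd (\<delta> k))"
    unfolding chain_def zero using start_zero \<sigma> imp st(3) by (auto simp: S_def) (simp add: \<sigma>_def)
  moreover have "AE \<omega> in M. \<forall>k<n. fst (\<delta> k) \<omega> = \<sigma> (Suc k) \<omega>" using times by eventually_elim simp
  ultimately show ?thesis
    using reward_eq_payoff[where \<sigma>=\<sigma> and S=S and \<eta>="\<lambda>k. snd (\<delta> k)", OF \<delta> _ zero] payoff_le[of n \<sigma> S "\<lambda>k. snd (\<delta> k)"] zero by simp
qed

lemma reward_attained:
  "\<exists>\<delta>\<in>strategies_upto M T B U n. reward M T L h \<psi> \<delta> = W n (\<lambda>_. 0) (\<lambda>_. 0)"
proof -
  obtain \<sigma> S \<eta> where c: "chain n \<sigma> S \<eta>" "\<sigma> 0 = (\<lambda>_. 0)" "S 0 = (\<lambda>_. 0)" "payoff n \<sigma> S \<eta> = W n (\<lambda>_. 0) (\<lambda>_. 0)"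
    using payoff_attained[OF start_zero, of n] by auto
  obtain u where u: "u \<in> U" using U by auto
  \<comment> \<open>After its \<open>n\<close> impulses the chain is continued by impulses at
    \<open>T\<close> with an arbitrary \<open>u\<close> from \<open>U\<close>; they are free and
    make the time with index \<open>n\<close> equal to \<open>T\<close>.\<close>
  define \<delta> where "\<delta> k = (if k < n then (\<sigma> (Suc k), \<eta> k) else (\<lambda>_. T, \<lambda>_. u))" for k
  have T: "stime (\<lambda>_. T)" using T_pos by (simp add: stime_const)
  have s: "stime (fst (\<delta> k))" "snd (\<delta> k) \<in> borel_measurable (Fs (fst (\<delta> k)))" "\<forall>\<omega>\<in>space M. snd (\<delta> k) \<omega> \<in> U" for k
    using c(1) T u by (auto simp: \<delta>_def chain_def)
  have le: "fst (\<delta> k) \<omega> \<le> fst (\<delta> (Suc k)) \<omega>" if "\<omega> \<in> space M" for k \<omega>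
  proof (cases "Suc k < n")
    case True
    then show ?thesis using c(1) that by (auto simp: \<delta>_def chain_def)
  next
    case False
    then show ?thesis using stime_range(2)[OF s(1) that] by (simp add: \<delta>_def)
  qed
  have "\<delta> \<in> strategies M T B U"
    unfolding strategies_def
  proof (intro CollectI conjI allI)
    show "AE \<omega> in M. 0 \<le> fst (\<delta> 0) \<omega> \<and> (\<forall>n. fst (\<delta> n) \<omega> \<le> fst (\<delta> (Suc n)) \<omega> \<and> fst (\<delta> n) \<omega> \<le> T)"
      using le stime_range[OF s(1)] by (intro AE_I2) auto
  qed (use s stime_stopping in auto)
  then have "\<delta> \<in> strategies_upto M T B U n"
  proof -
    have "{\<omega>\<in>space M. \<forall>k. fst (\<delta> k) \<omega> < T} = {}" by (auto simp: \<delta>_def intro!: exI[of _ n])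
    then have "measure M {\<omega>\<in>space M. \<forall>k. fst (\<delta> k) \<omega> < T} = 0" by (simp only: measure_empty)
    moreover have "AE \<omega> in M. fst (\<delta> n) \<omega> = T" by (simp add: \<delta>_def)
    ultimately show ?thesis using \<open>\<delta> \<in> strategies M T B U\<close> by (simp add: strategies_upto_def finite_strategies_def)
  qed
  moreover from reward_eq_payoff[OF this c(1,2,3)] have "reward M T L h \<psi> \<delta> = W n (\<lambda>_. 0) (\<lambda>_. 0)"
    using c(4) by (simp add: \<delta>_def)
  ultimately show ?thesis by blast
qed

text \<open>The initial value is measurable for the trivial \<open>F 0\<close>, so it equals its own
  mean almost surely, and this mean is \<open>W n\<close> at the zero data.\<close>

lemma Y_initial: "AE \<omega> in M. Y n (\<lambda>_. 0) (\<lambda>_. 0) 0 \<omega> = W n (\<lambda>_. 0) (\<lambda>_. 0)"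
proof -
  have "Y n (\<lambda>_. 0) (\<lambda>_. 0) 0 \<in> borel_measurable (F 0)"
    using T_pos by (intro progressive_adapted decomposed_path(1)[OF Y_decomposed[OF start_zero]]) auto
  then show ?thesis
    unfolding W_def using Y_stopped_integrable[OF start_zero start_stime[OF start_zero]] by (rule F0_const)
qed

lemma value_and_optimal_strategy:
  "(AE \<omega> in M. ereal (Y n (\<lambda>_. 0) (\<lambda>_. 0) 0 \<omega>) =
            (SUP \<delta>\<in>strategies_upto M T B U n. ereal (reward M T L h \<psi> \<delta>))) \<and>
         (\<exists>\<delta>\<in>strategies_upto M T B U n. ereal (reward M T L h \<psi> \<delta>) =
            (SUP \<delta>\<in>strategies_upto M T B U n. ereal (reward M T L h \<psi> \<delta>)))"
proof -
  obtain \<delta> where \<delta>: "\<delta> \<in> strategies_upto M T B U n" "reward M T L h \<psi> \<delta> = W n (\<lambda>_. 0) (\<lambda>_. 0)"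
    using reward_attained by blast
  have sup: "(SUP \<delta>\<in>strategies_upto M T B U n. ereal (reward M T L h \<psi> \<delta>)) = ereal (W n (\<lambda>_. 0) (\<lambda>_. 0))"
  proof (rule antisym)
    show "(SUP \<delta>\<in>strategies_upto M T B U n. ereal (reward M T L h \<psi> \<delta>)) \<le> ereal (W n (\<lambda>_. 0) (\<lambda>_. 0))"
      by (intro SUP_least) (simp add: reward_le)
    show "ereal (W n (\<lambda>_. 0) (\<lambda>_. 0)) \<le> (SUP \<delta>\<in>strategies_upto M T B U n. ereal (reward M T L h \<psi> \<delta>))"
      unfolding \<delta>(2)[symmetric] by (rule SUP_upper[OF \<delta>(1)])
  qed
  have "AE \<omega> in M. ereal (Y n (\<lambda>_. 0) (\<lambda>_. 0) 0 \<omega>) = (SUP \<delta>\<in>strategies_upto M T B U n. ereal (reward M T L h \<psi> \<delta>))"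
    unfolding sup using Y_initial by eventually_elim simp
  then show ?thesis using \<delta> sup by auto
qed

end

theorem proposition5p1:
  fixes M :: "'w measure" and T :: real
    and B :: "real \<Rightarrow> 'w \<Rightarrow> real ^ 'd::finite"
    and L :: "real \<Rightarrow> 'w \<Rightarrow> real ^ 'l::finite"
    and U :: "(real ^ 'l) set"
    and h :: "real \<Rightarrow> 'w \<Rightarrow> real ^ 'l \<Rightarrow> real" and \<gamma> :: real
    and \<psi> :: "real ^ 'l \<Rightarrow> real" and c :: real
    and Y :: "nat \<Rightarrow> ('w \<Rightarrow> real) \<Rightarrow> ('w \<Rightarrow> real ^ 'l) \<Rightarrow> real \<Rightarrow> 'w \<Rightarrow> real"
    and Z :: "nat \<Rightarrow> ('w \<Rightarrow> real) \<Rightarrow> ('w \<Rightarrow> real ^ 'l) \<Rightarrow> real \<Rightarrow> 'w \<Rightarrow> real ^ 'd"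
    and K :: "nat \<Rightarrow> ('w \<Rightarrow> real) \<Rightarrow> ('w \<Rightarrow> real ^ 'l) \<Rightarrow> real \<Rightarrow> 'w \<Rightarrow> real"
    and n :: nat
  assumes "prob_space M" and "T > 0"
    and "standard_brownian_motion M T B"
    and "L \<in> H2 M T B"
    and "finite U" and "U \<noteq> {}"
    and "(\<lambda>(p, x). h (fst p) (snd p) x)
           \<in> borel_measurable (progressive_sigma M T B \<Otimes>\<^sub>M borel)"
    and "\<And>t \<omega> x. t \<in> {0..T} \<Longrightarrow> \<omega> \<in> space M \<Longrightarrow> 0 \<le> h t \<omega> x \<and> h t \<omega> x \<le> \<gamma>"
    and "c > 0" and "\<And>\<beta>. \<beta> \<in> U \<Longrightarrow> c \<le> \<psi> \<beta>"
    and "\<And>\<nu> \<xi>. start_data M T B \<nu> \<xi> \<Longrightarrow>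
           bsde_solution M T B (shifted_running_reward L h \<nu> \<xi>) (Y 0 \<nu> \<xi>) (Z 0 \<nu> \<xi>)"
    and "\<And>m \<nu> \<xi>. m \<ge> 1 \<Longrightarrow> start_data M T B \<nu> \<xi> \<Longrightarrow>
           rbsde_solution M T B (shifted_running_reward L h \<nu> \<xi>)
             (impulse_obstacle U \<psi> (Y (m - 1)) \<nu> \<xi>) (Y m \<nu> \<xi>) (Z m \<nu> \<xi>) (K m \<nu> \<xi>)"
    and "n \<ge> 1"
  shows "(AE \<omega> in M. ereal (Y n (\<lambda>_. 0) (\<lambda>_. 0) 0 \<omega>) =
            (SUP \<delta>\<in>strategies_upto M T B U n. ereal (reward M T L h \<psi> \<delta>))) \<and>
         (\<exists>\<delta>\<in>strategies_upto M T B U n. ereal (reward M T L h \<psi> \<delta>) =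
            (SUP \<delta>\<in>strategies_upto M T B U n. ereal (reward M T L h \<psi> \<delta>)))"
proof -
  interpret impulse_control M T B L U h \<gamma> \<psi> Y Z K
  proof -
    interpret prob_space M by fact
    show "impulse_control M T B L U h \<gamma> \<psi> Y Z K"
      \<comment> \<open>The reflected equation is given for levels \<open>m \<ge> 1\<close> with
        obstacle from \<open>m - 1\<close>; taken at successors it has the form required by the
        locale.\<close>
      by unfold_locales (use assms(2-8) assms(11) assms(12)[of "Suc _"] in simp_all)
  qed
  show ?thesis by (rule value_and_optimal_strategy)
qed

end
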